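(* Let $u$ be an integer and let $X_u$ be a random profinite $\Gamma$-group with distribution $\mu_u$. Then for any finite admissible $\Gamma$-group $A$, $$\mathbb{E}\big(|\mathrm{Sur}_\Gamma(X_u,A)|\big)=\frac{1}{[A:A^\Gamma]^u}.$$
   Context: $\Gamma$ is a finite group with fixed generators $\gamma_1,\dots,\gamma_d$; $Y(g)=(g^{-1}\gamma_1(g),\dots,g^{-1}\gamma_d(g))$; $|\Gamma|'$ means order prime to $|\Gamma|$. A $\Gamma$-group is admissible if pro-$|\Gamma|'$ and topologically generated as a closed $\Gamma$-subgroup by $\{g^{-1}\gamma(g)\}$. For a set $\mathcal{C}$ of finite $\Gamma$-groups, $G^{\mathcal{C}}=\varprojlim G/M$ over closed normal $\Gamma$-subgroups $M$ with $G/M$ in the closure of $\mathcal{C}$ under finite direct products, $\Gamma$-subgroups and $\Gamma$-quotients. $\mathcal{P}$ is the set of isomorphism classes of admissible $\Gamma$-groups $G$ with $G^{\mathcal{C}}$ finite for all finite sets $\mathcal{C}$ of finite $|\Gamma|'$-$\Gamma$-groups, with basic opens $U_{\mathcal{C},H}=\{X:X^{\mathcal{C}}\cong H\}$. $X_{u,n}=\mathcal{F}_n/[Y(S)]$, $S$ being $n+u$ independent Haar-random elements of $\mathcal{F}_n$ (the closed $\Gamma$-subgroup generated by $\{x_i^{-1}\gamma_j(x_i)\}$ in the free pro-$|\Gamma|'$ group on $\{x_{i,\gamma}\}_{1\le i\le n,\gamma\in\Gamma}$ with $\sigma(x_{i,\gamma})=x_{i,\sigma\gamma}$, $x_i=x_{i,1}$),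 and $[Y(S)]$ the closed normal $\Gamma$-subgroup generated by coordinates of $Y(r)$, $r\in S$. $\mu_u$ is the Borel probability measure on $\mathcal{P}$ with $\mu_u(U)=\lim_{n\to\infty}\mathrm{Prob}(X_{u,n}\in U)$ on the algebra generated by basic opens. $\mathrm{Sur}_\Gamma$ denotes continuous $\Gamma$-equivariant surjections. *)

theory Defs
  imports "HOL-Probability.Probability" "HOL-Algebra.Product_Groups" "HOL-Algebra.Generated_Groups"
begin

section \<open>Profinite \<open>\<Gamma>\<close>-groups\<close>

record ('g, 'a) ggroup = "'a monoid" +
  gtop :: "'a topology"
  gact :: "'g \<Rightarrow> 'a \<Rightarrow> 'a"

definition profinite_ggroup :: "'g monoid \<Rightarrow> ('g, 'a) ggroup \<Rightarrow> bool" where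
  "profinite_ggroup \<Gamma> G \<longleftrightarrow>
     group G \<and>
     topspace (gtop G) = carrier G \<and>
     continuous_map (prod_topology (gtop G) (gtop G)) (gtop G) (\<lambda>(x, y). x \<otimes>\<^bsub>G\<^esub> y) \<and>
     continuous_map (gtop G) (gtop G) (\<lambda>x. inv\<^bsub>G\<^esub> x) \<and>
     compact_space (gtop G) \<and> Hausdorff_space (gtop G) \<and>
     (\<forall>S. connectedin (gtop G) S \<longrightarrow> (\<exists>a. S \<subseteq> {a})) \<and>
     (\<forall>\<sigma>\<in>carrier \<Gamma>. gact G \<sigma> \<in> hom G G \<and> continuous_map (gtop G) (gtop G) (gact G \<sigma>)) \<and>
     (\<forall>x\<in>carrier G. gact G \<one>\<^bsub>\<Gamma>\<^esub> x = x) \<and>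
     (\<forall>\<sigma>\<in>carrier \<Gamma>. \<forall>\<tau>\<in>carrier \<Gamma>. \<forall>x\<in>carrier G.
        gact G (\<sigma> \<otimes>\<^bsub>\<Gamma>\<^esub> \<tau>) x = gact G \<sigma> (gact G \<tau> x))"

definition pro_prime_ggroup :: "'g monoid \<Rightarrow> ('g, 'a) ggroup \<Rightarrow> bool" where
  "pro_prime_ggroup \<Gamma> G \<longleftrightarrow>
     profinite_ggroup \<Gamma> G \<and>
     (\<forall>N. N \<lhd> G \<and> openin (gtop G) N \<longrightarrow> coprime (card (rcosets\<^bsub>G\<^esub> N)) (order \<Gamma>))"

definition gequivariant ::
  "'g monoid \<Rightarrow> ('g, 'a) ggroup \<Rightarrow> ('g, 'b) ggroup \<Rightarrow> ('a \<Rightarrow> 'b) \<Rightarrow> bool" where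
  "gequivariant \<Gamma> G H f \<longleftrightarrow>
     (\<forall>\<sigma>\<in>carrier \<Gamma>. \<forall>x\<in>carrier G. f (gact G \<sigma> x) = gact H \<sigma> (f x))"

definition giso :: "'g monoid \<Rightarrow> ('g, 'a) ggroup \<Rightarrow> ('g, 'b) ggroup \<Rightarrow> bool" where
  "giso \<Gamma> G H \<longleftrightarrow>
     (\<exists>f. f \<in> iso G H \<and> homeomorphic_map (gtop G) (gtop H) f \<and> gequivariant \<Gamma> G H f)"

text \<open>Maps are restricted to the carrier (\<open>extensional\<close>) so that they can be counted.\<close>

definition gSur :: "'g monoid \<Rightarrow> ('g, 'a) ggroup \<Rightarrow> ('g, 'b) ggroup \<Rightarrow> ('a \<Rightarrow> 'b) set" where
  "gSur \<Gamma> G A =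
     {f \<in> extensional (carrier G).
        f \<in> epi G A \<and> continuous_map (gtop G) (gtop A) f \<and> gequivariant \<Gamma> G A f}"

definition ginvariants :: "'g monoid \<Rightarrow> ('g, 'a) ggroup \<Rightarrow> 'a set" where
  "ginvariants \<Gamma> G = {x \<in> carrier G. \<forall>\<sigma>\<in>carrier \<Gamma>. gact G \<sigma> x = x}"

subsection \<open>Subgroups, quotients, products\<close>

definition gstable :: "'g monoid \<Rightarrow> ('g, 'a) ggroup \<Rightarrow> 'a set \<Rightarrow> bool" where
  "gstable \<Gamma> G H \<longleftrightarrow> (\<forall>\<sigma>\<in>carrier \<Gamma>. gact G \<sigma> ` H \<subseteq> H)"

definition closed_gsubgroup :: "'g monoid \<Rightarrow> ('g, 'a) ggroup \<Rightarrow> 'a set \<Rightarrow> bool" where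
  "closed_gsubgroup \<Gamma> G H \<longleftrightarrow> subgroup H G \<and> closedin (gtop G) H \<and> gstable \<Gamma> G H"

definition closed_normal_gsubgroup :: "'g monoid \<Rightarrow> ('g, 'a) ggroup \<Rightarrow> 'a set \<Rightarrow> bool" where
  "closed_normal_gsubgroup \<Gamma> G N \<longleftrightarrow> N \<lhd> G \<and> closedin (gtop G) N \<and> gstable \<Gamma> G N"

definition closed_gsubgroup_gen :: "'g monoid \<Rightarrow> ('g, 'a) ggroup \<Rightarrow> 'a set \<Rightarrow> 'a set" where
  "closed_gsubgroup_gen \<Gamma> G S = \<Inter> {H. closed_gsubgroup \<Gamma> G H \<and> S \<subseteq> H}"

definition closed_normal_gsubgroup_gen :: "'g monoid \<Rightarrow> ('g, 'a) ggroup \<Rightarrow> 'a set \<Rightarrow> 'a set" where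
  "closed_normal_gsubgroup_gen \<Gamma> G S = \<Inter> {N. closed_normal_gsubgroup \<Gamma> G N \<and> S \<subseteq> N}"

definition gsub :: "('g, 'a) ggroup \<Rightarrow> 'a set \<Rightarrow> ('g, 'a) ggroup" where
  "gsub G H = G\<lparr>carrier := H, gtop := subtopology (gtop G) H\<rparr>"

definition gquot_top :: "('g, 'a) ggroup \<Rightarrow> 'a set \<Rightarrow> 'a set topology" where
  "gquot_top G N =
     topology (\<lambda>U. U \<subseteq> rcosets\<^bsub>G\<^esub> N \<and> openin (gtop G) {x \<in> topspace (gtop G). N #>\<^bsub>G\<^esub> x \<in> U})"

definition gquot :: "('g, 'a) ggroup \<Rightarrow> 'a set \<Rightarrow> ('g, 'a set) ggroup" where
  "gquot G N = monoid.extend (G Mod N) (ggroup.fields (gquot_top G N) (\<lambda>\<sigma> K. gact G \<sigma> ` K))"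

definition gprod :: "'i set \<Rightarrow> ('i \<Rightarrow> ('g, 'a) ggroup) \<Rightarrow> ('g, 'i \<Rightarrow> 'a) ggroup" where
  "gprod I G = monoid.extend (product_group I G)
     (ggroup.fields (product_topology (\<lambda>i. gtop (G i)) I) (\<lambda>\<sigma> f. \<lambda>i\<in>I. gact (G i) \<sigma> (f i)))"

lemma openin_gquot_top:
  "openin (gquot_top G N) U \<longleftrightarrow>
     U \<subseteq> rcosets\<^bsub>G\<^esub> N \<and> openin (gtop G) {x \<in> topspace (gtop G). N #>\<^bsub>G\<^esub> x \<in> U}"
proof -
  let ?T = "\<lambda>U. {x \<in> topspace (gtop G). N #>\<^bsub>G\<^esub> x \<in> U}"
  have "?T (U \<inter> V) = ?T U \<inter> ?T V" "?T (\<Union>K) = (\<Union>U\<in>K. ?T U)" for U V K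
    by auto
  then have "istopology (\<lambda>U. U \<subseteq> rcosets\<^bsub>G\<^esub> N \<and> openin (gtop G) (?T U))"
    unfolding istopology_def by (auto intro!: openin_Int openin_Union)
  then show ?thesis
    by (simp add: gquot_top_def topology_inverse')
qed

subsection \<open>Admissible \<open>\<Gamma>\<close>-groups\<close>

definition admissible :: "'g monoid \<Rightarrow> ('g, 'a) ggroup \<Rightarrow> bool" where
  "admissible \<Gamma> G \<longleftrightarrow>
     pro_prime_ggroup \<Gamma> G \<and>
     closed_gsubgroup_gen \<Gamma> G {inv\<^bsub>G\<^esub> g \<otimes>\<^bsub>G\<^esub> gact G \<sigma> g | g \<sigma>. g \<in> carrier G \<and> \<sigma> \<in> carrier \<Gamma>}
       = carrier G"

section \<open>The completion \<open>G\<^sup>C\<close>\<close>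

text \<open>Up to isomorphism every finite \<open>\<Gamma>\<close>-group has its carrier in \<^typ>\<open>nat\<close>. Finite direct
  products include the empty one, so that the trivial group always belongs to the closure.\<close>

inductive_set gclosure :: "'g monoid \<Rightarrow> ('g, nat) ggroup set \<Rightarrow> ('g, nat) ggroup set"
  for \<Gamma> :: "'g monoid" and C :: "('g, nat) ggroup set" where
  base: "\<lbrakk>K \<in> C; profinite_ggroup \<Gamma> H; giso \<Gamma> K H\<rbrakk> \<Longrightarrow> H \<in> gclosure \<Gamma> C"
| prod: "\<lbrakk>finite (I :: nat set); \<forall>i\<in>I. K i \<in> gclosure \<Gamma> C;
          profinite_ggroup \<Gamma> H; giso \<Gamma> (gprod I K) H\<rbrakk> \<Longrightarrow> H \<in> gclosure \<Gamma> C"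
| sub: "\<lbrakk>K \<in> gclosure \<Gamma> C; closed_gsubgroup \<Gamma> K L;
         profinite_ggroup \<Gamma> H; giso \<Gamma> (gsub K L) H\<rbrakk> \<Longrightarrow> H \<in> gclosure \<Gamma> C"
| quot: "\<lbrakk>K \<in> gclosure \<Gamma> C; closed_normal_gsubgroup \<Gamma> K N;
          profinite_ggroup \<Gamma> H; giso \<Gamma> (gquot K N) H\<rbrakk> \<Longrightarrow> H \<in> gclosure \<Gamma> C"

definition gcompl_index :: "'g monoid \<Rightarrow> ('g, 'a) ggroup \<Rightarrow> ('g, nat) ggroup set \<Rightarrow> 'a set set" where
  "gcompl_index \<Gamma> G C =
     {M. closed_normal_gsubgroup \<Gamma> G M \<and> (\<exists>H\<in>gclosure \<Gamma> C. giso \<Gamma> (gquot G M) H)}"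

text \<open>The inverse limit of the quotients \<open>G/M\<close>: for \<open>M \<subseteq> M'\<close> the transition map
  sends a coset of \<open>M\<close> to the unique coset of \<open>M'\<close> that contains it.\<close>

definition gcompl :: "'g monoid \<Rightarrow> ('g, 'a) ggroup \<Rightarrow> ('g, nat) ggroup set \<Rightarrow> ('g, 'a set \<Rightarrow> 'a set) ggroup"
  where
  "gcompl \<Gamma> G C =
     (let I = gcompl_index \<Gamma> G C; Q = gprod I (gquot G)
      in gsub Q {f \<in> carrier Q. \<forall>M\<in>I. \<forall>M'\<in>I. M \<subseteq> M' \<longrightarrow> f M \<subseteq> f M'})"

definition level_set :: "'g monoid \<Rightarrow> ('g, nat) ggroup set \<Rightarrow> bool" where
  "level_set \<Gamma> C \<longleftrightarrow> finite C \<and> (\<forall>K\<in>C. pro_prime_ggroup \<Gamma> K \<and> finite (carrier K))"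

section \<open>The space \<open>\<P>\<close>\<close>

text \<open>If \<open>G\<^sup>C\<close> is finite for all \<open>C\<close> as above, then \<open>G\<close> has only countably many open normal
  \<open>\<Gamma>\<close>-subgroups, so it embeds into a countable product of finite sets. Hence all
  isomorphism classes in question are represented by groups with carrier in
  \<^typ>\<open>nat \<Rightarrow> nat\<close>, and an isomorphism class is rendered as the set of its members with such a
  carrier. The function \<open>gclass\<close> accepts groups over arbitrary types.\<close>

type_synonym 'g gclass = "('g, nat \<Rightarrow> nat) ggroup set"

definition gclass :: "'g monoid \<Rightarrow> ('g, 'a) ggroup \<Rightarrow> 'g gclass" where
  "gclass \<Gamma> G = {H. profinite_ggroup \<Gamma> H \<and> giso \<Gamma> G H}"

definition P_groups :: "'g monoid \<Rightarrow> ('g, nat \<Rightarrow> nat) ggroup set" where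
  "P_groups \<Gamma> = {G. admissible \<Gamma> G \<and> (\<forall>C. level_set \<Gamma> C \<longrightarrow> finite (carrier (gcompl \<Gamma> G C)))}"

definition P_space :: "'g monoid \<Rightarrow> 'g gclass set" where
  "P_space \<Gamma> = gclass \<Gamma> ` P_groups \<Gamma>"

definition P_basic :: "'g monoid \<Rightarrow> ('g, nat) ggroup set \<Rightarrow> ('g, nat) ggroup \<Rightarrow> 'g gclass set" where
  "P_basic \<Gamma> C H = gclass \<Gamma> ` {G \<in> P_groups \<Gamma>. giso \<Gamma> (gcompl \<Gamma> G C) H}"

definition P_basics :: "'g monoid \<Rightarrow> 'g gclass set set" where
  "P_basics \<Gamma> =
     {P_basic \<Gamma> C H | C H. level_set \<Gamma> C \<and> pro_prime_ggroup \<Gamma> H \<and> finite (carrier H)}"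

definition P_top :: "'g monoid \<Rightarrow> 'g gclass topology" where
  "P_top \<Gamma> = topology_generated_by (P_basics \<Gamma>)"

definition P_algebra :: "'g monoid \<Rightarrow> 'g gclass set set" where
  "P_algebra \<Gamma> = \<Inter> {\<A>. Sigma_Algebra.algebra (P_space \<Gamma>) \<A> \<and> P_basics \<Gamma> \<subseteq> \<A>}"

definition borel_of :: "'a topology \<Rightarrow> 'a measure" where
  "borel_of T = sigma (topspace T) {U. openin T U}"

text \<open>\<open>|Sur\<^sub>\<Gamma>(X, A)|\<close> does not depend on the representative of the class \<open>X\<close>.\<close>

definition gSur_class :: "'g monoid \<Rightarrow> 'g gclass \<Rightarrow> ('g, 'b) ggroup \<Rightarrow> ((nat \<Rightarrow> nat) \<Rightarrow> 'b) set" where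
  "gSur_class \<Gamma> X A = gSur \<Gamma> (SOME G. G \<in> X) A"

section \<open>Free groups and the random groups \<open>X\<^sub>u\<^sub>,\<^sub>n\<close>\<close>

text \<open>The free pro-\<open>|\<Gamma>|'\<close> group on the symbols \<open>(i, \<gamma>)\<close> with \<open>i < n\<close>, \<open>\<gamma> \<in> \<Gamma>\<close> is realised inside the
  product, over all maps \<open>f\<close> from the symbols to a finite \<open>|\<Gamma>|'\<close>-group \<open>H\<close>, of the groups \<open>H\<close>
  (discrete; up to isomorphism \<open>H\<close> has carrier in \<^typ>\<open>nat\<close>), as the closed subgroup generated by
  the tautological elements \<open>(H, f) \<mapsto> f (i, \<gamma>)\<close>. The homomorphism extending \<open>f\<close> is the
  projection to the factor \<open>(H, f)\<close>; see the lemmas below. The action that sends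
  \<open>(i, \<gamma>)\<close> to \<open>(i, \<sigma> \<gamma>)\<close> is by reindexing of the factors.\<close>

definition free_index :: "'g monoid \<Rightarrow> nat \<Rightarrow> (nat monoid \<times> (nat \<times> 'g \<Rightarrow> nat)) set" where
  "free_index \<Gamma> n =
     {(H, f). group H \<and> finite (carrier H) \<and> coprime (order H) (order \<Gamma>) \<and>
              f \<in> ({..<n} \<times> carrier \<Gamma>) \<rightarrow>\<^sub>E carrier H}"

type_synonym 'g free_elem = "nat monoid \<times> (nat \<times> 'g \<Rightarrow> nat) \<Rightarrow> nat"

definition free_ambient :: "'g monoid \<Rightarrow> nat \<Rightarrow> ('g, 'g free_elem) ggroup" where
  "free_ambient \<Gamma> n = monoid.extend (product_group (free_index \<Gamma> n) fst)
     (ggroup.fields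
        (product_topology (\<lambda>(H, f). discrete_topology (carrier H)) (free_index \<Gamma> n))
        (\<lambda>\<sigma> w. \<lambda>(H, f)\<in>free_index \<Gamma> n.
            w (H, \<lambda>(i, \<gamma>)\<in>{..<n} \<times> carrier \<Gamma>. f (i, \<sigma> \<otimes>\<^bsub>\<Gamma>\<^esub> \<gamma>))))"

definition free_gen :: "'g monoid \<Rightarrow> nat \<Rightarrow> nat \<Rightarrow> 'g \<Rightarrow> 'g free_elem" where
  "free_gen \<Gamma> n i \<gamma> = (\<lambda>(H, f)\<in>free_index \<Gamma> n. f (i, \<gamma>))"

lemma free_proj_hom:
  assumes "(H, f) \<in> free_index \<Gamma> n"
  shows "(\<lambda>w. w (H, f)) \<in> hom (free_ambient \<Gamma> n) H"
  using assms
  by (force simp: free_ambient_def product_group_def monoid.defs ggroup.defs hom_def PiE_iff)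

lemma free_proj_continuous:
  assumes "(H, f) \<in> free_index \<Gamma> n"
  shows "continuous_map (gtop (free_ambient \<Gamma> n)) (discrete_topology (carrier H)) (\<lambda>w. w (H, f))"
  using continuous_map_product_projection[OF assms, of "\<lambda>(H, f). discrete_topology (carrier H)"]
  by (simp add: free_ambient_def monoid.defs ggroup.defs)

lemma free_proj_gen:
  assumes "(H, f) \<in> free_index \<Gamma> n"
  shows "free_gen \<Gamma> n i \<gamma> (H, f) = f (i, \<gamma>)"
  using assms by (simp add: free_gen_def)

lemma gact_free_gen:
  assumes "group \<Gamma>" "\<sigma> \<in> carrier \<Gamma>" "\<gamma> \<in> carrier \<Gamma>" "i < n"
  shows "gact (free_ambient \<Gamma> n) \<sigma> (free_gen \<Gamma> n i \<gamma>) = free_gen \<Gamma> n i (\<sigma> \<otimes>\<^bsub>\<Gamma>\<^esub> \<gamma>)"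
proof
  fix p :: "nat monoid \<times> (nat \<times> 'a \<Rightarrow> nat)"
  obtain H f where p: "p = (H, f)" by (cases p)
  let ?f = "\<lambda>(i, \<gamma>)\<in>{..<n} \<times> carrier \<Gamma>. f (i, \<sigma> \<otimes>\<^bsub>\<Gamma>\<^esub> \<gamma>)"
  have "(H, ?f) \<in> free_index \<Gamma> n" if "(H, f) \<in> free_index \<Gamma> n"
    using that assms by (auto simp: free_index_def PiE_iff extensional_def group.is_monoid monoid.m_closed)
  then show "gact (free_ambient \<Gamma> n) \<sigma> (free_gen \<Gamma> n i \<gamma>) p = free_gen \<Gamma> n i (\<sigma> \<otimes>\<^bsub>\<Gamma>\<^esub> \<gamma>) p"
    using assms by (auto simp: p free_ambient_def free_gen_def monoid.defs ggroup.defs)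
qed

definition free_ggroup :: "'g monoid \<Rightarrow> nat \<Rightarrow> ('g, 'g free_elem) ggroup" where
  "free_ggroup \<Gamma> n =
     gsub (free_ambient \<Gamma> n)
       (gtop (free_ambient \<Gamma> n) closure_of
          generate (free_ambient \<Gamma> n) {free_gen \<Gamma> n i \<gamma> | i \<gamma>. i < n \<and> \<gamma> \<in> carrier \<Gamma>})"

definition Fn :: "'g monoid \<Rightarrow> 'g list \<Rightarrow> nat \<Rightarrow> ('g, 'g free_elem) ggroup" where
  "Fn \<Gamma> gs n =
     (let F = free_ggroup \<Gamma> n; x = (\<lambda>i. free_gen \<Gamma> n i \<one>\<^bsub>\<Gamma>\<^esub>)
      in gsub F (closed_gsubgroup_gen \<Gamma> F
           {inv\<^bsub>F\<^esub> (x i) \<otimes>\<^bsub>F\<^esub> gact F \<gamma> (x i) | i \<gamma>. i < n \<and> \<gamma> \<in> set gs}))"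

definition Ymap :: "'g list \<Rightarrow> ('g, 'a) ggroup \<Rightarrow> 'a \<Rightarrow> 'a list" where
  "Ymap gs G g = map (\<lambda>\<gamma>. inv\<^bsub>G\<^esub> g \<otimes>\<^bsub>G\<^esub> gact G \<gamma> g) gs"

definition Xun :: "'g monoid \<Rightarrow> 'g list \<Rightarrow> nat \<Rightarrow> 'g free_elem set \<Rightarrow> ('g, 'g free_elem set) ggroup" where
  "Xun \<Gamma> gs n S =
     gquot (Fn \<Gamma> gs n)
       (closed_normal_gsubgroup_gen \<Gamma> (Fn \<Gamma> gs n) (\<Union>r\<in>S. set (Ymap gs (Fn \<Gamma> gs n) r)))"

definition haar_prob :: "('g, 'a) ggroup \<Rightarrow> 'a measure \<Rightarrow> bool" where
  "haar_prob G \<nu> \<longleftrightarrow>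
     prob_space \<nu> \<and> sets \<nu> = sets (borel_of (gtop G)) \<and>
     (\<forall>g\<in>carrier G. \<forall>B\<in>sets \<nu>. emeasure \<nu> (g <#\<^bsub>G\<^esub> B) = emeasure \<nu> B)"

text \<open>In the following two definitions \<open>\<nu>\<close> is the Haar probability measure of \<^term>\<open>Fn \<Gamma> gs n\<close>,
  respectively the sequence of these measures. The number \<open>n + u\<close> of relators is negative
  for finitely many \<open>n\<close> only, where the truncation by \<^const>\<open>nat\<close> does not affect the limit.\<close>

definition Xun_prob ::
  "'g monoid \<Rightarrow> 'g list \<Rightarrow> 'g free_elem measure \<Rightarrow> int \<Rightarrow> nat \<Rightarrow> 'g gclass set \<Rightarrow> real" where
  "Xun_prob \<Gamma> gs \<nu> u n U =
     (let k = nat (int n + u); M = PiM {..<k} (\<lambda>_. \<nu>)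
      in measure M {r \<in> space M. gclass \<Gamma> (Xun \<Gamma> gs n (r ` {..<k})) \<in> U})"

definition is_mu ::
  "'g monoid \<Rightarrow> 'g list \<Rightarrow> (nat \<Rightarrow> 'g free_elem measure) \<Rightarrow> int \<Rightarrow> 'g gclass measure \<Rightarrow> bool" where
  "is_mu \<Gamma> gs \<nu> u \<mu> \<longleftrightarrow>
     prob_space \<mu> \<and> sets \<mu> = sets (borel_of (P_top \<Gamma>)) \<and>
     (\<forall>U\<in>P_algebra \<Gamma>. (\<lambda>n. Xun_prob \<Gamma> gs (\<nu> n) u n U) \<longlonglongrightarrow> measure \<mu> U)"

end

theory Submission
  imports Defs "HOL-Algebra.Multiplicative_Group"
begin

text \<open>
  A \<open>\<Gamma>\<close>-surjection \<open>\<F>\<^sub>n \<rightarrow> A\<close> pushes Haar measure forward to the uniform measure, so it kills \<open>Y(r)\<close> for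
  a random \<open>r\<close> with probability \<open>1/[A : A\<^sup>\<Gamma>]\<close>, and the mean number of surjections \<open>X\<^sub>u\<^sub>,\<^sub>n \<rightarrow> A\<close> is
  \<open>|Sur(\<F>\<^sub>n, A)| / [A : A\<^sup>\<Gamma>]\<^sup>n\<^sup>+\<^sup>u\<close>. Since \<open>\<F>\<^sub>n\<close> is free on \<open>n\<close> cocycles, \<open>|Hom(\<F>\<^sub>n, A)| = |Z\<^sup>1(\<Gamma>, A)|\<^sup>n\<close>, and
  for admissible \<open>A\<close> almost all of these homomorphisms are surjective. If \<open>H\<^sup>1(\<Gamma>, A)\<close> vanishes, then
  \<open>|Z\<^sup>1(\<Gamma>, A)| = [A : A\<^sup>\<Gamma>]\<close> and the means tend to \<open>[A : A\<^sup>\<Gamma>]\<^sup>-\<^sup>u\<close>. The limit and the expectation may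
  be interchanged because the second moments, which count \<open>\<Gamma>\<close>-homomorphisms to \<open>A \<times> A\<close> by their
  image, are bounded. The number of surjections to \<open>A\<close> depends only on the completion at \<open>{A}\<close>, which
  takes countably many values, so that convergence on basic open sets is all that is needed.
\<close>

text \<open>The vanishing of H^1(\<Gamma>, D) is needed not only for A but for every
  \<Gamma>-subgroup D of A \<times> A: the term |Z^1(\<Gamma>, D)|^n / [D : D^\<Gamma>]^(n+u) of the
  second moment is bounded in n precisely when every cocycle is a coboundary. The usual proof uses
  that one of two coprime orders is odd, hence belongs to a solvable group. Here the vanishing is
  extracted from the hypothesis that the limit law has total mass one. Triviality of H^1 passes to
  extensions, and a \<Gamma>-simple group either carries the trivial action or is admissible. For an
  admissible \<Gamma>-simple B with nontrivial H^1 the mean number of surjections to B would grow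
  like (|Z^1| / [B : B^\<Gamma>])^n, with variance at most a constant times the mean by Goursat's
  lemma, so that the number would leave every bounded range. A second obstacle is that the events
  "the class of X_{u,n} lies in U" are not known to be measurable. The number of surjections from
  X_{u,n} is therefore expressed through Haar-measurable conditions on the relators, and the events
  enter only through their limiting probabilities.\<close>

section \<open>Topological \<Gamma>-groups and the closed \<Gamma>-subgroups generated by a
  set\<close>

locale topological_ggroup = group G for \<Gamma> :: "'g monoid" and G :: "('g, 'a) ggroup" (structure) +
  assumes topspace_gtop: "topspace (gtop G) = carrier G"
    and continuous_mult: "continuous_map (prod_topology (gtop G) (gtop G)) (gtop G) (\<lambda>(x, y). x \<otimes> y)"
    and continuous_inv: "continuous_map (gtop G) (gtop G) (\<lambda>x. inv x)"
    and gact_hom: "\<sigma> \<in> carrier \<Gamma> \<Longrightarrow> gact G \<sigma> \<in> hom G G"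
    and continuous_gact: "\<sigma> \<in> carrier \<Gamma> \<Longrightarrow> continuous_map (gtop G) (gtop G) (gact G \<sigma>)"
    and gact_one: "x \<in> carrier G \<Longrightarrow> gact G \<one>\<^bsub>\<Gamma>\<^esub> x = x"
    and gact_comp: "\<lbrakk>\<sigma> \<in> carrier \<Gamma>; \<tau> \<in> carrier \<Gamma>; x \<in> carrier G\<rbrakk> \<Longrightarrow>
        gact G (\<sigma> \<otimes>\<^bsub>\<Gamma>\<^esub> \<tau>) x = gact G \<sigma> (gact G \<tau> x)"
begin

lemma gact_closed [simp]: "\<lbrakk>\<sigma> \<in> carrier \<Gamma>; x \<in> carrier G\<rbrakk> \<Longrightarrow> gact G \<sigma> x \<in> carrier G"
  using gact_hom by (auto simp: hom_def)

lemma gact_mult: "\<lbrakk>\<sigma> \<in> carrier \<Gamma>; x \<in> carrier G; y \<in> carrier G\<rbrakk> \<Longrightarrow>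
    gact G \<sigma> (x \<otimes> y) = gact G \<sigma> x \<otimes> gact G \<sigma> y"
  using gact_hom by (auto simp: hom_def)

lemma gact_group_hom: "\<sigma> \<in> carrier \<Gamma> \<Longrightarrow> group_hom G G (gact G \<sigma>)"
  by (simp add: gact_hom group_hom.intro group_hom_axioms.intro)

lemma gact_1 [simp]: "\<sigma> \<in> carrier \<Gamma> \<Longrightarrow> gact G \<sigma> \<one> = \<one>"
  using group_hom.hom_one[OF gact_group_hom] .

lemma gact_inv: "\<lbrakk>\<sigma> \<in> carrier \<Gamma>; x \<in> carrier G\<rbrakk> \<Longrightarrow> gact G \<sigma> (inv x) = inv (gact G \<sigma> x)"
  using group_hom.hom_inv[OF gact_group_hom] .

lemma ginvariants_subgroup: "subgroup (ginvariants \<Gamma> G) G"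
proof (rule subgroupI)
  have "\<one> \<in> ginvariants \<Gamma> G" by (simp add: ginvariants_def)
  then show "ginvariants \<Gamma> G \<noteq> {}" by blast
qed (auto simp: ginvariants_def gact_mult gact_inv)

lemma closed_gsubgroup_carrier: "closed_gsubgroup \<Gamma> G (carrier G)"
  unfolding closed_gsubgroup_def gstable_def
  using closedin_topspace[of "gtop G"] by (simp add: topspace_gtop subgroup_self image_subset_iff)

lemma closed_normal_gsubgroup_carrier: "closed_normal_gsubgroup \<Gamma> G (carrier G)"
  unfolding closed_normal_gsubgroup_def gstable_def
  using closedin_topspace[of "gtop G"]
  by (simp add: topspace_gtop normal_invI subgroup_self image_subset_iff)

lemma closed_gsubgroup_gen:
  assumes "S \<subseteq> carrier G"
  shows "closed_gsubgroup \<Gamma> G (closed_gsubgroup_gen \<Gamma> G S)" (is "closed_gsubgroup _ _ ?K")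
    and "S \<subseteq> closed_gsubgroup_gen \<Gamma> G S"
proof -
  let ?F = "{H. closed_gsubgroup \<Gamma> G H \<and> S \<subseteq> H}"
  have ne: "carrier G \<in> ?F" using closed_gsubgroup_carrier assms by auto
  have "subgroup ?K G" unfolding closed_gsubgroup_gen_def
    by (rule subgroups_Inter) (use ne in \<open>auto simp: closed_gsubgroup_def\<close>)
  moreover have "closedin (gtop G) ?K" unfolding closed_gsubgroup_gen_def
    by (rule closedin_Inter) (use ne in \<open>auto simp: closed_gsubgroup_def\<close>)
  moreover have "gstable \<Gamma> G ?K" unfolding closed_gsubgroup_gen_def
    by (auto simp: closed_gsubgroup_def gstable_def)
  ultimately show "closed_gsubgroup \<Gamma> G ?K" by (simp add: closed_gsubgroup_def)
qed (auto simp: closed_gsubgroup_gen_def)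

lemma closed_normal_gsubgroup_gen:
  assumes "S \<subseteq> carrier G"
  shows "closed_normal_gsubgroup \<Gamma> G (closed_normal_gsubgroup_gen \<Gamma> G S)"
      (is "closed_normal_gsubgroup _ _ ?K")
    and "S \<subseteq> closed_normal_gsubgroup_gen \<Gamma> G S"
proof -
  let ?F = "{H. closed_normal_gsubgroup \<Gamma> G H \<and> S \<subseteq> H}"
  have ne: "carrier G \<in> ?F" using closed_normal_gsubgroup_carrier assms by auto
  have "subgroup ?K G" unfolding closed_normal_gsubgroup_gen_def
    by (rule subgroups_Inter)
       (use ne in \<open>auto simp: closed_normal_gsubgroup_def normal_imp_subgroup\<close>)
  moreover have "x \<otimes> h \<otimes> inv x \<in> ?K" if "x \<in> carrier G" "h \<in> ?K" for x h
    using that unfolding closed_normal_gsubgroup_gen_def closed_normal_gsubgroup_def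
    by (auto simp: normal_inv_iff)
  ultimately have "?K \<lhd> G" by (simp add: normal_invI)
  moreover have "closedin (gtop G) ?K" unfolding closed_normal_gsubgroup_gen_def
    by (rule closedin_Inter) (use ne in \<open>auto simp: closed_normal_gsubgroup_def\<close>)
  moreover have "gstable \<Gamma> G ?K" unfolding closed_normal_gsubgroup_gen_def
    by (auto simp: closed_normal_gsubgroup_def gstable_def)
  ultimately show "closed_normal_gsubgroup \<Gamma> G ?K" by (simp add: closed_normal_gsubgroup_def)
qed (auto simp: closed_normal_gsubgroup_gen_def)

end

lemma closed_gsubgroup_gen_least:
  "\<lbrakk>closed_gsubgroup \<Gamma> G H; S \<subseteq> H\<rbrakk> \<Longrightarrow> closed_gsubgroup_gen \<Gamma> G S \<subseteq> H"
  by (auto simp: closed_gsubgroup_gen_def)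

lemma closed_normal_gsubgroup_gen_least:
  "\<lbrakk>closed_normal_gsubgroup \<Gamma> G H; S \<subseteq> H\<rbrakk> \<Longrightarrow> closed_normal_gsubgroup_gen \<Gamma> G S \<subseteq> H"
  by (auto simp: closed_normal_gsubgroup_gen_def)

lemma gsub_simps [simp]:
  "carrier (gsub G H) = H" "mult (gsub G H) = mult G" "one (gsub G H) = one G"
  "gtop (gsub G H) = subtopology (gtop G) H" "gact (gsub G H) = gact G"
  by (simp_all add: gsub_def)

lemma group_gsub:
  assumes "group G" and "subgroup H G"
  shows "group (gsub G H)"
proof -
  interpret group G by fact
  have "group (G\<lparr>carrier := H\<rparr>)" using subgroup_imp_group assms by blast
  then interpret K: group "G\<lparr>carrier := H\<rparr>" .
  show ?thesis
    by (rule groupI) (use K.m_closed K.one_closed K.m_assoc K.l_one K.l_inv_ex in simp_all)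
qed

lemma m_inv_gsub:
  assumes "group G" "subgroup H G" "x \<in> H"
  shows "m_inv (gsub G H) x = inv\<^bsub>G\<^esub> x"
proof -
  interpret group G by fact
  interpret K: group "gsub G H" using group_gsub[OF assms(1,2)] .
  have "inv\<^bsub>G\<^esub> x \<in> H" using assms by (simp add: subgroup.m_inv_closed)
  then show ?thesis
    using assms subgroup.mem_carrier[OF assms(2,3)] by (intro K.inv_equality) (simp_all)
qed

lemma (in topological_ggroup) topological_ggroup_gsub:
  assumes "subgroup H G" "gstable \<Gamma> G H"
  shows "topological_ggroup \<Gamma> (gsub G H)"
proof -
  have 1: "group (gsub G H)" using group_gsub[OF is_group assms(1)] .
  have HG: "H \<subseteq> carrier G" by (rule subgroup.subset[OF assms(1)])
  have st: "gact G \<sigma> x \<in> H" if "\<sigma> \<in> carrier \<Gamma>" "x \<in> H" for \<sigma> x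
    using that assms by (auto simp: gstable_def)
  show ?thesis
  proof (intro topological_ggroup.intro 1 topological_ggroup_axioms.intro)
    show "topspace (gtop (gsub G H)) = carrier (gsub G H)" using HG topspace_gtop by auto
    show "continuous_map (prod_topology (gtop (gsub G H)) (gtop (gsub G H))) (gtop (gsub G H))
     (\<lambda>(x, y). x \<otimes>\<^bsub>gsub G H\<^esub> y)"
      using HG subgroup.m_closed[OF assms(1)] continuous_map_from_subtopology[OF continuous_mult]
      by (auto simp: continuous_map_in_subtopology simp flip: subtopology_Times)
    have "continuous_map (subtopology (gtop G) H) (gtop G) (m_inv (gsub G H))"
      by (rule continuous_map_eq[OF continuous_map_from_subtopology[OF continuous_inv]])
         (use HG topspace_gtop in \<open>auto simp: m_inv_gsub[OF is_group assms(1)]\<close>)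
    then show "continuous_map (gtop (gsub G H)) (gtop (gsub G H)) (m_inv (gsub G H))"
      using group.inv_closed[OF 1] by (auto simp: continuous_map_in_subtopology)
    show "gact (gsub G H) \<sigma> \<in> hom (gsub G H) (gsub G H)" if "\<sigma> \<in> carrier \<Gamma>" for \<sigma>
      using that st gact_mult[OF that subsetD[OF HG] subsetD[OF HG]] by (intro homI) auto
    show "continuous_map (gtop (gsub G H)) (gtop (gsub G H)) (gact (gsub G H) \<sigma>)" if "\<sigma> \<in> carrier \<Gamma>" for \<sigma>
      using that continuous_map_from_subtopology[OF continuous_gact[OF that]] st
      by (auto simp: continuous_map_in_subtopology)
    show "gact (gsub G H) \<one>\<^bsub>\<Gamma>\<^esub> x = x" if "x \<in> carrier (gsub G H)" for x
      using subsetD[OF HG] gact_one that by simp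
    show "gact (gsub G H) (\<sigma> \<otimes>\<^bsub>\<Gamma>\<^esub> \<tau>) x = gact (gsub G H) \<sigma> (gact (gsub G H) \<tau> x)"
      if "\<sigma> \<in> carrier \<Gamma>" "\<tau> \<in> carrier \<Gamma>" "x \<in> carrier (gsub G H)" for \<sigma> \<tau> x
      using subsetD[OF HG] gact_comp that by simp
  qed
qed

section \<open>\<Gamma>-homomorphisms and the descent of surjections to quotients\<close>

definition gHom :: "'g monoid \<Rightarrow> ('g, 'a) ggroup \<Rightarrow> ('g, 'b) ggroup \<Rightarrow> ('a \<Rightarrow> 'b) set" where
  "gHom \<Gamma> G A = {f \<in> extensional (carrier G).
     f \<in> hom G A \<and> continuous_map (gtop G) (gtop A) f \<and> gequivariant \<Gamma> G A f}"

lemma gSur_eq: "gSur \<Gamma> G A = {f \<in> gHom \<Gamma> G A. f ` carrier G = carrier A}"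
  by (auto simp: gSur_def gHom_def epi_def)

text \<open>Enough structure to transport surjections along quotient maps. This is all that is
  needed of the groups \<open>X\<^sub>u\<^sub>,\<^sub>n\<close>, so that they need not be shown to be profinite.\<close>

locale pre_ggroup = group G for \<Gamma> :: "'g monoid" and G :: "('g, 'a) ggroup" (structure) +
  assumes topspace_eq: "topspace (gtop G) = carrier G"
    and act_closed: "\<lbrakk>\<sigma> \<in> carrier \<Gamma>; x \<in> carrier G\<rbrakk> \<Longrightarrow> gact G \<sigma> x \<in> carrier G"

sublocale topological_ggroup \<subseteq> pre_ggroup \<Gamma> G
  by unfold_locales (simp_all add: topspace_gtop)

text \<open>Universal property of quotients: a map that is constant on the fibres of
  \<open>\<pi>\<close> descends, and the quotient topology makes the descended map continuous. The
  same lemma serves isomorphisms, the first isomorphism theorem, the completions and the quotients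
  of F_n by relators.\<close>

lemma (in pre_ggroup) bij_betw_gSur_quotient:
  assumes \<pi>: "\<pi> \<in> epi G Q" and q: "quotient_map (gtop G) (gtop Q) \<pi>" and e: "gequivariant \<Gamma> G Q \<pi>"
  shows "bij_betw (\<lambda>f. restrict (f \<circ> \<pi>) (carrier G)) (gSur \<Gamma> Q A)
    {\<phi> \<in> gSur \<Gamma> G A. \<forall>x\<in>carrier G. \<forall>y\<in>carrier G. \<pi> x = \<pi> y \<longrightarrow> \<phi> x = \<phi> y}"
    (is "bij_betw ?F _ ?T")
proof (rule bij_betw_imageI)
  have im: "\<pi> ` carrier G = carrier Q" and hom: "\<pi> \<in> hom G Q" using \<pi> by (auto simp: epi_def)
  show "inj_on ?F (gSur \<Gamma> Q A)"
  proof (rule inj_onI)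
    fix f g assume fg: "f \<in> gSur \<Gamma> Q A" "g \<in> gSur \<Gamma> Q A" "?F f = ?F g"
    have "f y = g y" if y: "y \<in> carrier Q" for y
    proof -
      obtain x where "x \<in> carrier G" "y = \<pi> x" using y im by blast
      then show ?thesis using fun_cong[OF fg(3), of x] by simp
    qed
    moreover have "f \<in> extensional (carrier Q)" "g \<in> extensional (carrier Q)"
      using fg(1,2) by (simp_all add: gSur_def)
    ultimately show "f = g" using extensionalityI by blast
  qed
  have "?F f \<in> ?T" if f: "f \<in> gSur \<Gamma> Q A" for f
  proof -
    have "f \<circ> \<pi> \<in> epi G A" using f \<pi> by (auto simp: gSur_def intro: epi_compose)
    then have "?F f \<in> epi G A" unfolding epi_def hom_def by (simp add: Pi_iff)
    moreover have "continuous_map (gtop G) (gtop A) (f \<circ> \<pi>)"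
      using f quotient_imp_continuous_map[OF q] by (simp add: gSur_def continuous_map_compose)
    then have "continuous_map (gtop G) (gtop A) (?F f)"
      by (rule continuous_map_eq) (simp add: topspace_eq)
    moreover have "gequivariant \<Gamma> G A (?F f)"
      using f e hom_in_carrier[OF hom] act_closed by (simp add: gSur_def gequivariant_def)
    moreover have "?F f \<in> extensional (carrier G)" by simp
    ultimately show ?thesis by (simp add: gSur_def)
  qed
  moreover have "\<phi> \<in> ?F ` gSur \<Gamma> Q A" if \<phi>T: "\<phi> \<in> ?T" for \<phi>
  proof -
    have \<phi>: "\<phi> \<in> gSur \<Gamma> G A" using \<phi>T by blast
    \<comment> \<open>Any choice of preimages will do, because \<open>\<phi>\<close> is constant on
      the fibres of \<open>\<pi>\<close>.\<close>
    define f where "f = restrict (\<lambda>y. \<phi> (inv_into (carrier G) \<pi> y)) (carrier Q)"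
    have f: "f (\<pi> x) = \<phi> x" if "x \<in> carrier G" for x
    proof -
      have "\<pi> x \<in> \<pi> ` carrier G" using that by auto
      then have "\<pi> (inv_into (carrier G) \<pi> (\<pi> x)) = \<pi> x" "inv_into (carrier G) \<pi> (\<pi> x) \<in> carrier G"
          "\<pi> x \<in> carrier Q"
        using im by (auto simp: f_inv_into_f inv_into_into)
      moreover from this have "\<phi> (inv_into (carrier G) \<pi> (\<pi> x)) = \<phi> x" using that \<phi>T by blast
      ultimately show ?thesis unfolding f_def by simp
    qed
    have "f \<in> hom Q A"
    proof (rule homI)
      fix y y' assume "y \<in> carrier Q" "y' \<in> carrier Q"
      then obtain x x' where x: "x \<in> carrier G" "y = \<pi> x" "x' \<in> carrier G" "y' = \<pi> x'" using im by blast
      then have "y \<otimes>\<^bsub>Q\<^esub> y' = \<pi> (x \<otimes> x')" using hom by (simp add: hom_def)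
      then show "f (y \<otimes>\<^bsub>Q\<^esub> y') = f y \<otimes>\<^bsub>A\<^esub> f y'" using x f \<phi>
        by (simp add: gSur_def epi_def hom_def)
    next
      fix y assume "y \<in> carrier Q"
      then obtain x where x: "x \<in> carrier G" "y = \<pi> x" using im by blast
      then show "f y \<in> carrier A" using f \<phi> by (auto simp add: gSur_def epi_def)
    qed
    moreover have "f ` carrier Q = carrier A"
    proof -
      have "f ` carrier Q = (\<lambda>x. f (\<pi> x)) ` carrier G" unfolding im[symmetric] by (rule image_image)
      also have "\<dots> = \<phi> ` carrier G" using f by simp
      finally show ?thesis using \<phi> by (simp add: gSur_def epi_def)
    qed
    moreover have "continuous_map (gtop Q) (gtop A) f"
    proof (rule continuous_compose_quotient_map[OF q])
      show "continuous_map (gtop G) (gtop A) (f \<circ> \<pi>)"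
        by (rule continuous_map_eq[of _ _ \<phi>]) (use \<phi> f topspace_eq in \<open>simp_all add: gSur_def\<close>)
    qed
    moreover have "gequivariant \<Gamma> Q A f"
      unfolding gequivariant_def
    proof (intro ballI)
      fix \<sigma> y assume s: "\<sigma> \<in> carrier \<Gamma>" and "y \<in> carrier Q"
      then obtain x where x: "x \<in> carrier G" "y = \<pi> x" using im by blast
      then show "f (gact Q \<sigma> y) = gact A \<sigma> (f y)"
        using s e f[of x] f[of "gact G \<sigma> x"] act_closed[of \<sigma> x] \<phi> by (simp add: gequivariant_def gSur_def)
    qed
    ultimately have "f \<in> gSur \<Gamma> Q A" by (simp add: gSur_def epi_def f_def)
    moreover have "\<phi> = ?F f"
      by (rule extensionalityI[of _ "carrier G"]) (use \<phi> f in \<open>simp_all add: gSur_def\<close>)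
    ultimately show ?thesis by blast
  qed
  ultimately show "?F ` gSur \<Gamma> Q A = ?T" by blast
qed

text \<open>The fibres of an isomorphism are single points, so the constancy condition of the
  quotient lemma is vacuous.\<close>

lemma (in pre_ggroup) bij_betw_gSur_giso:
  assumes "giso \<Gamma> G Q"
  shows "\<exists>F. bij_betw F (gSur \<Gamma> Q A) (gSur \<Gamma> G A)"
proof -
  obtain \<theta> where \<theta>: "\<theta> \<in> iso G Q" "homeomorphic_map (gtop G) (gtop Q) \<theta>" "gequivariant \<Gamma> G Q \<theta>"
    using assms by (auto simp: giso_def)
  have "\<theta> \<in> epi G Q" "inj_on \<theta> (carrier G)"
    using \<theta>(1) by (auto simp: iso_iff epi_def)
  then have "{\<phi> \<in> gSur \<Gamma> G A. \<forall>x\<in>carrier G. \<forall>y\<in>carrier G. \<theta> x = \<theta> y \<longrightarrow> \<phi> x = \<phi> y} = gSur \<Gamma> G A"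
    by (auto simp: inj_on_def)
  moreover have "quotient_map (gtop G) (gtop Q) \<theta>"
    using \<theta>(2) by (simp add: continuous_open_imp_quotient_map homeomorphic_imp_continuous_map
        homeomorphic_imp_open_map homeomorphic_imp_surjective_map)
  ultimately show ?thesis
    using bij_betw_gSur_quotient[OF \<open>\<theta> \<in> epi G Q\<close> _ \<theta>(3), of A] by auto
qed

lemma (in pre_ggroup) card_gSur_giso:
  assumes "giso \<Gamma> G Q"
  shows "card (gSur \<Gamma> Q A) = card (gSur \<Gamma> G A)" "finite (gSur \<Gamma> Q A) \<longleftrightarrow> finite (gSur \<Gamma> G A)"
  using bij_betw_gSur_giso[OF assms, of A] bij_betw_same_card bij_betw_finite by metis+

lemma giso_refl: "giso \<Gamma> G G"
  unfolding giso_def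
  by (rule exI[of _ "\<lambda>x. x"]) (auto simp: iso_set_refl gequivariant_def homeomorphic_map_id[unfolded id_def])

lemma giso_trans: "\<lbrakk>giso \<Gamma> G H; giso \<Gamma> H K\<rbrakk> \<Longrightarrow> giso \<Gamma> G K"
proof -
  assume "giso \<Gamma> G H" "giso \<Gamma> H K"
  then obtain f g where fg: "f \<in> iso G H" "homeomorphic_map (gtop G) (gtop H) f" "gequivariant \<Gamma> G H f"
     "g \<in> iso H K" "homeomorphic_map (gtop H) (gtop K) g" "gequivariant \<Gamma> H K g"
    by (auto simp: giso_def)
  have "f x \<in> carrier H" if "x \<in> carrier G" for x using fg(1) that by (auto simp: iso_def hom_def)
  then show ?thesis unfolding giso_def
    using iso_set_trans[OF fg(1,4)] homeomorphic_map_compose[OF fg(2,5)] fg(3,6)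
    by (intro exI[of _ "g \<circ> f"]) (auto simp: gequivariant_def)
qed

lemma profinite_imp_topological_ggroup: "profinite_ggroup \<Gamma> G \<Longrightarrow> topological_ggroup \<Gamma> G"
  unfolding profinite_ggroup_def topological_ggroup_def topological_ggroup_axioms_def by auto

text \<open>Both images are in bijection with the common set of fibres. This is what matches
  coboundaries with cosets of the invariants.\<close>

lemma card_image_kernel_cong:
  assumes "\<And>x y. \<lbrakk>x \<in> S; y \<in> S\<rbrakk> \<Longrightarrow> f x = f y \<longleftrightarrow> g x = g y"
  shows "card (f ` S) = card (g ` S)"
proof -
  have "bij_betw (\<lambda>z. g (inv_into S f z)) (f ` S) (g ` S)"
  proof (rule bij_betw_imageI)
    have *: "g (inv_into S f (f x)) = g x" if "x \<in> S" for x
      using that assms[of "inv_into S f (f x)" x] by (simp add: f_inv_into_f inv_into_into)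
    show "inj_on (\<lambda>z. g (inv_into S f z)) (f ` S)"
      using * assms by (intro inj_onI) auto
    show "(\<lambda>z. g (inv_into S f z)) ` f ` S = g ` S"
      unfolding image_image using * by (rule image_cong[OF refl])
  qed
  then show ?thesis by (rule bij_betw_same_card)
qed

section \<open>Finite \<Gamma>-groups and their copies on natural numbers\<close>

text \<open>A finite Hausdorff space is discrete, so the continuity demands become automatic and
  purely algebraic axioms remain; \<open>finite_ggroup_iff_profinite\<close> shows that this is the
  finite case of \<open>profinite_ggroup\<close>.\<close>

locale finite_ggroup = group B for \<Gamma> :: "'g monoid" and B :: "('g, 'a) ggroup" (structure) +
  assumes finite_carrier [simp]: "finite (carrier B)"
    and gtop_discrete: "gtop B = discrete_topology (carrier B)"
    and gact_hom': "\<sigma> \<in> carrier \<Gamma> \<Longrightarrow> gact B \<sigma> \<in> hom B B"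
    and gact_one': "x \<in> carrier B \<Longrightarrow> gact B \<one>\<^bsub>\<Gamma>\<^esub> x = x"
    and gact_comp': "\<lbrakk>\<sigma> \<in> carrier \<Gamma>; \<tau> \<in> carrier \<Gamma>; x \<in> carrier B\<rbrakk> \<Longrightarrow>
        gact B (\<sigma> \<otimes>\<^bsub>\<Gamma>\<^esub> \<tau>) x = gact B \<sigma> (gact B \<tau> x)"

sublocale finite_ggroup \<subseteq> topological_ggroup \<Gamma> B
proof
  show "continuous_map (prod_topology (gtop B) (gtop B)) (gtop B) (\<lambda>(x, y). x \<otimes> y)"
    by (auto simp: gtop_discrete simp flip: prod_topology_discrete_topology)
  show "continuous_map (gtop B) (gtop B) (\<lambda>x. inv x)" by (auto simp: gtop_discrete)
  show "continuous_map (gtop B) (gtop B) (gact B \<sigma>)" if "\<sigma> \<in> carrier \<Gamma>" for \<sigma>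
    using gact_hom'[OF that] by (auto simp: gtop_discrete hom_def)
qed (simp_all add: gtop_discrete gact_hom' gact_one' gact_comp')

text \<open>The axioms are equations and travel along an equivariant surjection, even to a target
  not yet known to be a group. The unit is a separate record field on which \<open>epi\<close> says
  nothing, hence the hypothesis \<open>one\<close>.\<close>

lemma (in topological_ggroup) finite_ggroup_epi_image:
  fixes Q :: "('g, 'b) ggroup"
  assumes \<Gamma>: "group \<Gamma>" and \<pi>: "\<pi> \<in> epi G Q" "gequivariant \<Gamma> G Q \<pi>"
    and one: "\<one>\<^bsub>Q\<^esub> = \<pi> \<one>" and fin: "finite (carrier Q)" and top: "gtop Q = discrete_topology (carrier Q)"
  shows "finite_ggroup \<Gamma> Q"
proof (intro finite_ggroup.intro finite_ggroup_axioms.intro)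
  interpret \<Gamma>: group \<Gamma> by fact
  have hom: "\<pi> \<in> hom G Q" and im: "\<pi> ` carrier G = carrier Q" using \<pi> by (auto simp: epi_def)
  have mem: "\<pi> x \<in> carrier Q" if "x \<in> carrier G" for x using hom_in_carrier[OF hom that] .
  have ex: "\<exists>x\<in>carrier G. y = \<pi> x" if "y \<in> carrier Q" for y using that im by blast
  have mult: "\<pi> x \<otimes>\<^bsub>Q\<^esub> \<pi> y = \<pi> (x \<otimes> y)" if "x \<in> carrier G" "y \<in> carrier G" for x y
    using hom that by (simp add: hom_def)
  have act: "gact Q \<sigma> (\<pi> x) = \<pi> (gact G \<sigma> x)" if "\<sigma> \<in> carrier \<Gamma>" "x \<in> carrier G" for \<sigma> x
    using \<pi>(2) that by (simp add: gequivariant_def)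
  show "group Q"
    using hom_imp_img_group[OF hom] by (simp add: im flip: one)
  fix \<sigma> assume \<sigma>: "\<sigma> \<in> carrier \<Gamma>"
  show "gact Q \<sigma> \<in> hom Q Q"
  proof (rule homI)
    fix x assume "x \<in> carrier Q"
    then obtain a where "a \<in> carrier G" "x = \<pi> a" using ex by blast
    then show "gact Q \<sigma> x \<in> carrier Q" using \<sigma> by (simp add: act mem)
  next
    fix x y assume "x \<in> carrier Q" "y \<in> carrier Q"
    then obtain a b where "a \<in> carrier G" "x = \<pi> a" "b \<in> carrier G" "y = \<pi> b" using ex by metis
    then show "gact Q \<sigma> (x \<otimes>\<^bsub>Q\<^esub> y) = gact Q \<sigma> x \<otimes>\<^bsub>Q\<^esub> gact Q \<sigma> y"
      using \<sigma> by (simp add: mult act gact_mult)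
  qed
next
  interpret \<Gamma>: group \<Gamma> by fact
  have act: "gact Q \<sigma> (\<pi> x) = \<pi> (gact G \<sigma> x)" if "\<sigma> \<in> carrier \<Gamma>" "x \<in> carrier G" for \<sigma> x
    using \<pi>(2) that by (simp add: gequivariant_def)
  fix x assume "x \<in> carrier Q"
  then obtain a where a: "a \<in> carrier G" "x = \<pi> a" using \<pi> by (auto simp: epi_def)
  then show "gact Q \<one>\<^bsub>\<Gamma>\<^esub> x = x" using gact_one by (simp add: act)
  fix \<sigma> \<tau> assume st: "\<sigma> \<in> carrier \<Gamma>" "\<tau> \<in> carrier \<Gamma>"
  then show "gact Q (\<sigma> \<otimes>\<^bsub>\<Gamma>\<^esub> \<tau>) x = gact Q \<sigma> (gact Q \<tau> x)"
    unfolding a(2) using a(1) by (simp add: act gact_comp)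
qed (fact fin top)+

lemma finite_ggroup_iff_profinite:
  "finite_ggroup \<Gamma> B \<longleftrightarrow> profinite_ggroup \<Gamma> B \<and> finite (carrier B)"
proof
  assume "finite_ggroup \<Gamma> B"
  then interpret finite_ggroup \<Gamma> B .
  have "\<exists>a. S \<subseteq> {a}" if "connectedin (gtop B) S" for S
    using that by (auto simp: gtop_discrete connectedin_discrete_topology)
  then show "profinite_ggroup \<Gamma> B \<and> finite (carrier B)"
    unfolding profinite_ggroup_def
    using topspace_gtop continuous_mult continuous_inv gact_hom continuous_gact gact_one gact_comp
    by (simp add: is_group gtop_discrete compact_space_discrete_topology)
next
  assume a: "profinite_ggroup \<Gamma> B \<and> finite (carrier B)"
  then interpret topological_ggroup \<Gamma> B by (simp add: profinite_imp_topological_ggroup)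
  show "finite_ggroup \<Gamma> B"
  proof
    show "gtop B = discrete_topology (carrier B)"
      using a by (simp add: profinite_ggroup_def finite_topspace_imp_discrete_topology)
    show "finite (carrier B)" using a by simp
  qed (simp_all add: gact_hom gact_one gact_comp)
qed

context finite_ggroup
begin

lemma profinite_ggroup: "profinite_ggroup \<Gamma> B"
  using finite_ggroup_iff_profinite finite_ggroup_axioms by blast

lemma order_pos: "order B > 0"
  by (simp add: order_gt_0_iff_finite)

lemma continuous_map_into_iff:
  "continuous_map X (gtop B) f \<longleftrightarrow>
     f \<in> topspace X \<rightarrow> carrier B \<and> (\<forall>b\<in>carrier B. openin X {x \<in> topspace X. f x = b})"
proof
  assume "continuous_map X (gtop B) f"
  then show "f \<in> topspace X \<rightarrow> carrier B \<and> (\<forall>b\<in>carrier B. openin X {x \<in> topspace X. f x = b})"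
    using openin_continuous_map_preimage[of X "gtop B" f "{b}" for b]
    by (auto simp: gtop_discrete continuous_map_def)
next
  assume *: "f \<in> topspace X \<rightarrow> carrier B \<and> (\<forall>b\<in>carrier B. openin X {x \<in> topspace X. f x = b})"
  have "openin X {x \<in> topspace X. f x \<in> U}" if "U \<subseteq> carrier B" for U
  proof -
    have "{x \<in> topspace X. f x \<in> U} = (\<Union>b\<in>U. {x \<in> topspace X. f x = b})" by auto
    moreover have "openin X (\<Union>b\<in>U. {x \<in> topspace X. f x = b})" using * that by (intro openin_Union) blast
    ultimately show ?thesis by simp
  qed
  then show "continuous_map X (gtop B) f" using * by (auto simp: continuous_map_def gtop_discrete)
qed

end

text \<open>In a discrete group the trivial subgroup is open and normal and its index is the order;
  conversely every index divides the order by Lagrange.\<close>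

lemma pro_prime_finite_iff:
  assumes "finite (carrier B)"
  shows "pro_prime_ggroup \<Gamma> B \<longleftrightarrow> finite_ggroup \<Gamma> B \<and> coprime (order B) (order \<Gamma>)"
proof
  assume a: "pro_prime_ggroup \<Gamma> B"
  then interpret finite_ggroup \<Gamma> B
    using assms by (simp add: finite_ggroup_iff_profinite pro_prime_ggroup_def)
  have "{\<one>\<^bsub>B\<^esub>} \<lhd> B" by (rule one_is_normal)
  moreover have "openin (gtop B) {\<one>\<^bsub>B\<^esub>}" by (simp add: gtop_discrete)
  ultimately have "coprime (card (rcosets\<^bsub>B\<^esub> {\<one>\<^bsub>B\<^esub>})) (order \<Gamma>)"
    using a by (auto simp: pro_prime_ggroup_def)
  moreover have "card (rcosets\<^bsub>B\<^esub> {\<one>\<^bsub>B\<^esub>}) * card {\<one>\<^bsub>B\<^esub>} = order B"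
    by (rule lagrange[OF triv_subgroup])
  ultimately show "finite_ggroup \<Gamma> B \<and> coprime (order B) (order \<Gamma>)"
    by (simp add: finite_ggroup_axioms)
next
  assume a: "finite_ggroup \<Gamma> B \<and> coprime (order B) (order \<Gamma>)"
  then interpret finite_ggroup \<Gamma> B by blast
  have "coprime (card (rcosets\<^bsub>B\<^esub> N)) (order \<Gamma>)" if "N \<lhd> B" for N
  proof -
    have "card (rcosets\<^bsub>B\<^esub> N) dvd order B"
      using lagrange[OF normal_imp_subgroup[OF that]] by (metis dvd_triv_left)
    then show ?thesis by (rule coprime_divisors[OF _ dvd_refl]) (use a in simp)
  qed
  then show "pro_prime_ggroup \<Gamma> B" by (simp add: pro_prime_ggroup_def profinite_ggroup)
qed

lemma (in finite_ggroup) finite_ggroup_transport: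
  fixes B' :: "('g, 'b) ggroup"
  assumes bij: "bij_betw \<theta> (carrier B) (carrier B')"
    and mult: "\<And>x y. \<lbrakk>x \<in> carrier B; y \<in> carrier B\<rbrakk> \<Longrightarrow> \<theta> (x \<otimes> y) = \<theta> x \<otimes>\<^bsub>B'\<^esub> \<theta> y"
    and one: "\<one>\<^bsub>B'\<^esub> = \<theta> \<one>"
    and top: "gtop B' = discrete_topology (carrier B')"
    and act: "\<And>\<sigma> x. \<lbrakk>\<sigma> \<in> carrier \<Gamma>; x \<in> carrier B\<rbrakk> \<Longrightarrow> gact B' \<sigma> (\<theta> x) = \<theta> (gact B \<sigma> x)"
    and \<Gamma>: "group \<Gamma>"
  shows "finite_ggroup \<Gamma> B'" "giso \<Gamma> B B'"
proof -
  have im: "\<theta> ` carrier B = carrier B'" using bij by (simp add: bij_betw_def)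
  have \<theta>: "\<theta> x \<in> carrier B'" if "x \<in> carrier B" for x using that im by blast
  have iso: "\<theta> \<in> iso B B'" using bij mult \<theta> by (intro isoI homI) auto
  show "finite_ggroup \<Gamma> B'"
  proof (rule finite_ggroup_epi_image[where \<pi> = \<theta> and Q = B', OF \<Gamma> _ _ one _ top])
    show "\<theta> \<in> epi B B'" using iso by (auto simp: iso_iff epi_def)
    show "gequivariant \<Gamma> B B' \<theta>" using act by (simp add: gequivariant_def)
    show "finite (carrier B')" using im by (metis finite_carrier finite_imageI)
  qed
  have "homeomorphic_map (gtop B) (gtop B') \<theta>"
    using bij by (simp add: gtop_discrete top homeomorphic_map_def) (auto simp: bij_betw_def quotient_map_def)
  then show "giso \<Gamma> B B'"
    using iso act by (auto simp: giso_def gequivariant_def)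
qed

definition nat_ggroup :: "nat set \<Rightarrow> nat \<Rightarrow> (nat \<times> nat \<Rightarrow> nat) \<Rightarrow> ('g \<times> nat \<Rightarrow> nat) \<Rightarrow> ('g, nat) ggroup" where
  "nat_ggroup S e m a =
     \<lparr>carrier = S, mult = (\<lambda>x y. m (x, y)), one = e, gtop = discrete_topology S, gact = (\<lambda>\<sigma> x. a (\<sigma>, x))\<rparr>"

text \<open>All structures on initial segments of the natural numbers, groups or not. The tables are
  extensional, so a finite \<Gamma> leaves finitely many for each size and countably many in total;
  this countability later yields a countable partition of the space of classes.\<close>

definition nat_ggroups :: "'g monoid \<Rightarrow> ('g, nat) ggroup set" where
  "nat_ggroups \<Gamma> = (\<Union>k. (\<lambda>(e, m, a). nat_ggroup {..<k} e m a) `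
     ({..<k} \<times> ({..<k} \<times> {..<k} \<rightarrow>\<^sub>E {..<k}) \<times> (carrier \<Gamma> \<times> {..<k} \<rightarrow>\<^sub>E {..<k})))"

lemma countable_nat_ggroups:
  assumes "finite (carrier \<Gamma>)"
  shows "countable (nat_ggroups \<Gamma>)"
  unfolding nat_ggroups_def
  using assms by (intro countable_UN[OF countableI_type] countable_finite finite_imageI finite_cartesian_product finite_PiE) auto

text \<open>Enumerate the carrier and conjugate all operations by the enumeration. Such copies are
  required wherever a definition quantifies over groups on natural numbers, as
  \<open>gclosure\<close> and \<open>free_index\<close> do.\<close>

lemma (in finite_ggroup) ex_nat_copy:
  assumes "group \<Gamma>"
  shows "\<exists>B'\<in>nat_ggroups \<Gamma>. finite_ggroup \<Gamma> B' \<and> giso \<Gamma> B B'"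
proof -
  define k where "k = card (carrier B)"
  obtain \<theta> where \<theta>: "bij_betw \<theta> (carrier B) {..<k}"
    using ex_bij_betw_finite_nat[OF finite_carrier] by (auto simp: k_def atLeast0LessThan)
  define g where "g = inv_into (carrier B) \<theta>"
  have g: "g x \<in> carrier B" if "x < k" for x
    using that \<theta> bij_betw_inv_into[OF \<theta>] by (auto simp: g_def bij_betw_def)
  have \<theta>': "\<theta> x < k" "g (\<theta> x) = x" if "x \<in> carrier B" for x
    using that \<theta> bij_betw_inv_into_left[OF \<theta> that] by (auto simp: g_def bij_betw_def)
  define m where "m = restrict (\<lambda>(x, y). \<theta> (g x \<otimes> g y)) ({..<k} \<times> {..<k})"
  define a where "a = restrict (\<lambda>(\<sigma>, x). \<theta> (gact B \<sigma> (g x))) (carrier \<Gamma> \<times> {..<k})"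
  let ?B = "nat_ggroup {..<k} (\<theta> \<one>) m a"
  have "finite_ggroup \<Gamma> ?B" "giso \<Gamma> B ?B"
    by (rule finite_ggroup_transport[of \<theta> ?B]; use \<theta> \<theta>' assms in \<open>auto simp: nat_ggroup_def m_def a_def\<close>)+
  moreover have "?B \<in> nat_ggroups \<Gamma>"
    unfolding nat_ggroups_def
  proof (intro UN_I[OF UNIV_I] image_eqI)
    show "(\<theta> \<one>, m, a) \<in> {..<k} \<times> ({..<k} \<times> {..<k} \<rightarrow>\<^sub>E {..<k}) \<times> (carrier \<Gamma> \<times> {..<k} \<rightarrow>\<^sub>E {..<k})"
      using \<theta>' g by (auto simp: m_def a_def)
  qed simp
  ultimately show ?thesis by blast
qed

lemma (in finite_ggroup) finite_ggroup_gsub: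
  assumes "subgroup H B" "gstable \<Gamma> B H"
  shows "finite_ggroup \<Gamma> (gsub B H)" "order (gsub B H) dvd order B"
proof -
  interpret K: topological_ggroup \<Gamma> "gsub B H" by (rule topological_ggroup_gsub[OF assms])
  have H: "H \<subseteq> carrier B" by (rule subgroup.subset[OF assms(1)])
  show "finite_ggroup \<Gamma> (gsub B H)"
  proof
    show "gtop (gsub B H) = discrete_topology (carrier (gsub B H))"
      using H by (simp add: gtop_discrete Int_absorb1)
    show "finite (carrier (gsub B H))" using H finite_subset[OF H] by simp
  qed (use K.gact_hom K.gact_one K.gact_comp in auto)
  have "card (rcosets H) * card H = order B" by (rule lagrange[OF assms(1)])
  then show "order (gsub B H) dvd order B" by (metis dvd_triv_right gsub_simps(1) order_def)
qed

section \<open>Products and quotients of \<Gamma>-groups\<close>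

lemma gprod_simps [simp]:
  "carrier (gprod I K) = (\<Pi>\<^sub>E i\<in>I. carrier (K i))"
  "mult (gprod I K) = (\<lambda>x y. \<lambda>i\<in>I. x i \<otimes>\<^bsub>K i\<^esub> y i)"
  "one (gprod I K) = (\<lambda>i\<in>I. \<one>\<^bsub>K i\<^esub>)"
  "gtop (gprod I K) = product_topology (\<lambda>i. gtop (K i)) I"
  "gact (gprod I K) = (\<lambda>\<sigma> f. \<lambda>i\<in>I. gact (K i) \<sigma> (f i))"
  by (simp_all add: gprod_def monoid.defs ggroup.defs product_group_def)

lemma group_gprod:
  assumes "\<And>i. i \<in> I \<Longrightarrow> group (K i)"
  shows "group (gprod I K)"
proof -
  interpret P: group "product_group I K" using assms by simp
  show ?thesis
    by (rule groupI) (use P.m_closed P.one_closed P.m_assoc P.l_one P.l_inv_ex in simp_all)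
qed

lemma product_topology_discrete:
  assumes "finite I" and T: "\<And>i. i \<in> I \<Longrightarrow> T i = discrete_topology (S i)"
  shows "product_topology T I = discrete_topology (\<Pi>\<^sub>E i\<in>I. S i)"
proof -
  have "openin (product_topology T I) {x}" if x: "x \<in> (\<Pi>\<^sub>E i\<in>I. S i)" for x
  proof -
    have "{x} = (\<Pi>\<^sub>E i\<in>I. {x i})" using x PiE_singleton[of x I] by (auto simp: PiE_def)
    moreover have "openin (product_topology T I) (\<Pi>\<^sub>E i\<in>I. {x i})"
      using assms(1) T x by (simp add: openin_PiE_gen PiE_iff)
    ultimately show ?thesis by simp
  qed
  moreover have "topspace (product_topology T I) = (\<Pi>\<^sub>E i\<in>I. S i)"
    using T by (simp cong: PiE_cong)
  ultimately show ?thesis by (metis discrete_topology_unique topspace_product_topology topspace_discrete_topology)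
qed

lemma finite_ggroup_gprod:
  assumes "finite I" and K: "\<And>i. i \<in> I \<Longrightarrow> finite_ggroup \<Gamma> (K i)" and "group \<Gamma>"
  shows "finite_ggroup \<Gamma> (gprod I K)"
proof -
  interpret \<Gamma>: group \<Gamma> by fact
  have gr: "group (K i)" if "i \<in> I" for i using K[OF that] by (rule finite_ggroup.axioms)
  have tg: "topological_ggroup \<Gamma> (K i)" if "i \<in> I" for i
    using K[OF that] finite_ggroup_iff_profinite profinite_imp_topological_ggroup by blast
  note simps = topological_ggroup.gact_mult topological_ggroup.gact_closed
      topological_ggroup.gact_one topological_ggroup.gact_comp
  show ?thesis
  proof (intro finite_ggroup.intro finite_ggroup_axioms.intro)
    show "group (gprod I K)" by (rule group_gprod[OF gr])
    show "finite (carrier (gprod I K))" using assms(1) K finite_ggroup.finite_carrier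
      by (auto intro!: finite_PiE)
    show "gtop (gprod I K) = discrete_topology (carrier (gprod I K))"
      using finite_ggroup.gtop_discrete[OF K] by (simp add: product_topology_discrete[OF assms(1)])
    fix \<sigma> assume \<sigma>: "\<sigma> \<in> carrier \<Gamma>"
    show "gact (gprod I K) \<sigma> \<in> hom (gprod I K) (gprod I K)"
    proof (rule homI)
      fix x y assume "x \<in> carrier (gprod I K)" "y \<in> carrier (gprod I K)"
      then show "gact (gprod I K) \<sigma> (x \<otimes>\<^bsub>gprod I K\<^esub> y) = gact (gprod I K) \<sigma> x \<otimes>\<^bsub>gprod I K\<^esub> gact (gprod I K) \<sigma> y"
        using \<sigma> simps(1)[OF tg] by (auto simp: PiE_iff intro!: restrict_ext)
    next
      fix x assume "x \<in> carrier (gprod I K)"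
      then show "gact (gprod I K) \<sigma> x \<in> carrier (gprod I K)"
        using \<sigma> simps(2)[OF tg] by (auto simp: PiE_iff)
    qed
  next
    fix x assume x: "x \<in> carrier (gprod I K)"
    show "gact (gprod I K) \<one>\<^bsub>\<Gamma>\<^esub> x = x"
      using x simps(3)[OF tg] by (auto simp: PiE_iff fun_eq_iff extensional_def)
    fix \<sigma> \<tau> assume "\<sigma> \<in> carrier \<Gamma>" "\<tau> \<in> carrier \<Gamma>"
    then show "gact (gprod I K) (\<sigma> \<otimes>\<^bsub>\<Gamma>\<^esub> \<tau>) x = gact (gprod I K) \<sigma> (gact (gprod I K) \<tau> x)"
      using x simps(4)[OF tg] by (auto simp: PiE_iff intro!: restrict_ext)
  qed
qed

lemma gquot_simps [simp]:
  "carrier (gquot G N) = rcosets\<^bsub>G\<^esub> N" "mult (gquot G N) = set_mult G" "one (gquot G N) = N"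
  "gtop (gquot G N) = gquot_top G N" "gact (gquot G N) = (\<lambda>\<sigma> K. gact G \<sigma> ` K)"
  by (simp_all add: gquot_def monoid.defs ggroup.defs FactGroup_def)

lemma (in group) inv_mult_cancel_left:
  "\<lbrakk>x \<in> carrier G; y \<in> carrier G\<rbrakk> \<Longrightarrow> x \<otimes> (inv x \<otimes> y) = y"
  "\<lbrakk>x \<in> carrier G; y \<in> carrier G\<rbrakk> \<Longrightarrow> inv x \<otimes> (x \<otimes> y) = y"
  by (simp_all flip: m_assoc)

context topological_ggroup
begin

text \<open>Stability is only an inclusion; applied to the inverse of \<sigma> it yields the other
  one. The equality matters because \<open>gquot\<close> acts on cosets by direct image, which must
  again be a full coset.\<close>

lemma gact_image_stable:
  assumes "group \<Gamma>" "gstable \<Gamma> G N" "N \<subseteq> carrier G" "\<sigma> \<in> carrier \<Gamma>"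
  shows "gact G \<sigma> ` N = N"
proof
  interpret \<Gamma>: group \<Gamma> by fact
  show "gact G \<sigma> ` N \<subseteq> N" using assms by (auto simp: gstable_def)
  show "N \<subseteq> gact G \<sigma> ` N"
  proof
    fix x assume x: "x \<in> N"
    have "gact G (inv\<^bsub>\<Gamma>\<^esub> \<sigma>) x \<in> N" using x assms(2,4) \<Gamma>.inv_closed unfolding gstable_def by blast
    moreover have "gact G \<sigma> (gact G (inv\<^bsub>\<Gamma>\<^esub> \<sigma>) x) = x"
      using x assms(3,4) gact_comp[of \<sigma> "inv\<^bsub>\<Gamma>\<^esub> \<sigma>" x] gact_one[of x] \<Gamma>.inv_closed[of \<sigma>]
      by (simp add: subset_iff)
    ultimately show "x \<in> gact G \<sigma> ` N" by (metis imageI)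
  qed
qed

lemma gact_image_rcoset:
  assumes "group \<Gamma>" "gstable \<Gamma> G N" "N \<subseteq> carrier G" "\<sigma> \<in> carrier \<Gamma>" "x \<in> carrier G"
  shows "gact G \<sigma> ` (N #> x) = N #> gact G \<sigma> x"
proof -
  have "gact G \<sigma> ` (N #> x) = (\<lambda>h. gact G \<sigma> h \<otimes> gact G \<sigma> x) ` N"
    unfolding r_coset_def UNION_singleton_eq_range image_image
    using assms gact_mult[OF assms(4)] by (intro image_cong) auto
  also have "\<dots> = (\<lambda>h. h \<otimes> gact G \<sigma> x) ` gact G \<sigma> ` N" by (simp add: image_image)
  also have "\<dots> = N #> gact G \<sigma> x"
    unfolding gact_image_stable[OF assms(1-4)] r_coset_def by (simp add: UNION_singleton_eq_range)
  finally show ?thesis .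
qed

lemma rcosets_eq_image: "rcosets N = (\<lambda>x. N #> x) ` carrier G"
  by (simp add: RCOSETS_def UNION_singleton_eq_range)

lemma quotient_projection:
  assumes "group \<Gamma>" "N \<lhd> G" "gstable \<Gamma> G N"
  shows "(\<lambda>x. N #> x) \<in> epi G (gquot G N)"
    and "quotient_map (gtop G) (gtop (gquot G N)) (\<lambda>x. N #> x)"
    and "gequivariant \<Gamma> G (gquot G N) (\<lambda>x. N #> x)"
proof -
  have N: "N \<subseteq> carrier G" by (rule subgroup.subset[OF normal_imp_subgroup[OF assms(2)]])
  show "(\<lambda>x. N #> x) \<in> epi G (gquot G N)"
    using normal.rcos_sum[OF assms(2)] by (auto simp: epi_def hom_def rcosets_eq_image)
  show "gequivariant \<Gamma> G (gquot G N) (\<lambda>x. N #> x)"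
    using gact_image_rcoset[OF assms(1,3) N] by (simp add: gequivariant_def)
  have "topspace (gquot_top G N) = rcosets N"
  proof -
    have "openin (gquot_top G N) (rcosets N)"
    proof -
      have "{x \<in> topspace (gtop G). N #> x \<in> rcosets N} = topspace (gtop G)"
        by (auto simp: rcosets_eq_image topspace_gtop)
      then show ?thesis by (simp add: openin_gquot_top)
    qed
    moreover have "U \<subseteq> rcosets N" if "openin (gquot_top G N) U" for U
      using that by (simp add: openin_gquot_top)
    ultimately show ?thesis by (meson openin_subset openin_topspace subset_antisym)
  qed
  then show "quotient_map (gtop G) (gtop (gquot G N)) (\<lambda>x. N #> x)"
    by (auto simp: quotient_map_def rcosets_eq_image topspace_gtop openin_gquot_top)
qed

lemma pre_ggroup_gquot:
  assumes "group \<Gamma>" "N \<lhd> G" "gstable \<Gamma> G N"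
  shows "pre_ggroup \<Gamma> (gquot G N)"
proof -
  interpret N: normal N G by fact
  interpret Q: group "G Mod N" by (rule N.factorgroup_is_group)
  note \<pi> = quotient_projection[OF assms]
  show ?thesis
  proof (intro pre_ggroup.intro pre_ggroup_axioms.intro)
    show "group (gquot G N)"
      by (rule groupI)
        (use Q.m_closed Q.one_closed Q.m_assoc Q.l_one Q.l_inv_ex in \<open>simp_all add: FactGroup_def\<close>)
    show "topspace (gtop (gquot G N)) = carrier (gquot G N)"
      using quotient_imp_surjective_map[OF \<pi>(2)] by (simp add: topspace_gtop rcosets_eq_image)
    show "gact (gquot G N) \<sigma> K \<in> carrier (gquot G N)"
      if "\<sigma> \<in> carrier \<Gamma>" "K \<in> carrier (gquot G N)" for \<sigma> K
      using that gact_image_rcoset[OF assms(1,3) N.subset] by (auto simp: rcosets_eq_image)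
  qed
qed

end

lemma (in finite_ggroup) finite_ggroup_gquot:
  assumes "group \<Gamma>" "N \<lhd> B" "gstable \<Gamma> B N"
  shows "finite_ggroup \<Gamma> (gquot B N)" and "order (gquot B N) * card N = order B"
proof -
  note \<pi> = quotient_projection[OF assms]
  interpret N: normal N B by fact
  show "finite_ggroup \<Gamma> (gquot B N)"
  proof (rule finite_ggroup_epi_image[OF assms(1) \<pi>(1,3)])
    show "\<one>\<^bsub>gquot B N\<^esub> = N #> \<one>" using coset_mult_one[OF N.subset] by simp
    show "finite (carrier (gquot B N))" by (simp add: rcosets_eq_image)
    have "openin (gquot_top B N) U \<longleftrightarrow> U \<subseteq> rcosets N" for U
      unfolding openin_gquot_top by (simp add: gtop_discrete subset_iff)
    then have "gquot_top B N = discrete_topology (rcosets N)" by (simp add: topology_eq)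
    then show "gtop (gquot B N) = discrete_topology (carrier (gquot B N))" by simp
  qed
  show "order (gquot B N) * card N = order B"
    using lagrange[OF normal_imp_subgroup[OF assms(2)]] by (simp add: order_def)
qed

section \<open>Cocycles\<close>

text \<open>Non-abelian 1-cocycles, that is, crossed homomorphisms: c corresponds to the splitting
  \<sigma> \<mapsto> (c(\<sigma>), \<sigma>) of the semidirect product of B and \<Gamma>.\<close>

definition cocycles :: "'g monoid \<Rightarrow> ('g, 'a) ggroup \<Rightarrow> ('g \<Rightarrow> 'a) set" where
  "cocycles \<Gamma> B = {c \<in> carrier \<Gamma> \<rightarrow>\<^sub>E carrier B.
     \<forall>\<sigma>\<in>carrier \<Gamma>. \<forall>\<tau>\<in>carrier \<Gamma>. c (\<sigma> \<otimes>\<^bsub>\<Gamma>\<^esub> \<tau>) = c \<sigma> \<otimes>\<^bsub>B\<^esub> gact B \<sigma> (c \<tau>)}"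

text \<open>Restricted to the fixed generators of \<Gamma>, these are the coordinates of
  Y(b).\<close>

definition coboundary :: "'g monoid \<Rightarrow> ('g, 'a) ggroup \<Rightarrow> 'a \<Rightarrow> 'g \<Rightarrow> 'a" where
  "coboundary \<Gamma> B b = (\<lambda>\<sigma>\<in>carrier \<Gamma>. inv\<^bsub>B\<^esub> b \<otimes>\<^bsub>B\<^esub> gact B \<sigma> b)"

definition H1_trivial :: "'g monoid \<Rightarrow> ('g, 'a) ggroup \<Rightarrow> bool" where
  "H1_trivial \<Gamma> B \<longleftrightarrow> cocycles \<Gamma> B \<subseteq> coboundary \<Gamma> B ` carrier B"

definition gindex :: "'g monoid \<Rightarrow> ('g, 'a) ggroup \<Rightarrow> nat" where
  "gindex \<Gamma> B = card (rcosets\<^bsub>B\<^esub> (ginvariants \<Gamma> B))"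

context topological_ggroup
begin

lemma coboundary_mem_cocycles:
  assumes "group \<Gamma>" "b \<in> carrier G"
  shows "coboundary \<Gamma> G b \<in> cocycles \<Gamma> G"
proof -
  interpret \<Gamma>: group \<Gamma> by fact
  show ?thesis
    using assms(2) by (auto simp: cocycles_def coboundary_def gact_comp gact_mult gact_inv m_assoc inv_mult_cancel_left)
qed

text \<open>For each \<sigma>, a^(-1) \<sigma>(a) = b^(-1) \<sigma>(b) says exactly that \<sigma>
  fixes b a^(-1). Hence there are [G : G^\<Gamma>] coboundaries, which is how the index of the
  theorem meets the count of cocycles.\<close>

lemma coboundary_eq_iff:
  assumes "a \<in> carrier G" "b \<in> carrier G"
  shows "coboundary \<Gamma> G a = coboundary \<Gamma> G b \<longleftrightarrow> ginvariants \<Gamma> G #> a = ginvariants \<Gamma> G #> b"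
proof -
  have "inv a \<otimes> gact G \<sigma> a = inv b \<otimes> gact G \<sigma> b \<longleftrightarrow> gact G \<sigma> (b \<otimes> inv a) = b \<otimes> inv a"
    if "\<sigma> \<in> carrier \<Gamma>" for \<sigma>
  proof -
    let ?a = "gact G \<sigma> a" and ?b = "gact G \<sigma> b"
    have c: "?a \<in> carrier G" "?b \<in> carrier G" using that assms by auto
    have "inv a \<otimes> ?a = inv b \<otimes> ?b \<longleftrightarrow> ?b = b \<otimes> (inv a \<otimes> ?a)"
      by (rule inv_solve_left) (use c assms in simp_all)
    also have "b \<otimes> (inv a \<otimes> ?a) = (b \<otimes> inv a) \<otimes> ?a" using c assms by (simp add: m_assoc)
    also have "?b = (b \<otimes> inv a) \<otimes> ?a \<longleftrightarrow> b \<otimes> inv a = ?b \<otimes> inv ?a"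
      by (rule inv_solve_right[symmetric]) (use c assms in simp_all)
    also have "\<dots> \<longleftrightarrow> ?b \<otimes> inv ?a = b \<otimes> inv a" by (rule eq_commute)
    finally show ?thesis using that assms by (simp add: gact_mult gact_inv)
  qed
  then have "coboundary \<Gamma> G a = coboundary \<Gamma> G b \<longleftrightarrow> b \<otimes> inv a \<in> ginvariants \<Gamma> G"
    using assms by (auto simp: coboundary_def ginvariants_def restrict_def fun_eq_iff)
  also have "\<dots> \<longleftrightarrow> ginvariants \<Gamma> G #> a = ginvariants \<Gamma> G #> b"
  proof
    note I = ginvariants_subgroup
    assume "b \<otimes> inv a \<in> ginvariants \<Gamma> G"
    then have "b \<in> ginvariants \<Gamma> G #> a"
      using subgroup.rcos_module_rev[OF I is_group assms] by blast
    then show "ginvariants \<Gamma> G #> a = ginvariants \<Gamma> G #> b"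
      using repr_independence[OF _ assms(1) I] by blast
  next
    assume "ginvariants \<Gamma> G #> a = ginvariants \<Gamma> G #> b"
    then have "b \<in> ginvariants \<Gamma> G #> a"
      using repr_independenceD[OF ginvariants_subgroup assms(2)] by blast
    then show "b \<otimes> inv a \<in> ginvariants \<Gamma> G"
      using subgroup.rcos_module_imp[OF ginvariants_subgroup is_group assms(1)] by blast
  qed
  finally show ?thesis .
qed

lemma card_coboundaries: "card (coboundary \<Gamma> G ` carrier G) = gindex \<Gamma> G"
  unfolding gindex_def rcosets_eq_image
  by (rule card_image_kernel_cong) (rule coboundary_eq_iff)

lemma cocycles_gsub:
  assumes "D \<subseteq> carrier G"
  shows "cocycles \<Gamma> (gsub G D) = {c \<in> cocycles \<Gamma> G. c ` carrier \<Gamma> \<subseteq> D}"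
  using assms by (auto simp: cocycles_def)

end

context finite_ggroup
begin

lemma finite_cocycles: "finite (carrier \<Gamma>) \<Longrightarrow> finite (cocycles \<Gamma> B)"
  by (rule finite_subset[of _ "carrier \<Gamma> \<rightarrow>\<^sub>E carrier B"]) (auto simp: cocycles_def intro!: finite_PiE)

lemma gindex_mult_card_ginvariants: "gindex \<Gamma> B * card (ginvariants \<Gamma> B) = order B"
  unfolding gindex_def by (rule lagrange[OF ginvariants_subgroup])

lemma gindex_pos: "gindex \<Gamma> B > 0"
  using gindex_mult_card_ginvariants order_pos by (metis gr0I mult_0 less_irrefl)

lemma gindex_le_card_cocycles:
  assumes "group \<Gamma>" "finite (carrier \<Gamma>)"
  shows "gindex \<Gamma> B \<le> card (cocycles \<Gamma> B)"
  unfolding card_coboundaries[symmetric]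
  using assms by (intro card_mono finite_cocycles) (auto intro: coboundary_mem_cocycles)

lemma card_cocycles_eq_gindex_iff:
  assumes "group \<Gamma>" "finite (carrier \<Gamma>)"
  shows "card (cocycles \<Gamma> B) = gindex \<Gamma> B \<longleftrightarrow> H1_trivial \<Gamma> B"
proof -
  have sub: "coboundary \<Gamma> B ` carrier B \<subseteq> cocycles \<Gamma> B" using assms(1) coboundary_mem_cocycles by blast
  show ?thesis
    unfolding card_coboundaries[symmetric] H1_trivial_def
    using card_subset_eq[OF finite_cocycles[OF assms(2)] sub] sub by (metis subset_antisym subset_refl)
qed

text \<open>If every cocycle took values in D, then so would every coboundary, and D would contain
  all g^(-1) \<sigma>(g). By admissibility these generate B as a closed \<Gamma>-subgroup.\<close>

lemma card_cocycles_gsub_less: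
  assumes "group \<Gamma>" "finite (carrier \<Gamma>)" "admissible \<Gamma> B"
    and D: "subgroup D B" "gstable \<Gamma> B D" "D \<noteq> carrier B"
  shows "card (cocycles \<Gamma> (gsub B D)) < card (cocycles \<Gamma> B)"
proof -
  have DB: "D \<subseteq> carrier B" by (rule subgroup.subset[OF D(1)])
  have "cocycles \<Gamma> (gsub B D) \<noteq> cocycles \<Gamma> B"
  proof
    assume eq: "cocycles \<Gamma> (gsub B D) = cocycles \<Gamma> B"
    have "inv b \<otimes> gact B \<sigma> b \<in> D" if "b \<in> carrier B" "\<sigma> \<in> carrier \<Gamma>" for b \<sigma>
    proof -
      have "coboundary \<Gamma> B b \<in> cocycles \<Gamma> (gsub B D)"
        using eq coboundary_mem_cocycles[OF assms(1) that(1)] by simp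
      then have "coboundary \<Gamma> B b ` carrier \<Gamma> \<subseteq> D" by (simp add: cocycles_gsub[OF DB])
      then show ?thesis using that(2) by (auto simp: coboundary_def)
    qed
    then have sub: "{inv\<^bsub>B\<^esub> g \<otimes>\<^bsub>B\<^esub> gact B \<sigma> g | g \<sigma>. g \<in> carrier B \<and> \<sigma> \<in> carrier \<Gamma>} \<subseteq> D" by blast
    have "closed_gsubgroup \<Gamma> B D" using D DB by (simp add: closed_gsubgroup_def gtop_discrete closedin_def)
    from closed_gsubgroup_gen_least[OF this sub] show False
      using assms(3) D DB by (simp add: admissible_def)
  qed
  then have "cocycles \<Gamma> (gsub B D) \<subset> cocycles \<Gamma> B" by (auto simp: cocycles_gsub[OF DB])
  then show ?thesis by (rule psubset_card_mono[OF finite_cocycles[OF assms(2)]])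
qed

end

text \<open>Devissage for non-abelian H^1: trivialise the image of c in Q, lift the trivialising
  element to b, twist c by b into a cocycle with values in N, and trivialise that one by some n;
  then n b trivialises c.\<close>

lemma (in topological_ggroup) H1_trivial_extension:
  assumes \<Gamma>: "group \<Gamma>" and N: "N \<lhd> G" "gstable \<Gamma> G N" "H1_trivial \<Gamma> (gsub G N)"
    and Q: "topological_ggroup \<Gamma> Q" "H1_trivial \<Gamma> Q"
    and \<pi>: "\<pi> \<in> epi G Q" "gequivariant \<Gamma> G Q \<pi>" "\<And>x. x \<in> carrier G \<Longrightarrow> \<pi> x = \<one>\<^bsub>Q\<^esub> \<Longrightarrow> x \<in> N"
  shows "H1_trivial \<Gamma> G"
  unfolding H1_trivial_def
proof
  interpret Q: topological_ggroup \<Gamma> Q by fact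
  interpret \<Gamma>: group \<Gamma> by fact
  fix c assume c: "c \<in> cocycles \<Gamma> G"
  have hom: "\<pi> \<in> hom G Q" and im: "\<pi> ` carrier G = carrier Q" using \<pi> by (auto simp: epi_def)
  interpret \<pi>: group_hom G Q \<pi> by (simp add: group_hom.intro group_hom_axioms.intro hom)
  have NG: "N \<subseteq> carrier G" by (rule subgroup.subset[OF normal_imp_subgroup[OF N(1)]])
  have cc: "c \<sigma> \<in> carrier G" if "\<sigma> \<in> carrier \<Gamma>" for \<sigma> using c that by (auto simp: cocycles_def)
  have ccoc: "c (\<sigma> \<otimes>\<^bsub>\<Gamma>\<^esub> \<tau>) = c \<sigma> \<otimes> gact G \<sigma> (c \<tau>)" if "\<sigma> \<in> carrier \<Gamma>" "\<tau> \<in> carrier \<Gamma>" for \<sigma> \<tau>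
    using c that by (auto simp: cocycles_def)
  have "(\<lambda>\<sigma>\<in>carrier \<Gamma>. \<pi> (c \<sigma>)) \<in> cocycles \<Gamma> Q"
    using cc ccoc \<pi>(2) by (simp add: cocycles_def gequivariant_def)
  then obtain q where q: "q \<in> carrier Q" "(\<lambda>\<sigma>\<in>carrier \<Gamma>. \<pi> (c \<sigma>)) = coboundary \<Gamma> Q q"
    using Q(2) unfolding H1_trivial_def by blast
  obtain b where b: "b \<in> carrier G" "q = \<pi> b" using q im by blast
  \<comment> \<open>The twist of c by b. Since \<open>\<pi>\<close> sends c to the coboundary of
    \<open>\<pi> b\<close>, it sends this cocycle to the unit.\<close>
  define c' where "c' = (\<lambda>\<sigma>\<in>carrier \<Gamma>. b \<otimes> c \<sigma> \<otimes> inv (gact G \<sigma> b))"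
  have c': "c' \<sigma> \<in> carrier G" "c \<sigma> = inv b \<otimes> c' \<sigma> \<otimes> gact G \<sigma> b" if "\<sigma> \<in> carrier \<Gamma>" for \<sigma>
    using that cc b by (simp_all add: c'_def m_assoc inv_mult_cancel_left)
  have "\<pi> (c' \<sigma>) = \<one>\<^bsub>Q\<^esub>" if s: "\<sigma> \<in> carrier \<Gamma>" for \<sigma>
  proof -
    have "\<pi> (c \<sigma>) = inv\<^bsub>Q\<^esub> \<pi> b \<otimes>\<^bsub>Q\<^esub> \<pi> (gact G \<sigma> b)"
      using fun_cong[OF q(2), of \<sigma>] s b \<pi>(2) by (simp add: coboundary_def gequivariant_def)
    then show ?thesis using s cc[OF s] b Q.m_assoc[symmetric] by (simp add: c'_def)
  qed
  then have c'N: "c' \<sigma> \<in> N" if "\<sigma> \<in> carrier \<Gamma>" for \<sigma> using that c'(1) \<pi>(3) by blast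
  have "c' \<in> cocycles \<Gamma> G"
    unfolding cocycles_def
  proof (intro CollectI conjI ballI)
    show "c' \<in> carrier \<Gamma> \<rightarrow>\<^sub>E carrier G" using c'(1) by (auto simp: c'_def)
    fix \<sigma> \<tau> assume st: "\<sigma> \<in> carrier \<Gamma>" "\<tau> \<in> carrier \<Gamma>"
    let ?x = "gact G \<sigma> b" and ?y = "gact G \<sigma> (c \<tau>)" and ?z = "gact G (\<sigma> \<otimes>\<^bsub>\<Gamma>\<^esub> \<tau>) b"
    have cl: "?x \<in> carrier G" "?y \<in> carrier G" "?z \<in> carrier G" "c \<sigma> \<in> carrier G" "c \<tau> \<in> carrier G"
      using st b cc by auto
    have "gact G \<sigma> (c' \<tau>) = ?x \<otimes> ?y \<otimes> inv ?z"
      using st b cc by (simp add: c'_def gact_mult gact_inv gact_comp)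
    moreover have "b \<otimes> c \<sigma> \<otimes> inv ?x \<otimes> (?x \<otimes> ?y \<otimes> inv ?z) = b \<otimes> (c \<sigma> \<otimes> ?y) \<otimes> inv ?z"
      using cl b by (simp add: m_assoc inv_mult_cancel_left)
    ultimately show "c' (\<sigma> \<otimes>\<^bsub>\<Gamma>\<^esub> \<tau>) = c' \<sigma> \<otimes> gact G \<sigma> (c' \<tau>)"
      using st ccoc by (simp add: c'_def)
  qed
  then have "c' \<in> cocycles \<Gamma> (gsub G N)" using c'N by (auto simp: cocycles_gsub[OF NG])
  then obtain n where n: "n \<in> N" "c' = coboundary \<Gamma> (gsub G N) n"
    using N(3) by (auto simp: H1_trivial_def)
  have nG: "n \<in> carrier G" using n NG by blast
  have "c \<sigma> = coboundary \<Gamma> G (n \<otimes> b) \<sigma>" if s: "\<sigma> \<in> carrier \<Gamma>" for \<sigma>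
  proof -
    have "c' \<sigma> = inv n \<otimes> gact G \<sigma> n"
      using n s m_inv_gsub[OF is_group normal_imp_subgroup[OF N(1)] n(1)] by (simp add: coboundary_def)
    then show ?thesis using c'(2)[OF s] s nG b by (simp add: coboundary_def gact_mult inv_mult_group m_assoc)
  qed
  moreover have "c \<in> extensional (carrier \<Gamma>)" using c by (simp add: cocycles_def PiE_def)
  ultimately have "c = coboundary \<Gamma> G (n \<otimes> b)"
    by (intro extensionalityI[of _ "carrier \<Gamma>"]) (simp_all add: coboundary_def)
  then show "c \<in> coboundary \<Gamma> G ` carrier G" using nG b by blast
qed

text \<open>An isomorphism is an extension with trivial kernel, and the trivial group has a single
  cocycle.\<close>

lemma (in topological_ggroup) H1_trivial_giso:
  assumes "group \<Gamma>" "topological_ggroup \<Gamma> Q" "giso \<Gamma> G Q" "H1_trivial \<Gamma> Q"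
  shows "H1_trivial \<Gamma> G"
proof -
  obtain \<theta> where \<theta>: "\<theta> \<in> iso G Q" "gequivariant \<Gamma> G Q \<theta>"
    using assms by (auto simp: giso_def)
  interpret Q: topological_ggroup \<Gamma> Q by fact
  interpret \<theta>: group_hom G Q \<theta> using \<theta> by (simp add: group_hom.intro group_hom_axioms.intro iso_def)
  have N: "{\<one>} \<lhd> G" "gstable \<Gamma> G {\<one>}" by (auto simp: one_is_normal gstable_def)
  show ?thesis
  proof (rule H1_trivial_extension[OF assms(1) N _ assms(2,4), of \<theta>])
    interpret K: group "gsub G {\<one>}" by (rule group_gsub[OF is_group triv_subgroup])
    show "H1_trivial \<Gamma> (gsub G {\<one>})"
      unfolding H1_trivial_def
    proof
      fix c assume c: "c \<in> cocycles \<Gamma> (gsub G {\<one>})"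
      have "c = coboundary \<Gamma> (gsub G {\<one>}) \<one>"
        by (rule extensionalityI[of _ "carrier \<Gamma>"])
           (use c in \<open>auto simp: cocycles_def coboundary_def m_inv_gsub[OF is_group triv_subgroup]\<close>)
      then show "c \<in> coboundary \<Gamma> (gsub G {\<one>}) ` carrier (gsub G {\<one>})" by simp
    qed
    show "\<theta> \<in> epi G Q" using \<theta>(1) by (auto simp: iso_iff epi_def)
    show "gequivariant \<Gamma> G Q \<theta>" by fact
    show "x \<in> {\<one>}" if "x \<in> carrier G" "\<theta> x = \<one>\<^bsub>Q\<^esub>" for x
      using that \<theta>(1) \<theta>.hom_one unfolding iso_iff inj_on_def by (metis one_closed singletonI)
  qed
qed

section \<open>The groups \<open>\<F>\<^sub>n\<close>\<close>

lemma continuous_map_discrete_binop: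
  assumes "continuous_map X (discrete_topology S) a" "continuous_map X (discrete_topology T) b"
    and "\<And>s t. \<lbrakk>s \<in> S; t \<in> T\<rbrakk> \<Longrightarrow> h s t \<in> U"
  shows "continuous_map X (discrete_topology U) (\<lambda>x. h (a x) (b x))"
proof -
  have "continuous_map X (prod_topology (discrete_topology S) (discrete_topology T)) (\<lambda>x. (a x, b x))"
    using assms by (simp add: continuous_map_paired)
  moreover have "continuous_map (prod_topology (discrete_topology S) (discrete_topology T))
      (discrete_topology U) (\<lambda>(s, t). h s t)"
    using assms(3) by (auto simp flip: prod_topology_discrete_topology)
  ultimately show ?thesis using continuous_map_compose by (force simp: o_def)
qed

lemma free_ambient_simps [simp]:
  "carrier (free_ambient \<Gamma> n) = (\<Pi>\<^sub>E p\<in>free_index \<Gamma> n. carrier (fst p))"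
  "mult (free_ambient \<Gamma> n) = (\<lambda>x y. \<lambda>p\<in>free_index \<Gamma> n. x p \<otimes>\<^bsub>fst p\<^esub> y p)"
  "one (free_ambient \<Gamma> n) = (\<lambda>p\<in>free_index \<Gamma> n. \<one>\<^bsub>fst p\<^esub>)"
  "gtop (free_ambient \<Gamma> n) =
     product_topology (\<lambda>p. discrete_topology (carrier (fst p))) (free_index \<Gamma> n)"
  "gact (free_ambient \<Gamma> n) = (\<lambda>\<sigma> w. \<lambda>(H, f)\<in>free_index \<Gamma> n.
            w (H, \<lambda>(i, \<gamma>)\<in>{..<n} \<times> carrier \<Gamma>. f (i, \<sigma> \<otimes>\<^bsub>\<Gamma>\<^esub> \<gamma>)))"
  by (simp_all add: free_ambient_def monoid.defs ggroup.defs product_group_def case_prod_beta')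

definition shift_index :: "'g monoid \<Rightarrow> nat \<Rightarrow> 'g \<Rightarrow> (nat \<times> 'g \<Rightarrow> 'b) \<Rightarrow> nat \<times> 'g \<Rightarrow> 'b" where
  "shift_index \<Gamma> n \<sigma> f = (\<lambda>(i, \<gamma>)\<in>{..<n} \<times> carrier \<Gamma>. f (i, \<sigma> \<otimes>\<^bsub>\<Gamma>\<^esub> \<gamma>))"

lemma shift_index_mem:
  assumes "group \<Gamma>" "\<sigma> \<in> carrier \<Gamma>" "(H, f) \<in> free_index \<Gamma> n"
  shows "(H, shift_index \<Gamma> n \<sigma> f) \<in> free_index \<Gamma> n"
  using assms monoid.m_closed[OF group.is_monoid[OF assms(1)]]
  by (auto simp: free_index_def shift_index_def PiE_iff extensional_def)

text \<open>The order is reversed: reindexing acts from the right. Elements of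
  \<open>free_ambient\<close> are functions of the index, which turns this into a left action on
  them.\<close>

lemma shift_index_shift_index:
  assumes "group \<Gamma>" "\<sigma> \<in> carrier \<Gamma>" "\<tau> \<in> carrier \<Gamma>"
  shows "shift_index \<Gamma> n \<tau> (shift_index \<Gamma> n \<sigma> f) = shift_index \<Gamma> n (\<sigma> \<otimes>\<^bsub>\<Gamma>\<^esub> \<tau>) f"
proof -
  interpret group \<Gamma> by fact
  show ?thesis
    using assms(2,3) by (auto simp: shift_index_def fun_eq_iff restrict_def m_assoc)
qed

lemma shift_index_one:
  assumes "group \<Gamma>" "f \<in> extensional ({..<n} \<times> carrier \<Gamma>)"
  shows "shift_index \<Gamma> n \<one>\<^bsub>\<Gamma>\<^esub> f = f"
proof -
  interpret group \<Gamma> by fact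
  show ?thesis
    using assms(2) by (auto simp: shift_index_def fun_eq_iff restrict_def extensional_def)
qed

lemma gact_free_ambient:
  assumes "(H, f) \<in> free_index \<Gamma> n"
  shows "gact (free_ambient \<Gamma> n) \<sigma> w (H, f) = w (H, shift_index \<Gamma> n \<sigma> f)"
  using assms by (simp add: shift_index_def)

lemma topological_ggroup_free_ambient:
  assumes \<Gamma>: "group \<Gamma>"
  shows "topological_ggroup \<Gamma> (free_ambient \<Gamma> n)"
proof -
  let ?W = "free_ambient \<Gamma> n" and ?I = "free_index \<Gamma> n"
  have gr: "group (fst p)" if "p \<in> ?I" for p using that by (auto simp: free_index_def)
  interpret P: group "product_group ?I fst" using gr by simp
  have W: "group ?W"
    by (rule groupI) (use P.m_closed P.one_closed P.m_assoc P.l_one P.l_inv_ex in simp_all)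
  interpret W: group ?W by (rule W)
  have pr: "(\<lambda>w. w p) \<in> hom ?W (fst p)" if "p \<in> ?I" for p
    using that free_proj_hom[of "fst p" "snd p" \<Gamma> n] by simp
  have inv: "(inv\<^bsub>?W\<^esub> w) p = inv\<^bsub>fst p\<^esub> (w p)" if "p \<in> ?I" "w \<in> carrier ?W" for p w
    using group_hom.hom_inv[of ?W "fst p" "\<lambda>w. w p"] that gr pr W
    by (simp add: group_hom_def group_hom_axioms_def)
  have W_eqI: "w = w'" if "w \<in> carrier ?W" "w' \<in> carrier ?W" "\<And>H f. (H, f) \<in> ?I \<Longrightarrow> w (H, f) = w' (H, f)" for w w'
    using that by (intro extensionalityI[of w ?I]) (auto simp: PiE_def)
  have act: "gact ?W \<sigma> w \<in> carrier ?W" if "w \<in> carrier ?W" "\<sigma> \<in> carrier \<Gamma>" for \<sigma> w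
  proof -
    have "w (H, shift_index \<Gamma> n \<sigma> f) \<in> carrier H" if "(H, f) \<in> ?I" for H f
      using PiE_mem[of w ?I "\<lambda>p. carrier (fst p)", OF _ shift_index_mem[OF \<Gamma> _ that]] \<open>w \<in> carrier ?W\<close> \<open>\<sigma> \<in> carrier \<Gamma>\<close> by simp
    then show ?thesis by (auto simp: shift_index_def)
  qed
  have proj: "continuous_map (gtop ?W) (discrete_topology (carrier (fst p))) (\<lambda>w. w p)" if "p \<in> ?I" for p
    using that continuous_map_product_projection[of p ?I "\<lambda>p. discrete_topology (carrier (fst p))"] by simp
  show ?thesis
  proof (intro topological_ggroup.intro topological_ggroup_axioms.intro W)
    show top: "topspace (gtop ?W) = carrier ?W" by simp
    show "continuous_map (prod_topology (gtop ?W) (gtop ?W)) (gtop ?W) (\<lambda>(x, y). x \<otimes>\<^bsub>?W\<^esub> y)"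
    proof -
      have "continuous_map (prod_topology (gtop ?W) (gtop ?W)) (discrete_topology (carrier (fst p)))
          (\<lambda>z. fst z p \<otimes>\<^bsub>fst p\<^esub> snd z p)" if "p \<in> ?I" for p
      proof (rule continuous_map_discrete_binop[where S = "carrier (fst p)" and T = "carrier (fst p)"
            and a = "\<lambda>z. fst z p" and b = "\<lambda>z. snd z p" and h = "mult (fst p)"])
        show "continuous_map (prod_topology (gtop ?W) (gtop ?W)) (discrete_topology (carrier (fst p))) (\<lambda>z. fst z p)"
          using continuous_map_compose[OF continuous_map_fst proj[OF that]] by (simp add: o_def)
        show "continuous_map (prod_topology (gtop ?W) (gtop ?W)) (discrete_topology (carrier (fst p))) (\<lambda>z. snd z p)"
          using continuous_map_compose[OF continuous_map_snd proj[OF that]] by (simp add: o_def)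
      qed (rule monoid.m_closed[OF group.is_monoid[OF gr[OF that]]])
      then show ?thesis by (simp add: continuous_map_componentwise case_prod_unfold image_subset_iff)
    qed
    show "continuous_map (gtop ?W) (gtop ?W) (\<lambda>x. inv\<^bsub>?W\<^esub> x)"
      unfolding free_ambient_simps(4) continuous_map_componentwise
    proof (intro conjI ballI)
      show "(\<lambda>x. inv\<^bsub>?W\<^esub> x) ` topspace (product_topology (\<lambda>p. discrete_topology (carrier (fst p))) ?I) \<subseteq> extensional ?I"
        using W.inv_closed by (auto simp: PiE_def)
      fix p assume p: "p \<in> ?I"
      have "continuous_map (gtop ?W) (discrete_topology (carrier (fst p))) (\<lambda>x. inv\<^bsub>fst p\<^esub> (x p))"
        using continuous_map_compose[OF proj[OF p], of "discrete_topology (carrier (fst p))" "m_inv (fst p)"]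
          group.inv_closed[OF gr[OF p]] by (simp add: o_def)
      then have "continuous_map (gtop ?W) (discrete_topology (carrier (fst p))) (\<lambda>x. (inv\<^bsub>?W\<^esub> x) p)"
        by (rule continuous_map_eq) (simp add: inv[OF p])
      then show "continuous_map (product_topology (\<lambda>p. discrete_topology (carrier (fst p))) ?I)
          (discrete_topology (carrier (fst p))) (\<lambda>x. (inv\<^bsub>?W\<^esub> x) p)" by simp
    qed
    fix \<sigma> assume \<sigma>: "\<sigma> \<in> carrier \<Gamma>"
    show "gact ?W \<sigma> \<in> hom ?W ?W"
    proof (rule homI)
      fix x y assume xy: "x \<in> carrier ?W" "y \<in> carrier ?W"
      show "gact ?W \<sigma> (x \<otimes>\<^bsub>?W\<^esub> y) = gact ?W \<sigma> x \<otimes>\<^bsub>?W\<^esub> gact ?W \<sigma> y"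
      proof (rule W_eqI)
        fix H f assume Hf: "(H, f) \<in> ?I"
        note Hf' = shift_index_mem[OF \<Gamma> \<sigma> Hf]
        show "gact ?W \<sigma> (x \<otimes>\<^bsub>?W\<^esub> y) (H, f) = (gact ?W \<sigma> x \<otimes>\<^bsub>?W\<^esub> gact ?W \<sigma> y) (H, f)"
          using Hf Hf' unfolding gact_free_ambient[OF Hf] free_ambient_simps(2)
          by (simp add: gact_free_ambient[OF Hf] del: free_ambient_simps(5))
      qed (use xy \<sigma> act W.m_closed in blast)+
    qed (rule act[OF _ \<sigma>])
    show "continuous_map (gtop ?W) (gtop ?W) (gact ?W \<sigma>)"
      unfolding free_ambient_simps(4) continuous_map_componentwise
    proof (intro conjI ballI)
      show "gact ?W \<sigma> ` topspace (product_topology (\<lambda>p. discrete_topology (carrier (fst p))) ?I) \<subseteq> extensional ?I"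
        by (auto simp: restrict_extensional)
      fix p assume p: "p \<in> ?I"
      obtain H f where Hf: "p = (H, f)" by (cases p)
      have "continuous_map (gtop ?W) (discrete_topology (carrier H)) (\<lambda>w. w (H, shift_index \<Gamma> n \<sigma> f))"
        using proj[OF shift_index_mem[OF \<Gamma> \<sigma>]] p Hf by (metis fst_conv)
      then show "continuous_map (product_topology (\<lambda>p. discrete_topology (carrier (fst p))) ?I)
          (discrete_topology (carrier (fst p))) (\<lambda>x. gact ?W \<sigma> x p)"
        using p unfolding Hf gact_free_ambient[OF p[unfolded Hf]] by simp
    qed
  next
    fix x assume x: "x \<in> carrier ?W"
    interpret \<Gamma>: group \<Gamma> by fact
    show "gact ?W \<one>\<^bsub>\<Gamma>\<^esub> x = x"
    proof (rule W_eqI)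
      fix H f assume Hf: "(H, f) \<in> ?I"
      then have "f \<in> extensional ({..<n} \<times> carrier \<Gamma>)" by (simp add: free_index_def PiE_def)
      then show "gact ?W \<one>\<^bsub>\<Gamma>\<^esub> x (H, f) = x (H, f)"
        unfolding gact_free_ambient[OF Hf] by (simp add: shift_index_one[OF \<Gamma>])
    qed (use x act \<Gamma>.one_closed in blast)+
    fix \<sigma> \<tau> assume st: "\<sigma> \<in> carrier \<Gamma>" "\<tau> \<in> carrier \<Gamma>"
    show "gact ?W (\<sigma> \<otimes>\<^bsub>\<Gamma>\<^esub> \<tau>) x = gact ?W \<sigma> (gact ?W \<tau> x)"
    proof (rule W_eqI)
      fix H f assume Hf: "(H, f) \<in> ?I"
      show "gact ?W (\<sigma> \<otimes>\<^bsub>\<Gamma>\<^esub> \<tau>) x (H, f) = gact ?W \<sigma> (gact ?W \<tau> x) (H, f)"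
        unfolding gact_free_ambient[OF Hf] gact_free_ambient[OF shift_index_mem[OF \<Gamma> st(1) Hf]]
        by (simp add: shift_index_shift_index[OF \<Gamma> st])
    qed (use x st act \<Gamma>.m_closed in blast)+
  qed
qed

context topological_ggroup
begin

lemma subgroup_closure_of:
  assumes H: "subgroup H G"
  shows "subgroup (gtop G closure_of H) G"
proof (rule subgroupI)
  have HG: "H \<subseteq> topspace (gtop G)" using subgroup.subset[OF H] topspace_gtop by simp
  have sub: "H \<subseteq> gtop G closure_of H" by (rule closure_of_subset[OF HG])
  show "gtop G closure_of H \<subseteq> carrier G" using closure_of_subset_topspace topspace_gtop by metis
  show "gtop G closure_of H \<noteq> {}" using sub subgroup.one_closed[OF H] by blast
  show "inv a \<in> gtop G closure_of H" if "a \<in> gtop G closure_of H" for a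
  proof -
    have "(\<lambda>x. inv x) ` (gtop G closure_of H) \<subseteq> gtop G closure_of ((\<lambda>x. inv x) ` H)"
      by (rule continuous_map_image_closure_subset[OF continuous_inv])
    also have "\<dots> \<subseteq> gtop G closure_of H"
      using subgroup.m_inv_closed[OF H] by (intro closure_of_mono) auto
    finally show ?thesis using that by blast
  qed
  show "a \<otimes> b \<in> gtop G closure_of H" if "a \<in> gtop G closure_of H" "b \<in> gtop G closure_of H" for a b
  proof -
    have "(\<lambda>(x, y). x \<otimes> y) ` (prod_topology (gtop G) (gtop G) closure_of (H \<times> H)) \<subseteq>
        gtop G closure_of ((\<lambda>(x, y). x \<otimes> y) ` (H \<times> H))"
      by (rule continuous_map_image_closure_subset[OF continuous_mult])
    also have "\<dots> \<subseteq> gtop G closure_of H"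
      using subgroup.m_closed[OF H] by (intro closure_of_mono) auto
    finally show ?thesis using that by (auto simp: closure_of_Times)
  qed
qed

lemma gstable_closure_of:
  assumes "gstable \<Gamma> G H"
  shows "gstable \<Gamma> G (gtop G closure_of H)"
  unfolding gstable_def
proof
  fix \<sigma> assume "\<sigma> \<in> carrier \<Gamma>"
  then have "gact G \<sigma> ` (gtop G closure_of H) \<subseteq> gtop G closure_of (gact G \<sigma> ` H)"
    by (intro continuous_map_image_closure_subset continuous_gact)
  also have "\<dots> \<subseteq> gtop G closure_of H"
    using assms \<open>\<sigma> \<in> carrier \<Gamma>\<close> by (intro closure_of_mono) (simp add: gstable_def)
  finally show "gact G \<sigma> ` (gtop G closure_of H) \<subseteq> gtop G closure_of H" .
qed

lemma gstable_generate:
  assumes "S \<subseteq> carrier G" "gstable \<Gamma> G S"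
  shows "gstable \<Gamma> G (generate G S)"
  unfolding gstable_def
proof (intro ballI subsetI)
  fix \<sigma> y assume \<sigma>: "\<sigma> \<in> carrier \<Gamma>" and "y \<in> gact G \<sigma> ` generate G S"
  then obtain x where x: "x \<in> generate G S" "y = gact G \<sigma> x" by blast
  from x(1) have "gact G \<sigma> x \<in> generate G S"
  proof induction
    case one
    then show ?case using \<sigma> by (simp add: generate.one)
  next
    case (incl h)
    then show ?case using \<sigma> assms(2) by (intro generate.incl) (auto simp: gstable_def)
  next
    case (inv h)
    then have "h \<in> carrier G" "gact G \<sigma> h \<in> S" using \<sigma> assms by (auto simp: gstable_def)
    then show ?case using \<sigma> by (simp add: gact_inv generate.inv)
  next
    case (eng h1 h2)
    then show ?case using \<sigma> generate_in_carrier[OF assms(1)] by (simp add: gact_mult generate.eng)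
  qed
  then show "y \<in> generate G S" using x by simp
qed

lemma cocycle_one:
  assumes "group \<Gamma>" "c \<in> cocycles \<Gamma> G"
  shows "c \<one>\<^bsub>\<Gamma>\<^esub> = \<one>"
proof -
  interpret \<Gamma>: group \<Gamma> by fact
  have "c \<one>\<^bsub>\<Gamma>\<^esub> \<in> carrier G" using assms(2) by (auto simp: cocycles_def)
  moreover have "c (\<one>\<^bsub>\<Gamma>\<^esub> \<otimes>\<^bsub>\<Gamma>\<^esub> \<one>\<^bsub>\<Gamma>\<^esub>) = c \<one>\<^bsub>\<Gamma>\<^esub> \<otimes> gact G \<one>\<^bsub>\<Gamma>\<^esub> (c \<one>\<^bsub>\<Gamma>\<^esub>)"
    using assms(2) \<Gamma>.one_closed unfolding cocycles_def by blast
  ultimately show ?thesis using gact_one by (simp add: l_cancel_one')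
qed

text \<open>The map \<open>x \<mapsto> (x\<^sup>-\<^sup>1 \<gamma>(x))\<^sub>\<gamma>\<close> is a cocycle, hence determined by its values on a generating set
  of \<open>\<Gamma>\<close>.\<close>

lemma cocycle_mem_of_generators:
  assumes \<Gamma>: "group \<Gamma>" and c: "c \<in> cocycles \<Gamma> G"
    and H: "subgroup H G" "gstable \<Gamma> G H"
    and S: "S \<subseteq> carrier \<Gamma>" "generate \<Gamma> S = carrier \<Gamma>" "\<And>\<sigma>. \<sigma> \<in> S \<Longrightarrow> c \<sigma> \<in> H"
    and \<sigma>: "\<sigma> \<in> carrier \<Gamma>"
  shows "c \<sigma> \<in> H"
proof -
  interpret \<Gamma>: group \<Gamma> by fact
  have cc: "c \<sigma> \<in> carrier G" if "\<sigma> \<in> carrier \<Gamma>" for \<sigma> using c that by (auto simp: cocycles_def)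
  have coc: "c (\<sigma> \<otimes>\<^bsub>\<Gamma>\<^esub> \<tau>) = c \<sigma> \<otimes> gact G \<sigma> (c \<tau>)" if "\<sigma> \<in> carrier \<Gamma>" "\<tau> \<in> carrier \<Gamma>" for \<sigma> \<tau>
    using c that by (auto simp: cocycles_def)
  have act: "gact G \<sigma> x \<in> H" if "\<sigma> \<in> carrier \<Gamma>" "x \<in> H" for \<sigma> x using that H(2) by (auto simp: gstable_def)
  have c1: "c \<one>\<^bsub>\<Gamma>\<^esub> = \<one>" by (rule cocycle_one[OF \<Gamma> c])
  have "\<sigma> \<in> generate \<Gamma> S" using \<sigma> S by simp
  then show ?thesis
  proof induction
    case one
    then show ?case using c1 subgroup.one_closed[OF H(1)] by simp
  next
    case (incl h)
    then show ?case using S by simp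
  next
    case (inv h)
    then have h: "h \<in> carrier \<Gamma>" "c h \<in> H" using S by auto
    let ?k = "inv\<^bsub>\<Gamma>\<^esub> h"
    have k: "?k \<in> carrier \<Gamma>" using h by simp
    have "c ?k \<otimes> gact G ?k (c h) = \<one>" using coc[OF k h(1)] h c1 by simp
    then have "c ?k = inv (gact G ?k (c h))"
      using inv_equality[of "c ?k" "gact G ?k (c h)"] cc[OF k] cc[OF h(1)] k by simp
    then show ?case using act[OF k h(2)] subgroup.m_inv_closed[OF H(1)] by simp
  next
    case (eng h1 h2)
    then have "h1 \<in> carrier \<Gamma>" "h2 \<in> carrier \<Gamma>" using S \<Gamma>.generate_in_carrier by metis+
    then show ?case using eng coc act subgroup.m_closed[OF H(1)] by simp
  qed
qed

text \<open>Equalizers of maps on F_n are closed \<Gamma>-subgroups of F_n, whereas minimality of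
  F_n is stated inside the free group; this lemma bridges the two.\<close>

lemma closed_gsubgroup_trans:
  assumes "closed_gsubgroup \<Gamma> G E" "closed_gsubgroup \<Gamma> (gsub G E) T"
  shows "closed_gsubgroup \<Gamma> G T"
proof -
  have E: "subgroup E G" "closedin (gtop G) E" "gstable \<Gamma> G E" using assms(1) by (auto simp: closed_gsubgroup_def)
  have T: "subgroup T (gsub G E)" "closedin (gtop (gsub G E)) T" "gstable \<Gamma> (gsub G E) T"
    using assms(2) by (auto simp: closed_gsubgroup_def)
  have TE: "T \<subseteq> E" using subgroup.subset[OF T(1)] by simp
  have "subgroup T G"
  proof (rule subgroupI)
    show "T \<subseteq> carrier G" using TE subgroup.subset[OF E(1)] by blast
    show "T \<noteq> {}" using subgroup.one_closed[OF T(1)] by blast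
    show "inv a \<in> T" if "a \<in> T" for a
      using subgroup.m_inv_closed[OF T(1) that] m_inv_gsub[OF is_group E(1), of a] TE that by auto
    show "a \<otimes> b \<in> T" if "a \<in> T" "b \<in> T" for a b
      using subgroup.m_closed[OF T(1) that] by simp
  qed
  moreover have "closedin (gtop G) T" using T(2) E(2) closedin_trans_full by auto
  moreover have "gstable \<Gamma> G T" using T(3) by (simp add: gstable_def)
  ultimately show ?thesis by (simp add: closed_gsubgroup_def)
qed

end

section \<open>F_n represents n-tuples of cocycles\<close>

locale generated_finite_group = \<Gamma>: group \<Gamma> for \<Gamma> :: "'g monoid" +
  fixes gs :: "'g list"
  assumes finite_\<Gamma>: "finite (carrier \<Gamma>)" and gs: "set gs \<subseteq> carrier \<Gamma>"
    and generate_gs: "generate \<Gamma> (set gs) = carrier \<Gamma>"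
begin

lemma group_\<Gamma>: "group \<Gamma>" ..

text \<open>The i-th universal cocycle. It is the coboundary of x_i in the free group, but x_i need
  not lie in F_n, so inside F_n it is in general only a cocycle.\<close>

definition Fn_cocycle :: "nat \<Rightarrow> nat \<Rightarrow> 'g \<Rightarrow> 'g free_elem" where
  "Fn_cocycle n i = coboundary \<Gamma> (free_ggroup \<Gamma> n) (free_gen \<Gamma> n i \<one>\<^bsub>\<Gamma>\<^esub>)"

abbreviation Fn_carrier :: "nat \<Rightarrow> 'g free_elem set" where
  "Fn_carrier n \<equiv> carrier (Fn \<Gamma> gs n)"

context
  fixes n :: nat
begin

abbreviation (input) W where "W \<equiv> free_ambient \<Gamma> n"
abbreviation (input) F where "F \<equiv> free_ggroup \<Gamma> n"

interpretation W: topological_ggroup \<Gamma> W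
  by (rule topological_ggroup_free_ambient[OF group_\<Gamma>])

lemma free_gen_carrier:
  assumes "\<gamma> \<in> carrier \<Gamma>" "i < n"
  shows "free_gen \<Gamma> n i \<gamma> \<in> carrier W"
  using assms by (auto simp: free_gen_def free_index_def PiE_iff)

lemma closed_gsubgroup_free: "closed_gsubgroup \<Gamma> W (carrier F)"
  and free_gen_mem: "\<lbrakk>\<gamma> \<in> carrier \<Gamma>; i < n\<rbrakk> \<Longrightarrow> free_gen \<Gamma> n i \<gamma> \<in> carrier F"
proof -
  let ?S = "{free_gen \<Gamma> n i \<gamma> | i \<gamma>. i < n \<and> \<gamma> \<in> carrier \<Gamma>}"
  have S: "?S \<subseteq> carrier W" using free_gen_carrier by blast
  have st: "gstable \<Gamma> W ?S"
    unfolding gstable_def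
  proof (intro ballI subsetI)
    fix \<sigma> y assume \<sigma>: "\<sigma> \<in> carrier \<Gamma>" and "y \<in> gact W \<sigma> ` ?S"
    then obtain i \<gamma> where "i < n" "\<gamma> \<in> carrier \<Gamma>" "y = gact W \<sigma> (free_gen \<Gamma> n i \<gamma>)" by blast
    then have "y = free_gen \<Gamma> n i (\<sigma> \<otimes>\<^bsub>\<Gamma>\<^esub> \<gamma>)" "\<sigma> \<otimes>\<^bsub>\<Gamma>\<^esub> \<gamma> \<in> carrier \<Gamma>"
      using gact_free_gen[OF group_\<Gamma> \<sigma>] \<sigma> by auto
    then show "y \<in> ?S" using \<open>i < n\<close> by blast
  qed
  have F: "carrier F = gtop W closure_of generate W ?S" by (simp add: free_ggroup_def)
  show "closed_gsubgroup \<Gamma> W (carrier F)"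
    unfolding closed_gsubgroup_def F
    by (intro conjI W.subgroup_closure_of W.generate_is_subgroup S closedin_closure_of
        W.gstable_closure_of W.gstable_generate st)
  show "free_gen \<Gamma> n i \<gamma> \<in> carrier F" if "\<gamma> \<in> carrier \<Gamma>" "i < n"
  proof -
    have "generate W ?S \<subseteq> topspace (gtop W)" using W.generate_incl[OF S] W.topspace_gtop by simp
    from closure_of_subset[OF this] show ?thesis
      unfolding F using that generate.incl[of "free_gen \<Gamma> n i \<gamma>" ?S W] by blast
  qed
qed

lemma free_ggroup_eq: "F = gsub W (carrier F)"
  by (simp add: free_ggroup_def)

lemma topological_ggroup_free_ggroup: "topological_ggroup \<Gamma> F"
  using W.topological_ggroup_gsub[of "carrier F"] closed_gsubgroup_free free_ggroup_eq
  by (simp add: closed_gsubgroup_def)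

interpretation F: topological_ggroup \<Gamma> F by (rule topological_ggroup_free_ggroup)

lemma Fn_cocycle_mem: "i < n \<Longrightarrow> Fn_cocycle n i \<in> cocycles \<Gamma> F"
  unfolding Fn_cocycle_def by (intro F.coboundary_mem_cocycles group_\<Gamma> free_gen_mem) simp_all

lemma Fn_cocycle_mult: "\<lbrakk>i < n; \<sigma> \<in> carrier \<Gamma>; \<tau> \<in> carrier \<Gamma>\<rbrakk> \<Longrightarrow>
    Fn_cocycle n i (\<sigma> \<otimes>\<^bsub>\<Gamma>\<^esub> \<tau>) = Fn_cocycle n i \<sigma> \<otimes>\<^bsub>F\<^esub> gact F \<sigma> (Fn_cocycle n i \<tau>)"
  using Fn_cocycle_mem by (simp add: cocycles_def)

definition Fn_generators :: "'g free_elem set" where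
  "Fn_generators = {Fn_cocycle n i \<gamma> | i \<gamma>. i < n \<and> \<gamma> \<in> set gs}"

lemma Fn_generators_subset: "Fn_generators \<subseteq> carrier F"
  using Fn_cocycle_mem gs unfolding Fn_generators_def by (auto simp: cocycles_def PiE_iff)

lemma Fn_eq: "Fn \<Gamma> gs n = gsub F (closed_gsubgroup_gen \<Gamma> F Fn_generators)"
proof -
  have "{inv\<^bsub>F\<^esub> (free_gen \<Gamma> n i \<one>\<^bsub>\<Gamma>\<^esub>) \<otimes>\<^bsub>F\<^esub> gact F \<gamma> (free_gen \<Gamma> n i \<one>\<^bsub>\<Gamma>\<^esub>) | i \<gamma>. i < n \<and> \<gamma> \<in> set gs}
      = Fn_generators"
    unfolding Fn_generators_def Fn_cocycle_def coboundary_def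
    by (rule Collect_cong) (use gs in \<open>auto simp: subset_iff; metis\<close>)
  then show ?thesis by (simp add: Fn_def Let_def)
qed

lemma closed_gsubgroup_Fn: "closed_gsubgroup \<Gamma> F (Fn_carrier n)"
  using F.closed_gsubgroup_gen(1)[OF Fn_generators_subset] by (simp add: Fn_eq)

lemma gsub_Fn_carrier: "gsub F (Fn_carrier n) = Fn \<Gamma> gs n"
  by (simp add: Fn_eq)

lemma topological_ggroup_Fn: "topological_ggroup \<Gamma> (Fn \<Gamma> gs n)"
  using F.topological_ggroup_gsub[of "Fn_carrier n"] closed_gsubgroup_Fn
  by (simp add: closed_gsubgroup_def gsub_Fn_carrier)

interpretation Fn: topological_ggroup \<Gamma> "Fn \<Gamma> gs n" by (rule topological_ggroup_Fn)

lemma Fn_induct: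
  assumes "closed_gsubgroup \<Gamma> F T" "\<And>i \<gamma>. \<lbrakk>i < n; \<gamma> \<in> set gs\<rbrakk> \<Longrightarrow> Fn_cocycle n i \<gamma> \<in> T"
  shows "Fn_carrier n \<subseteq> T"
proof -
  have "Fn_generators \<subseteq> T" using assms(2) by (auto simp: Fn_generators_def)
  from closed_gsubgroup_gen_least[OF assms(1) this] show ?thesis by (simp add: Fn_eq)
qed

text \<open>F_n is generated by the values at the members of \<open>gs\<close> only; the cocycle
  identity produces the values at all other elements of \<Gamma>.\<close>

lemma Fn_cocycle_carrier:
  assumes "i < n" "\<gamma> \<in> carrier \<Gamma>"
  shows "Fn_cocycle n i \<gamma> \<in> Fn_carrier n"
proof (rule F.cocycle_mem_of_generators[OF group_\<Gamma> Fn_cocycle_mem[OF assms(1)] _ _ gs generate_gs _ assms(2)])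
  show "subgroup (Fn_carrier n) F" "gstable \<Gamma> F (Fn_carrier n)"
    using closed_gsubgroup_Fn by (auto simp: closed_gsubgroup_def)
  show "Fn_cocycle n i \<gamma> \<in> Fn_carrier n" if "\<gamma> \<in> set gs" for \<gamma>
    using F.closed_gsubgroup_gen(2)[OF Fn_generators_subset] that assms(1)
    by (auto simp: Fn_eq Fn_generators_def)
qed

lemma Fn_cocycle_mem_Fn: "i < n \<Longrightarrow> Fn_cocycle n i \<in> cocycles \<Gamma> (Fn \<Gamma> gs n)"
  using F.cocycles_gsub[of "Fn_carrier n"] Fn_cocycle_mem Fn_cocycle_carrier
    subgroup.subset[of "Fn_carrier n" F] closed_gsubgroup_Fn gsub_Fn_carrier
  by (auto simp: closed_gsubgroup_def)

text \<open>The equalizer of two \<Gamma>-homomorphisms into a discrete group is a closed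
  \<Gamma>-subgroup, and it contains the generators.\<close>

lemma Fn_hom_eqI:
  assumes B: "finite_ggroup \<Gamma> B" and "\<phi> \<in> gHom \<Gamma> (Fn \<Gamma> gs n) B" "\<psi> \<in> gHom \<Gamma> (Fn \<Gamma> gs n) B"
    and eq: "\<And>i \<gamma>. \<lbrakk>i < n; \<gamma> \<in> carrier \<Gamma>\<rbrakk> \<Longrightarrow> \<phi> (Fn_cocycle n i \<gamma>) = \<psi> (Fn_cocycle n i \<gamma>)"
  shows "\<phi> = \<psi>"
proof -
  interpret B: finite_ggroup \<Gamma> B by fact
  have \<phi>: "\<phi> \<in> hom (Fn \<Gamma> gs n) B" "continuous_map (gtop (Fn \<Gamma> gs n)) (gtop B) \<phi>"
      "gequivariant \<Gamma> (Fn \<Gamma> gs n) B \<phi>" "\<phi> \<in> extensional (Fn_carrier n)"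
    and \<psi>: "\<psi> \<in> hom (Fn \<Gamma> gs n) B" "continuous_map (gtop (Fn \<Gamma> gs n)) (gtop B) \<psi>"
      "gequivariant \<Gamma> (Fn \<Gamma> gs n) B \<psi>" "\<psi> \<in> extensional (Fn_carrier n)"
    using assms by (simp_all add: gHom_def)
  interpret \<phi>: group_hom "Fn \<Gamma> gs n" B \<phi> by (simp add: group_hom.intro group_hom_axioms.intro \<phi>)
  interpret \<psi>: group_hom "Fn \<Gamma> gs n" B \<psi> by (simp add: group_hom.intro group_hom_axioms.intro \<psi>)
  let ?T = "{x \<in> Fn_carrier n. \<phi> x = \<psi> x}"
  have "closed_gsubgroup \<Gamma> (Fn \<Gamma> gs n) ?T"
    unfolding closed_gsubgroup_def
  proof (intro conjI)
    show "subgroup ?T (Fn \<Gamma> gs n)"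
    proof (rule Fn.subgroupI)
      show "?T \<noteq> {}" using Fn.one_closed \<phi>.hom_one \<psi>.hom_one by force
    qed auto
    show "closedin (gtop (Fn \<Gamma> gs n)) ?T"
      using closedin_continuous_maps_eq[OF _ \<phi>(2) \<psi>(2)] Fn.topspace_gtop by (simp add: B.gtop_discrete)
    show "gstable \<Gamma> (Fn \<Gamma> gs n) ?T"
      using \<phi>(3) \<psi>(3) by (auto simp: gstable_def gequivariant_def)
  qed
  then have "closed_gsubgroup \<Gamma> F ?T"
    using F.closed_gsubgroup_trans[OF closed_gsubgroup_Fn] by (simp add: gsub_Fn_carrier)
  then have "Fn_carrier n \<subseteq> ?T"
    by (rule Fn_induct) (use eq Fn_cocycle_carrier gs in blast)
  then show ?thesis by (intro extensionalityI[OF \<phi>(4) \<psi>(4)]) blast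
qed

text \<open>Send x_{i,\<gamma>} to c_i(\<gamma>). The resulting map \<open>P\<close> on the free
  group is in general not equivariant, since it kills x_i but not its translates. It becomes
  equivariant on F_n: the elements on which \<open>P\<close> commutes with \<Gamma> form a closed
  \<Gamma>-subgroup, and the cocycle identity for c_i places the generators in it.\<close>

lemma Fn_hom_exists:
  assumes B: "finite_ggroup \<Gamma> B" "coprime (order B) (order \<Gamma>)"
    and c: "\<And>i. i < n \<Longrightarrow> c i \<in> cocycles \<Gamma> B"
  shows "\<exists>\<phi>\<in>gHom \<Gamma> (Fn \<Gamma> gs n) B. \<forall>i<n. \<forall>\<gamma>\<in>carrier \<Gamma>. \<phi> (Fn_cocycle n i \<gamma>) = c i \<gamma>"
proof -
  interpret B: finite_ggroup \<Gamma> B by fact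
  \<comment> \<open>The factors of \<open>free_ambient\<close> are groups on natural numbers, so the
    target is replaced by a copy \<open>B'\<close>; the inverse \<open>\<eta>\<close> of
    \<open>\<theta>\<close> leads back at the end.\<close>
  obtain B' :: "('g, nat) ggroup" where B': "finite_ggroup \<Gamma> B'" "giso \<Gamma> B B'"
    using B.ex_nat_copy[OF group_\<Gamma>] by blast
  interpret B': finite_ggroup \<Gamma> B' by (rule B')
  obtain \<theta> where \<theta>: "\<theta> \<in> iso B B'" "gequivariant \<Gamma> B B' \<theta>" using B'(2) by (auto simp: giso_def)
  define H where "H = monoid.truncate B'"
  define f where "f = (\<lambda>(i, \<gamma>)\<in>{..<n} \<times> carrier \<Gamma>. \<theta> (c i \<gamma>))"
  have cB: "c i \<gamma> \<in> carrier B" if "i < n" "\<gamma> \<in> carrier \<Gamma>" for i \<gamma> using c that by (auto simp: cocycles_def)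
  have H: "carrier H = carrier B'" "mult H = mult B'" "one H = one B'" by (simp_all add: H_def monoid.defs)
  have "group H" by (rule groupI) (use B'.m_assoc B'.l_inv_ex in \<open>simp_all add: H\<close>)
  moreover have "order H = order B" using iso_same_card[OF is_isoI[OF \<theta>(1)]] by (simp add: order_def H)
  moreover have "\<theta> x \<in> carrier B'" if "x \<in> carrier B" for x using \<theta>(1) that by (auto simp: iso_def hom_def)
  ultimately have Hf: "(H, f) \<in> free_index \<Gamma> n"
    using B(2) cB by (auto simp: free_index_def H f_def)
  define P where "P = (\<lambda>w :: 'g free_elem. w (H, f))"
  have FW: "carrier F \<subseteq> carrier W" using closed_gsubgroup_free unfolding closed_gsubgroup_def by (intro subgroup.subset) simp
  have PW: "P \<in> hom W B'" using free_proj_hom[OF Hf] by (simp add: P_def hom_def H)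
  have multF: "mult F = mult W" by (subst free_ggroup_eq) simp
  have P: "P \<in> hom F B'"
    using PW FW unfolding hom_def multF by (auto simp del: free_ambient_simps)
  interpret P: group_hom F B' P by (simp add: group_hom.intro group_hom_axioms.intro P)
  have "continuous_map (gtop W) (gtop B') P"
    using free_proj_continuous[OF Hf] by (simp add: P_def B'.gtop_discrete H del: free_ambient_simps)
  then have Pc: "continuous_map (gtop F) (gtop B') P"
    by (subst free_ggroup_eq) (simp add: continuous_map_from_subtopology del: free_ambient_simps)
  let ?T = "{w \<in> carrier F. \<forall>\<sigma>\<in>carrier \<Gamma>. P (gact F \<sigma> w) = gact B' \<sigma> (P w)}"
  have "closed_gsubgroup \<Gamma> F ?T"
    unfolding closed_gsubgroup_def
  proof (intro conjI)
    show "subgroup ?T F"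
    proof (rule F.subgroupI)
      show "?T \<noteq> {}" using F.one_closed by force
    qed (auto simp: F.gact_mult B'.gact_mult F.gact_inv B'.gact_inv)
    have eq: "closedin (gtop F) {w \<in> topspace (gtop F). P (gact F \<sigma> w) = gact B' \<sigma> (P w)}"
      if "\<sigma> \<in> carrier \<Gamma>" for \<sigma>
    proof (rule closedin_continuous_maps_eq)
      show "Hausdorff_space (gtop B')" by (simp add: B'.gtop_discrete)
      show "continuous_map (gtop F) (gtop B') (\<lambda>w. P (gact F \<sigma> w))"
        using continuous_map_compose[OF F.continuous_gact[OF that] Pc] by (simp add: o_def)
      show "continuous_map (gtop F) (gtop B') (\<lambda>w. gact B' \<sigma> (P w))"
        using continuous_map_compose[OF Pc B'.continuous_gact[OF that]] by (simp add: o_def)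
    qed
    \<comment> \<open>The unit of \<Gamma> makes the index set non-empty, so that the intersection
      stays inside the carrier.\<close>
    have "?T = (\<Inter>\<sigma>\<in>carrier \<Gamma>. {w \<in> topspace (gtop F). P (gact F \<sigma> w) = gact B' \<sigma> (P w)})"
      using \<Gamma>.one_closed by (auto simp: F.topspace_gtop)
    then show "closedin (gtop F) ?T" using eq \<Gamma>.one_closed by (auto intro!: closedin_Inter)
    show "gstable \<Gamma> F ?T"
      by (auto simp: gstable_def F.gact_comp[symmetric] B'.gact_comp[symmetric])
  qed
  moreover have P_gen: "P (Fn_cocycle n i \<gamma>) = \<theta> (c i \<gamma>)" if "i < n" "\<gamma> \<in> carrier \<Gamma>" for i \<gamma>
  proof -
    interpret \<theta>: group_hom B B' \<theta> using \<theta>(1) by (simp add: group_hom.intro group_hom_axioms.intro iso_def)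
    have "gact F \<gamma> (free_gen \<Gamma> n i \<one>\<^bsub>\<Gamma>\<^esub>) = free_gen \<Gamma> n i \<gamma>"
      using gact_free_gen[OF group_\<Gamma> that(2) \<Gamma>.one_closed that(1)] that(2) by (subst free_ggroup_eq) simp
    moreover have "P (free_gen \<Gamma> n i \<gamma>) = \<theta> (c i \<gamma>)" if "\<gamma> \<in> carrier \<Gamma>" for \<gamma>
      using free_proj_gen[OF Hf] that \<open>i < n\<close> by (simp add: P_def f_def)
    \<comment> \<open>Because c_i is trivial at the unit, \<open>P\<close> kills x_i, and x_i^(-1)
      x_{i,\<gamma>} goes to c_i(\<gamma>) on the nose.\<close>
    moreover have "c i \<one>\<^bsub>\<Gamma>\<^esub> = \<one>\<^bsub>B\<^esub>" using B.cocycle_one[OF group_\<Gamma> c[OF that(1)]] .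
    ultimately show ?thesis using that free_gen_mem[OF _ that(1)] cB
      by (simp add: Fn_cocycle_def coboundary_def)
  qed
  moreover have "Fn_cocycle n i \<gamma> \<in> ?T" if i: "i < n" and \<gamma>: "\<gamma> \<in> carrier \<Gamma>" for i \<gamma>
  proof -
    have d: "Fn_cocycle n i \<sigma> \<in> carrier F" if "\<sigma> \<in> carrier \<Gamma>" for \<sigma>
      using Fn_cocycle_mem[OF i] that by (auto simp: cocycles_def)
    have "P (gact F \<sigma> (Fn_cocycle n i \<gamma>)) = gact B' \<sigma> (P (Fn_cocycle n i \<gamma>))" if \<sigma>: "\<sigma> \<in> carrier \<Gamma>" for \<sigma>
    proof -
      interpret \<theta>: group_hom B B' \<theta> using \<theta>(1) by (simp add: group_hom.intro group_hom_axioms.intro iso_def)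
      \<comment> \<open>The value of \<open>P\<close> at the universal cocycle at \<sigma>\<gamma>
        is computed in two ways, once through the cocycle identity in the free group and once
        through that of c_i; cancelling c_i(\<sigma>) leaves the equivariance.\<close>
      have "\<theta> (c i \<sigma>) \<otimes>\<^bsub>B'\<^esub> P (gact F \<sigma> (Fn_cocycle n i \<gamma>)) = P (Fn_cocycle n i (\<sigma> \<otimes>\<^bsub>\<Gamma>\<^esub> \<gamma>))"
        using d \<sigma> \<gamma> by (simp add: Fn_cocycle_mult[OF i \<sigma> \<gamma>] P_gen[OF i])
      also have "\<dots> = \<theta> (c i \<sigma> \<otimes>\<^bsub>B\<^esub> gact B \<sigma> (c i \<gamma>))"
        using P_gen[OF i] \<sigma> \<gamma> c[OF i] by (simp add: cocycles_def)
      also have "\<dots> = \<theta> (c i \<sigma>) \<otimes>\<^bsub>B'\<^esub> gact B' \<sigma> (\<theta> (c i \<gamma>))"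
        using cB[OF i] \<sigma> \<gamma> \<theta>(2) by (simp add: gequivariant_def)
      finally show ?thesis
        using cB[OF i] \<sigma> \<gamma> d P_gen[OF i \<gamma>] by simp
    qed
    then show ?thesis using d \<gamma> by simp
  qed
  ultimately have T: "Fn_carrier n \<subseteq> ?T" using gs by (intro Fn_induct) (simp_all add: subset_iff)
  define \<eta> where "\<eta> = inv_into (carrier B) \<theta>"
  have \<eta>: "\<eta> \<in> iso B' B" unfolding \<eta>_def by (rule B.iso_set_sym[OF \<theta>(1)])
  have bij: "bij_betw \<theta> (carrier B) (carrier B')" using \<theta>(1) by (simp add: iso_def)
  have \<eta>\<theta>: "\<eta> (\<theta> b) = b" if "b \<in> carrier B" for b
    using bij_betw_inv_into_left[OF bij that] by (simp add: \<eta>_def)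
  have \<eta>_act: "\<eta> (gact B' \<sigma> y) = gact B \<sigma> (\<eta> y)" if "\<sigma> \<in> carrier \<Gamma>" "y \<in> carrier B'" for \<sigma> y
  proof -
    obtain b where b: "b \<in> carrier B" "y = \<theta> b" using \<open>y \<in> carrier B'\<close> bij by (auto simp: bij_betw_def)
    then have "gact B' \<sigma> y = \<theta> (gact B \<sigma> b)" using that \<theta>(2) by (simp add: gequivariant_def)
    then show ?thesis using b that \<eta>\<theta> by simp
  qed
  define \<phi> where "\<phi> = restrict (\<eta> \<circ> P) (Fn_carrier n)"
  have sub: "Fn_carrier n \<subseteq> carrier F" using T by blast
  have multFn: "mult (Fn \<Gamma> gs n) = mult F" "gact (Fn \<Gamma> gs n) = gact F" "gtop (Fn \<Gamma> gs n) = subtopology (gtop F) (Fn_carrier n)"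
    using gsub_simps[of F "Fn_carrier n", unfolded gsub_Fn_carrier] by blast+
  have \<eta>h: "\<eta> \<in> hom B' B" using \<eta> by (simp add: iso_def)
  have "\<phi> \<in> gHom \<Gamma> (Fn \<Gamma> gs n) B"
    unfolding gHom_def
  proof (intro CollectI conjI)
    show "\<phi> \<in> extensional (Fn_carrier n)" by (simp add: \<phi>_def)
    show "\<phi> \<in> hom (Fn \<Gamma> gs n) B"
    proof (rule homI)
      fix x y assume xy: "x \<in> Fn_carrier n" "y \<in> Fn_carrier n"
      then show "\<phi> (x \<otimes>\<^bsub>Fn \<Gamma> gs n\<^esub> y) = \<phi> x \<otimes>\<^bsub>B\<^esub> \<phi> y"
        using Fn.m_closed[OF xy] subsetD[OF sub] \<eta>h by (simp add: \<phi>_def multFn hom_def Pi_iff)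
    next
      fix x assume "x \<in> Fn_carrier n"
      then show "\<phi> x \<in> carrier B" using subsetD[OF sub] hom_in_carrier[OF \<eta>h] by (simp add: \<phi>_def)
    qed
    have "continuous_map (gtop F) (gtop B) (\<eta> \<circ> P)"
      using hom_in_carrier[OF \<eta>h] by (intro continuous_map_compose[OF Pc]) (auto simp: B.gtop_discrete B'.gtop_discrete)
    then have "continuous_map (gtop (Fn \<Gamma> gs n)) (gtop B) (\<eta> \<circ> P)"
      by (simp add: multFn continuous_map_from_subtopology)
    then show "continuous_map (gtop (Fn \<Gamma> gs n)) (gtop B) \<phi>"
      by (rule continuous_map_eq) (simp add: \<phi>_def Fn.topspace_gtop)
    show "gequivariant \<Gamma> (Fn \<Gamma> gs n) B \<phi>"
      unfolding gequivariant_def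
    proof (intro ballI)
      fix \<sigma> x assume s: "\<sigma> \<in> carrier \<Gamma>" "x \<in> Fn_carrier n"
      then have "gact F \<sigma> x \<in> Fn_carrier n" using Fn.gact_closed[OF s] by (simp add: multFn)
      moreover have "P (gact F \<sigma> x) = gact B' \<sigma> (P x)" using s T by blast
      ultimately show "\<phi> (gact (Fn \<Gamma> gs n) \<sigma> x) = gact B \<sigma> (\<phi> x)"
        using s subsetD[OF sub] by (simp add: \<phi>_def multFn \<eta>_act)
    qed
  qed
  moreover have "\<phi> (Fn_cocycle n i \<gamma>) = c i \<gamma>" if "i < n" "\<gamma> \<in> carrier \<Gamma>" for i \<gamma>
    using that by (simp add: \<phi>_def Fn_cocycle_carrier P_gen \<eta>\<theta> cB)
  ultimately show ?thesis by blast
qed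

text \<open>Thus \<open>\<F>\<^sub>n\<close> is the free admissible group on \<open>n\<close> cocycles.\<close>

definition hom_cocycles :: "('g free_elem \<Rightarrow> 'b) \<Rightarrow> nat \<Rightarrow> 'g \<Rightarrow> 'b" where
  "hom_cocycles \<phi> = (\<lambda>i\<in>{..<n}. \<lambda>\<gamma>\<in>carrier \<Gamma>. \<phi> (Fn_cocycle n i \<gamma>))"

lemma hom_cocycles_mem:
  assumes "finite_ggroup \<Gamma> B" "\<phi> \<in> gHom \<Gamma> (Fn \<Gamma> gs n) B"
  shows "hom_cocycles \<phi> \<in> {..<n} \<rightarrow>\<^sub>E cocycles \<Gamma> (gsub B (\<phi> ` Fn_carrier n))"
proof -
  have \<phi>: "\<phi> \<in> hom (Fn \<Gamma> gs n) B" "gequivariant \<Gamma> (Fn \<Gamma> gs n) B \<phi>" using assms by (auto simp: gHom_def)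
  have "(\<lambda>\<gamma>\<in>carrier \<Gamma>. \<phi> (Fn_cocycle n i \<gamma>)) \<in> cocycles \<Gamma> (gsub B (\<phi> ` Fn_carrier n))" if i: "i < n" for i
    using Fn_cocycle_mem_Fn[OF i] \<phi> Fn_cocycle_carrier[OF i]
    by (auto simp: cocycles_def PiE_iff gequivariant_def hom_mult)
  then show ?thesis by (auto simp: hom_cocycles_def)
qed

lemma inj_on_hom_cocycles:
  assumes "finite_ggroup \<Gamma> B"
  shows "inj_on hom_cocycles (gHom \<Gamma> (Fn \<Gamma> gs n) B)"
proof (rule inj_onI)
  fix \<phi> \<psi> assume a: "\<phi> \<in> gHom \<Gamma> (Fn \<Gamma> gs n) B" "\<psi> \<in> gHom \<Gamma> (Fn \<Gamma> gs n) B" "hom_cocycles \<phi> = hom_cocycles \<psi>"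
  have "\<phi> (Fn_cocycle n i \<gamma>) = \<psi> (Fn_cocycle n i \<gamma>)" if "i < n" "\<gamma> \<in> carrier \<Gamma>" for i \<gamma>
    using fun_cong[OF fun_cong[OF a(3)], of i \<gamma>] that by (simp add: hom_cocycles_def)
  then show "\<phi> = \<psi>" by (rule Fn_hom_eqI[OF assms a(1,2)])
qed

lemma finite_gHom_Fn: "finite_ggroup \<Gamma> B \<Longrightarrow> finite (gHom \<Gamma> (Fn \<Gamma> gs n) B)"
proof -
  assume B: "finite_ggroup \<Gamma> B"
  interpret B: finite_ggroup \<Gamma> B by fact
  have "hom_cocycles ` gHom \<Gamma> (Fn \<Gamma> gs n) B \<subseteq> {..<n} \<rightarrow>\<^sub>E (carrier \<Gamma> \<rightarrow>\<^sub>E carrier B)"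
  proof (rule image_subsetI)
    fix \<phi> assume \<phi>: "\<phi> \<in> gHom \<Gamma> (Fn \<Gamma> gs n) B"
    then have "\<phi> ` Fn_carrier n \<subseteq> carrier B" by (simp add: gHom_def hom_carrier)
    then show "hom_cocycles \<phi> \<in> {..<n} \<rightarrow>\<^sub>E (carrier \<Gamma> \<rightarrow>\<^sub>E carrier B)"
      using hom_cocycles_mem[OF B \<phi>] by (auto simp: PiE_iff cocycles_def)
  qed
  then show ?thesis
    using finite_subset[OF _ finite_PiE] finite_\<Gamma> finite_PiE
    by (intro inj_on_finite[OF inj_on_hom_cocycles[OF B]]) (auto intro!: finite_PiE)
qed

text \<open>A homomorphism with image D is determined by the n cocycles it induces, and these take
  values in D.\<close>

lemma card_gHom_image_le:
  assumes "finite_ggroup \<Gamma> B" "D \<subseteq> carrier B"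
  shows "card {\<phi> \<in> gHom \<Gamma> (Fn \<Gamma> gs n) B. \<phi> ` Fn_carrier n = D} \<le> card (cocycles \<Gamma> (gsub B D)) ^ n"
proof -
  interpret B: finite_ggroup \<Gamma> B by fact
  have fin: "finite (cocycles \<Gamma> (gsub B D))"
    using finite_subset[OF _ B.finite_cocycles[OF finite_\<Gamma>]] by (auto simp: B.cocycles_gsub[OF assms(2)])
  have "card {\<phi> \<in> gHom \<Gamma> (Fn \<Gamma> gs n) B. \<phi> ` Fn_carrier n = D} \<le> card ({..<n} \<rightarrow>\<^sub>E cocycles \<Gamma> (gsub B D))"
  proof (rule card_inj_on_le)
    show "inj_on hom_cocycles {\<phi> \<in> gHom \<Gamma> (Fn \<Gamma> gs n) B. \<phi> ` Fn_carrier n = D}"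
      by (rule inj_on_subset[OF inj_on_hom_cocycles[OF assms(1)]]) auto
    show "hom_cocycles ` {\<phi> \<in> gHom \<Gamma> (Fn \<Gamma> gs n) B. \<phi> ` Fn_carrier n = D} \<subseteq> {..<n} \<rightarrow>\<^sub>E cocycles \<Gamma> (gsub B D)"
      using hom_cocycles_mem[OF assms(1)] by blast
    show "finite ({..<n} \<rightarrow>\<^sub>E cocycles \<Gamma> (gsub B D))" using fin by (simp add: finite_PiE)
  qed
  then show ?thesis by (simp add: card_PiE)
qed

text \<open>Uniqueness bounds the count from above; existence, for which the order of B must be
  prime to that of \<Gamma>, makes the bound an equality.\<close>

lemma card_gHom_Fn:
  assumes "finite_ggroup \<Gamma> B" "coprime (order B) (order \<Gamma>)"
  shows "card (gHom \<Gamma> (Fn \<Gamma> gs n) B) = card (cocycles \<Gamma> B) ^ n"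
proof -
  interpret B: finite_ggroup \<Gamma> B by fact
  have "hom_cocycles ` gHom \<Gamma> (Fn \<Gamma> gs n) B = {..<n} \<rightarrow>\<^sub>E cocycles \<Gamma> B"
  proof (intro subset_antisym image_subsetI subsetI)
    fix \<phi> assume \<phi>: "\<phi> \<in> gHom \<Gamma> (Fn \<Gamma> gs n) B"
    then have "\<phi> ` Fn_carrier n \<subseteq> carrier B" by (simp add: gHom_def hom_carrier)
    then show "hom_cocycles \<phi> \<in> {..<n} \<rightarrow>\<^sub>E cocycles \<Gamma> B"
      using hom_cocycles_mem[OF assms(1) \<phi>] by (auto simp: PiE_iff B.cocycles_gsub)
  next
    fix c assume c: "c \<in> {..<n} \<rightarrow>\<^sub>E cocycles \<Gamma> B"
    then obtain \<phi> where \<phi>: "\<phi> \<in> gHom \<Gamma> (Fn \<Gamma> gs n) B" "\<forall>i<n. \<forall>\<gamma>\<in>carrier \<Gamma>. \<phi> (Fn_cocycle n i \<gamma>) = c i \<gamma>"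
      using Fn_hom_exists[OF assms, of c] PiE_mem[OF c] by (auto simp: lessThan_iff)
    have "hom_cocycles \<phi> i \<gamma> = c i \<gamma>" for i \<gamma>
      using \<phi>(2) c by (auto simp: hom_cocycles_def PiE_iff cocycles_def extensional_def restrict_def)
    then have "c = hom_cocycles \<phi>" by (simp add: fun_eq_iff)
    then show "c \<in> hom_cocycles ` gHom \<Gamma> (Fn \<Gamma> gs n) B" using \<phi>(1) by blast
  qed
  then show ?thesis
    using card_image[OF inj_on_hom_cocycles[OF assms(1)]] by (simp add: card_PiE)
qed

end

end

section \<open>Moments of the number of surviving surjections\<close>

text \<open>Linearity of expectation over \<open>T\<close>; for a fixed t the k coordinates are
  independent, so the event for t has probability prob(K t)^k.\<close>

lemma (in prob_space) PiM_count_moment: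
  fixes k :: nat
  assumes T: "finite T" and K: "\<And>t. t \<in> T \<Longrightarrow> K t \<in> sets M"
  defines "P \<equiv> PiM {..<k} (\<lambda>_. M)"
  shows "integrable P (\<lambda>r. real (card {t \<in> T. \<forall>j<k. r j \<in> K t}))"
    and "(\<integral>r. real (card {t \<in> T. \<forall>j<k. r j \<in> K t}) \<partial>P) = (\<Sum>t\<in>T. prob (K t) ^ k)"
proof -
  interpret F: finite_product_prob_space "\<lambda>_. M" "{..<k::nat}"
    by standard simp
  have P: "P = PiM {..<k} (\<lambda>_. M)" by (simp add: P_def)
  have meas: "(\<Pi>\<^sub>E j\<in>{..<k}. K t) \<in> sets P" if "t \<in> T" for t
    unfolding P using K[OF that] by (intro sets_PiM_I_finite) auto
  have eq: "real (card {t \<in> T. \<forall>j<k. r j \<in> K t}) = (\<Sum>t\<in>T. indicator (\<Pi>\<^sub>E j\<in>{..<k}. K t) r)"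
    if "r \<in> space P" for r
  proof -
    have "r \<in> extensional {..<k}" using that by (simp add: P space_PiM PiE_def)
    then have "r \<in> (\<Pi>\<^sub>E j\<in>{..<k}. K t) \<longleftrightarrow> (\<forall>j<k. r j \<in> K t)" for t by (auto simp: PiE_iff)
    then have "(\<Sum>t\<in>T. indicator (\<Pi>\<^sub>E j\<in>{..<k}. K t) r) = (\<Sum>t\<in>T. if \<forall>j<k. r j \<in> K t then 1 else (0::real))"
      by (intro sum.cong) (auto simp: indicator_def)
    then show ?thesis using T by (simp add: sum.If_cases Int_def)
  qed
  have int: "integrable P (indicator (\<Pi>\<^sub>E j\<in>{..<k}. K t) :: _ \<Rightarrow> real)" if "t \<in> T" for t
    using meas[OF that] by (intro integrable_real_indicator) (auto simp: P less_top[symmetric])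
  show "integrable P (\<lambda>r. real (card {t \<in> T. \<forall>j<k. r j \<in> K t}))"
    by (subst Bochner_Integration.integrable_cong[OF refl eq]) (auto intro!: Bochner_Integration.integrable_sum int)
  have "(\<integral>r. real (card {t \<in> T. \<forall>j<k. r j \<in> K t}) \<partial>P) =
      (\<integral>r. (\<Sum>t\<in>T. indicator (\<Pi>\<^sub>E j\<in>{..<k}. K t) r) \<partial>P)"
    by (rule Bochner_Integration.integral_cong[OF refl eq])
  also have "\<dots> = (\<Sum>t\<in>T. \<integral>r. indicator (\<Pi>\<^sub>E j\<in>{..<k}. K t) r \<partial>P)"
    by (rule Bochner_Integration.integral_sum) (rule int)
  also have "\<dots> = (\<Sum>t\<in>T. measure P (\<Pi>\<^sub>E j\<in>{..<k}. K t))"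
  proof (rule sum.cong[OF refl])
    fix t assume "t \<in> T"
    then have "(\<Pi>\<^sub>E j\<in>{..<k}. K t) \<inter> space P = (\<Pi>\<^sub>E j\<in>{..<k}. K t)"
      using sets.sets_into_space[OF meas] by (simp add: Int_absorb2)
    then show "(\<integral>r. indicator (\<Pi>\<^sub>E j\<in>{..<k}. K t) r \<partial>P) = measure P (\<Pi>\<^sub>E j\<in>{..<k}. K t)" by simp
  qed
  also have "\<dots> = (\<Sum>t\<in>T. prob (K t) ^ k)"
    unfolding P using F.prob_times K by (intro sum.cong) auto
  finally show "(\<integral>r. real (card {t \<in> T. \<forall>j<k. r j \<in> K t}) \<partial>P) = (\<Sum>t\<in>T. prob (K t) ^ k)" .
qed

text \<open>The square of a count is the count of pairs, so this is the first moment for the family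
  K s \<inter> K t.\<close>

lemma (in prob_space) PiM_count_second_moment:
  fixes k :: nat
  assumes T: "finite T" and K: "\<And>t. t \<in> T \<Longrightarrow> K t \<in> sets M"
  defines "P \<equiv> PiM {..<k} (\<lambda>_. M)"
  shows "integrable P (\<lambda>r. (real (card {t \<in> T. \<forall>j<k. r j \<in> K t}))\<^sup>2)"
    and "(\<integral>r. (real (card {t \<in> T. \<forall>j<k. r j \<in> K t}))\<^sup>2 \<partial>P) = (\<Sum>(s, t)\<in>T \<times> T. prob (K s \<inter> K t) ^ k)"
proof -
  let ?K = "\<lambda>(s, t). K s \<inter> K t"
  have sq: "(real (card {t \<in> T. \<forall>j<k. r j \<in> K t}))\<^sup>2 = real (card {p \<in> T \<times> T. \<forall>j<k. r j \<in> ?K p})" for r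
  proof -
    have "{p \<in> T \<times> T. \<forall>j<k. r j \<in> ?K p} = {t \<in> T. \<forall>j<k. r j \<in> K t} \<times> {t \<in> T. \<forall>j<k. r j \<in> K t}"
      by auto
    then show ?thesis by (simp add: card_cartesian_product power2_eq_square)
  qed
  have "?K p \<in> sets M" if "p \<in> T \<times> T" for p using that K by auto
  then show "integrable P (\<lambda>r. (real (card {t \<in> T. \<forall>j<k. r j \<in> K t}))\<^sup>2)"
      and "(\<integral>r. (real (card {t \<in> T. \<forall>j<k. r j \<in> K t}))\<^sup>2 \<partial>P) = (\<Sum>(s, t)\<in>T \<times> T. prob (K s \<inter> K t) ^ k)"
    using PiM_count_moment[of "T \<times> T" ?K k] T unfolding P_def sq by (simp_all only: case_prod_unfold finite_cartesian_product)
qed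

definition gsubs :: "'g monoid \<Rightarrow> ('g, 'a) ggroup \<Rightarrow> 'a set set" where
  "gsubs \<Gamma> B = {D. subgroup D B \<and> gstable \<Gamma> B D}"

lemma (in finite_ggroup) finite_gsubs: "finite (gsubs \<Gamma> B)"
  by (rule finite_subset[of _ "Pow (carrier B)"]) (auto simp: gsubs_def dest: subgroup.subset)

lemma (in topological_ggroup) gHom_image_gsubs:
  assumes "topological_ggroup \<Gamma> B" "\<phi> \<in> gHom \<Gamma> G B"
  shows "\<phi> ` carrier G \<in> gsubs \<Gamma> B"
proof -
  interpret B: topological_ggroup \<Gamma> B by fact
  interpret group_hom G B \<phi>
    using assms(2) by (simp add: gHom_def group_hom.intro group_hom_axioms.intro)
  have "gact B \<sigma> (\<phi> x) \<in> \<phi> ` carrier G" if "\<sigma> \<in> carrier \<Gamma>" "x \<in> carrier G" for \<sigma> x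
    using assms(2) that by (auto simp: gHom_def gequivariant_def intro!: image_eqI[of _ _ "gact G \<sigma> x"])
  then show ?thesis using img_is_subgroup by (auto simp: gsubs_def gstable_def)
qed

lemma ginvariants_gsub: "D \<subseteq> carrier B \<Longrightarrow> ginvariants \<Gamma> (gsub B D) = ginvariants \<Gamma> B \<inter> D"
  by (auto simp: ginvariants_def)

lemma ginvariants_gprod:
  "ginvariants \<Gamma> (gprod I K) = (\<Pi>\<^sub>E i\<in>I. ginvariants \<Gamma> (K i))" (is "?L = ?R")
proof -
  have "(\<lambda>i\<in>I. gact (K i) \<sigma> (f i)) = f \<longleftrightarrow> (\<forall>i\<in>I. gact (K i) \<sigma> (f i) = f i)" if "f \<in> extensional I" for f \<sigma>
    using that by (auto simp: fun_eq_iff extensional_def restrict_def)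
  then have "f \<in> ?L \<longleftrightarrow> f \<in> ?R" for f
    by (auto simp: ginvariants_def PiE_iff)
  then show ?thesis by blast
qed

locale haar_Fn = generated_finite_group \<Gamma> gs for \<Gamma> :: "'g monoid" and gs :: "'g list" +
  fixes n :: nat and \<nu> :: "'g free_elem measure"
  assumes haar: "haar_prob (Fn \<Gamma> gs n) \<nu>"
begin

sublocale Fn: topological_ggroup \<Gamma> "Fn \<Gamma> gs n" by (rule topological_ggroup_Fn)

sublocale prob_space \<nu> using haar by (simp add: haar_prob_def)

lemma sets_\<nu>: "sets \<nu> = sigma_sets (Fn_carrier n) {U. openin (gtop (Fn \<Gamma> gs n)) U}"
  using haar openin_subset[of "gtop (Fn \<Gamma> gs n)"] Fn.topspace_gtop
  by (simp add: haar_prob_def borel_of_def sets_measure_of Pow_def subset_iff)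

lemma space_\<nu>: "space \<nu> = Fn_carrier n"
proof -
  have "space \<nu> = space (borel_of (gtop (Fn \<Gamma> gs n)))"
    using haar by (intro sets_eq_imp_space_eq) (simp add: haar_prob_def)
  then show ?thesis
    using openin_subset[of "gtop (Fn \<Gamma> gs n)"] Fn.topspace_gtop
    by (simp add: borel_of_def space_measure_of_conv)
qed

text \<open>A \<Gamma>-homomorphism \<phi> kills every coordinate of Y(r) exactly when \<phi>(r) is
  fixed by the generators of \<Gamma>, hence by \<Gamma>. So this is the set of relators that \<phi>
  tolerates.\<close>

definition stab :: "('g, 'b) ggroup \<Rightarrow> ('g free_elem \<Rightarrow> 'b) \<Rightarrow> 'g free_elem set" where
  "stab B \<phi> = {x \<in> Fn_carrier n. \<phi> x \<in> ginvariants \<Gamma> B}"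

context
  fixes B :: "('g, 'b) ggroup"
  assumes B: "finite_ggroup \<Gamma> B"
begin

interpretation B: finite_ggroup \<Gamma> B by (rule B)

lemma fibre_sets:
  assumes "\<phi> \<in> gHom \<Gamma> (Fn \<Gamma> gs n) B" "b \<in> carrier B"
  shows "{x \<in> Fn_carrier n. \<phi> x = b} \<in> sets \<nu>"
proof -
  have "openin (gtop (Fn \<Gamma> gs n)) {x \<in> topspace (gtop (Fn \<Gamma> gs n)). \<phi> x = b}"
    using assms by (simp add: gHom_def B.continuous_map_into_iff)
  then show ?thesis unfolding sets_\<nu> Fn.topspace_gtop by (intro sigma_sets.Basic) simp
qed

text \<open>Left translation by g carries the kernel onto the fibre over \<phi>(g), so invariance
  gives all fibres over the image the same measure, and together they exhaust F_n.\<close>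

lemma prob_fibre:
  assumes \<phi>: "\<phi> \<in> gHom \<Gamma> (Fn \<Gamma> gs n) B" and d: "d \<in> \<phi> ` Fn_carrier n"
  shows "prob {x \<in> Fn_carrier n. \<phi> x = d} = 1 / card (\<phi> ` Fn_carrier n)"
proof -
  have hom: "\<phi> \<in> hom (Fn \<Gamma> gs n) B" using \<phi> by (simp add: gHom_def)
  interpret \<phi>: group_hom "Fn \<Gamma> gs n" B \<phi> by (simp add: group_hom.intro group_hom_axioms.intro hom)
  let ?M = "\<lambda>d. {x \<in> Fn_carrier n. \<phi> x = d}" and ?D = "\<phi> ` Fn_carrier n"
  have DB: "?D \<subseteq> carrier B" using hom_carrier[OF hom] .
  then have fin: "finite ?D" using B.finite_carrier finite_subset by blast
  have eq: "prob (?M d) = prob (?M \<one>\<^bsub>B\<^esub>)" if d: "d \<in> ?D" for d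
  proof -
    obtain g where g: "g \<in> Fn_carrier n" "d = \<phi> g" using d by blast
    have "g <#\<^bsub>Fn \<Gamma> gs n\<^esub> ?M \<one>\<^bsub>B\<^esub> = ?M d"
    proof (intro subset_antisym subsetI)
      fix x assume "x \<in> g <#\<^bsub>Fn \<Gamma> gs n\<^esub> ?M \<one>\<^bsub>B\<^esub>"
      then show "x \<in> ?M d" using g by (auto simp: l_coset_def)
    next
      fix x assume x: "x \<in> ?M d"
      then have "inv\<^bsub>Fn \<Gamma> gs n\<^esub> g \<otimes>\<^bsub>Fn \<Gamma> gs n\<^esub> x \<in> ?M \<one>\<^bsub>B\<^esub>" using g by auto
      moreover have "x = g \<otimes>\<^bsub>Fn \<Gamma> gs n\<^esub> (inv\<^bsub>Fn \<Gamma> gs n\<^esub> g \<otimes>\<^bsub>Fn \<Gamma> gs n\<^esub> x)"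
        using x g by (simp add: Fn.inv_mult_cancel_left)
      ultimately show "x \<in> g <#\<^bsub>Fn \<Gamma> gs n\<^esub> ?M \<one>\<^bsub>B\<^esub>" unfolding l_coset_def by blast
    qed
    moreover have "emeasure \<nu> (g <#\<^bsub>Fn \<Gamma> gs n\<^esub> ?M \<one>\<^bsub>B\<^esub>) = emeasure \<nu> (?M \<one>\<^bsub>B\<^esub>)"
      using haar g fibre_sets[OF \<phi>] by (simp add: haar_prob_def)
    ultimately show ?thesis by (simp add: measure_def)
  qed
  have "1 = prob (\<Union>d\<in>?D. ?M d)"
  proof -
    have "(\<Union>d\<in>?D. ?M d) = space \<nu>" by (auto simp: space_\<nu>)
    then show ?thesis by (simp add: prob_space)
  qed
  also have "\<dots> = (\<Sum>d\<in>?D. prob (?M d))"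
    using fin fibre_sets[OF \<phi>] DB by (intro finite_measure_finite_Union) (auto simp: disjoint_family_on_def)
  also have "\<dots> = card ?D * prob (?M \<one>\<^bsub>B\<^esub>)" using eq by simp
  finally have "1 = card ?D * prob (?M \<one>\<^bsub>B\<^esub>)" .
  moreover have "card ?D \<noteq> 0" using d fin by auto
  ultimately show ?thesis using eq[OF d] by (simp add: field_simps)
qed

text \<open>With D the image of \<phi>, the value \<phi>(r) is uniform on D, and the invariants have
  density 1/[D : D^\<Gamma>] there.\<close>

lemma stab_sets_prob:
  assumes \<phi>: "\<phi> \<in> gHom \<Gamma> (Fn \<Gamma> gs n) B"
  shows "stab B \<phi> \<in> sets \<nu>"
    and "prob (stab B \<phi>) = 1 / gindex \<Gamma> (gsub B (\<phi> ` Fn_carrier n))"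
proof -
  let ?M = "\<lambda>d. {x \<in> Fn_carrier n. \<phi> x = d}" and ?D = "\<phi> ` Fn_carrier n"
  have hom: "\<phi> \<in> hom (Fn \<Gamma> gs n) B" using \<phi> by (simp add: gHom_def)
  have DB: "?D \<subseteq> carrier B" using hom_carrier[OF hom] .
  have Dg: "?D \<in> gsubs \<Gamma> B" using Fn.gHom_image_gsubs[OF B.topological_ggroup_axioms \<phi>] .
  interpret D: finite_ggroup \<Gamma> "gsub B ?D" using B.finite_ggroup_gsub(1) Dg by (simp add: gsubs_def)
  have I: "ginvariants \<Gamma> (gsub B ?D) \<subseteq> ?D" by (auto simp: ginvariants_def)
  have fin: "finite (ginvariants \<Gamma> (gsub B ?D))" using finite_subset[OF I] D.finite_carrier by simp
  have un: "stab B \<phi> = (\<Union>d\<in>ginvariants \<Gamma> (gsub B ?D). ?M d)"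
    using DB by (auto simp: stab_def ginvariants_gsub)
  show "stab B \<phi> \<in> sets \<nu>" unfolding un using fin fibre_sets[OF \<phi>] I DB by (intro sets.finite_UN) blast+
  have "prob (stab B \<phi>) = (\<Sum>d\<in>ginvariants \<Gamma> (gsub B ?D). prob (?M d))"
    unfolding un using fin fibre_sets[OF \<phi>] I DB
    by (intro finite_measure_finite_Union) (auto simp: disjoint_family_on_def subset_iff)
  also have "\<dots> = (\<Sum>d\<in>ginvariants \<Gamma> (gsub B ?D). 1 / card ?D)"
    using prob_fibre[OF \<phi>] I by (intro sum.cong) blast+
  also have "\<dots> = card (ginvariants \<Gamma> (gsub B ?D)) / card ?D" by simp
  also have "\<dots> = 1 / gindex \<Gamma> (gsub B ?D)"
  proof -
    have "gindex \<Gamma> (gsub B ?D) * card (ginvariants \<Gamma> (gsub B ?D)) = card ?D"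
      using D.gindex_mult_card_ginvariants by (simp add: order_def)
    then have "real (card ?D) = gindex \<Gamma> (gsub B ?D) * card (ginvariants \<Gamma> (gsub B ?D))"
      by (metis of_nat_mult)
    moreover have "card ?D > 0" using D.order_pos by (simp add: order_def)
    ultimately have "card (ginvariants \<Gamma> (gsub B ?D)) \<noteq> 0" by (metis mult_0_right of_nat_0 of_nat_eq_0_iff less_irrefl)
    then show ?thesis using \<open>real (card ?D) = _\<close> D.gindex_pos by (simp add: field_simps)
  qed
  finally show "prob (stab B \<phi>) = 1 / gindex \<Gamma> (gsub B ?D)" .
qed

text \<open>Group the homomorphisms by their image D: there are at most |Z^1(\<Gamma>, D)|^n of
  them, and each tolerates a random relator with probability 1/[D : D^\<Gamma>].\<close>

lemma sum_prob_stab_le: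
  "(\<Sum>\<phi>\<in>gHom \<Gamma> (Fn \<Gamma> gs n) B. prob (stab B \<phi>) ^ k) \<le>
     (\<Sum>D\<in>gsubs \<Gamma> B. real (card (cocycles \<Gamma> (gsub B D))) ^ n / real (gindex \<Gamma> (gsub B D)) ^ k)"
proof -
  let ?H = "gHom \<Gamma> (Fn \<Gamma> gs n) B"
  have "(\<Sum>\<phi>\<in>?H. prob (stab B \<phi>) ^ k) =
      (\<Sum>D\<in>gsubs \<Gamma> B. \<Sum>\<phi>\<in>{\<phi> \<in> ?H. \<phi> ` Fn_carrier n = D}. prob (stab B \<phi>) ^ k)"
    using Fn.gHom_image_gsubs[OF B.topological_ggroup_axioms]
    by (intro sum.group[symmetric] finite_gHom_Fn[OF B] B.finite_gsubs) blast
  also have "\<dots> \<le> (\<Sum>D\<in>gsubs \<Gamma> B. real (card (cocycles \<Gamma> (gsub B D))) ^ n / real (gindex \<Gamma> (gsub B D)) ^ k)"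
  proof (rule sum_mono)
    fix D assume D: "D \<in> gsubs \<Gamma> B"
    then have DB: "D \<subseteq> carrier B" by (auto simp: gsubs_def dest: subgroup.subset)
    have "(\<Sum>\<phi>\<in>{\<phi> \<in> ?H. \<phi> ` Fn_carrier n = D}. prob (stab B \<phi>) ^ k) =
        (\<Sum>\<phi>\<in>{\<phi> \<in> ?H. \<phi> ` Fn_carrier n = D}. (1 / gindex \<Gamma> (gsub B D)) ^ k)"
      by (intro sum.cong) (auto simp: stab_sets_prob)
    also have "\<dots> = card {\<phi> \<in> ?H. \<phi> ` Fn_carrier n = D} / real (gindex \<Gamma> (gsub B D)) ^ k"
      by (simp add: power_divide)
    also have "\<dots> \<le> real (card (cocycles \<Gamma> (gsub B D)) ^ n) / real (gindex \<Gamma> (gsub B D)) ^ k"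
      using card_gHom_image_le[OF B DB, of n] by (intro divide_right_mono) auto
    finally show "(\<Sum>\<phi>\<in>{\<phi> \<in> ?H. \<phi> ` Fn_carrier n = D}. prob (stab B \<phi>) ^ k) \<le>
        real (card (cocycles \<Gamma> (gsub B D))) ^ n / real (gindex \<Gamma> (gsub B D)) ^ k" by simp
  qed
  finally show ?thesis .
qed

end

end

lemma (in topological_ggroup) gsub_carrier: "gsub G (carrier G) = G"
  using subtopology_topspace[of "gtop G"] by (simp add: gsub_def topspace_gtop)

section \<open>Surviving surjections: first moments, and second moments through B \<times> B\<close>

context haar_Fn
begin

abbreviation surjections :: "('g, 'b) ggroup \<Rightarrow> ('g free_elem \<Rightarrow> 'b) set" where
  "surjections B \<equiv> gSur \<Gamma> (Fn \<Gamma> gs n) B"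

text \<open>The number of surjections that descend to the quotient by the k relators in r, see
  \<open>card_gSur_Xun\<close>. Unlike the class of that quotient, it is visibly a measurable
  function of r.\<close>

definition survivors :: "('g, 'b) ggroup \<Rightarrow> nat \<Rightarrow> (nat \<Rightarrow> 'g free_elem) \<Rightarrow> nat" where
  "survivors B k r = card {\<phi> \<in> surjections B. \<forall>j<k. r j \<in> stab B \<phi>}"

text \<open>B \<times> B as a product over \<open>bool\<close>, so that the facts about
  \<open>gprod\<close> apply.\<close>

definition square :: "('g, 'b) ggroup \<Rightarrow> ('g, bool \<Rightarrow> 'b) ggroup" where
  "square B = gprod UNIV (\<lambda>_. B)"

definition pairing :: "('g free_elem \<Rightarrow> 'b) \<times> ('g free_elem \<Rightarrow> 'b) \<Rightarrow> 'g free_elem \<Rightarrow> bool \<Rightarrow> 'b" where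
  "pairing = (\<lambda>(\<phi>, \<psi>). \<lambda>x\<in>Fn_carrier n. \<lambda>b. if b then \<phi> x else \<psi> x)"

context
  fixes B :: "('g, 'b) ggroup"
  assumes B: "finite_ggroup \<Gamma> B"
begin

interpretation B: finite_ggroup \<Gamma> B by (rule B)

lemma surjections_subset: "surjections B \<subseteq> gHom \<Gamma> (Fn \<Gamma> gs n) B"
  by (auto simp: gSur_eq)

lemma finite_surjections: "finite (surjections B)"
  by (rule finite_subset[OF surjections_subset finite_gHom_Fn[OF B]])

lemma prob_stab_surjection:
  assumes "\<phi> \<in> surjections B"
  shows "prob (stab B \<phi>) = 1 / gindex \<Gamma> B"
  using stab_sets_prob(2)[OF B, of \<phi>] assms B.gsub_carrier by (simp add: gSur_eq)

lemma stab_sets: "\<phi> \<in> surjections B \<Longrightarrow> stab B \<phi> \<in> sets \<nu>"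
  using stab_sets_prob(1)[OF B] surjections_subset by blast

lemma survivors_moment:
  "integrable (PiM {..<k} (\<lambda>_. \<nu>)) (\<lambda>r. real (survivors B k r))"
  "(\<integral>r. real (survivors B k r) \<partial>PiM {..<k} (\<lambda>_. \<nu>)) = card (surjections B) / real (gindex \<Gamma> B) ^ k"
  using PiM_count_moment[OF finite_surjections stab_sets, where k = k]
  by (simp_all add: survivors_def prob_stab_surjection power_divide)

lemma survivors_second_moment:
  "integrable (PiM {..<k} (\<lambda>_. \<nu>)) (\<lambda>r. (real (survivors B k r))\<^sup>2)"
  "(\<integral>r. (real (survivors B k r))\<^sup>2 \<partial>PiM {..<k} (\<lambda>_. \<nu>)) =
     (\<Sum>(\<phi>, \<psi>)\<in>surjections B \<times> surjections B. prob (stab B \<phi> \<inter> stab B \<psi>) ^ k)"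
  using PiM_count_second_moment[OF finite_surjections stab_sets, where k = k]
  by (simp_all add: survivors_def)

lemma card_gHom_le:
  "card (gHom \<Gamma> (Fn \<Gamma> gs n) B) \<le> card (surjections B) +
     (\<Sum>D\<in>gsubs \<Gamma> B - {carrier B}. card (cocycles \<Gamma> (gsub B D)) ^ n)"
proof -
  let ?H = "gHom \<Gamma> (Fn \<Gamma> gs n) B" and ?G = "gsubs \<Gamma> B - {carrier B}"
  have "?H \<subseteq> surjections B \<union> (\<Union>D\<in>?G. {\<phi> \<in> ?H. \<phi> ` Fn_carrier n = D})"
    using Fn.gHom_image_gsubs[OF B.topological_ggroup_axioms] by (auto simp: gSur_eq)
  moreover have fin: "finite (surjections B \<union> (\<Union>D\<in>?G. {\<phi> \<in> ?H. \<phi> ` Fn_carrier n = D}))"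
    by (rule finite_subset[OF _ finite_gHom_Fn[OF B]]) (auto simp: gSur_eq)
  ultimately have "card ?H \<le> card (surjections B \<union> (\<Union>D\<in>?G. {\<phi> \<in> ?H. \<phi> ` Fn_carrier n = D}))"
    by (intro card_mono)
  also have "\<dots> \<le> card (surjections B) + card (\<Union>D\<in>?G. {\<phi> \<in> ?H. \<phi> ` Fn_carrier n = D})"
    by (rule card_Un_le)
  also have "card (\<Union>D\<in>?G. {\<phi> \<in> ?H. \<phi> ` Fn_carrier n = D}) \<le> (\<Sum>D\<in>?G. card {\<phi> \<in> ?H. \<phi> ` Fn_carrier n = D})"
    by (rule card_UN_le) (simp add: B.finite_gsubs)
  also have "\<dots> \<le> (\<Sum>D\<in>?G. card (cocycles \<Gamma> (gsub B D)) ^ n)"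
  proof (rule sum_mono)
    fix D assume "D \<in> ?G"
    then have "D \<subseteq> carrier B" by (auto simp: gsubs_def dest: subgroup.subset)
    then show "card {\<phi> \<in> ?H. \<phi> ` Fn_carrier n = D} \<le> card (cocycles \<Gamma> (gsub B D)) ^ n"
      by (rule card_gHom_image_le[OF B])
  qed
  finally show ?thesis by simp
qed

lemma finite_ggroup_square: "finite_ggroup \<Gamma> (square B)"
  unfolding square_def by (rule finite_ggroup_gprod) (simp_all add: B group_\<Gamma>)

lemma order_square: "order (square B) = order B ^ 2"
  by (simp add: square_def order_def card_PiE)

lemma gindex_square: "gindex \<Gamma> (square B) = gindex \<Gamma> B ^ 2"
proof -
  interpret S: finite_ggroup \<Gamma> "square B" by (rule finite_ggroup_square)
  have I: "card (ginvariants \<Gamma> (square B)) = card (ginvariants \<Gamma> B) ^ 2"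
    by (simp add: square_def ginvariants_gprod card_PiE)
  have "gindex \<Gamma> (square B) * card (ginvariants \<Gamma> (square B)) = (gindex \<Gamma> B * card (ginvariants \<Gamma> B))\<^sup>2"
    using S.gindex_mult_card_ginvariants order_square B.gindex_mult_card_ginvariants by simp
  then have "gindex \<Gamma> (square B) * card (ginvariants \<Gamma> (square B)) = gindex \<Gamma> B ^ 2 * card (ginvariants \<Gamma> (square B))"
    by (simp add: I power_mult_distrib)
  moreover have "card (ginvariants \<Gamma> (square B)) \<noteq> 0"
    using S.gindex_mult_card_ginvariants S.order_pos by (metis less_irrefl mult_0_right)
  ultimately show ?thesis by simp
qed

lemma pairing_gHom:
  assumes "\<phi> \<in> gHom \<Gamma> (Fn \<Gamma> gs n) B" "\<psi> \<in> gHom \<Gamma> (Fn \<Gamma> gs n) B"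
  shows "pairing (\<phi>, \<psi>) \<in> gHom \<Gamma> (Fn \<Gamma> gs n) (square B)"
  unfolding gHom_def
proof (intro CollectI conjI)
  note hom = assms[unfolded gHom_def mem_Collect_eq]
  show "pairing (\<phi>, \<psi>) \<in> extensional (Fn_carrier n)" by (simp add: pairing_def)
  show "pairing (\<phi>, \<psi>) \<in> hom (Fn \<Gamma> gs n) (square B)"
  proof (rule homI)
    fix x assume "x \<in> Fn_carrier n"
    then show "pairing (\<phi>, \<psi>) x \<in> carrier (square B)"
      using hom_in_carrier[of \<phi> "Fn \<Gamma> gs n" B x] hom_in_carrier[of \<psi> "Fn \<Gamma> gs n" B x] hom
      by (simp add: pairing_def square_def PiE_iff)
  next
    fix x y assume xy: "x \<in> Fn_carrier n" "y \<in> Fn_carrier n"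
    then show "pairing (\<phi>, \<psi>) (x \<otimes>\<^bsub>Fn \<Gamma> gs n\<^esub> y) = pairing (\<phi>, \<psi>) x \<otimes>\<^bsub>(square B)\<^esub> pairing (\<phi>, \<psi>) y"
      using hom Fn.m_closed[OF xy] by (auto simp: pairing_def square_def hom_mult)
  qed
  have "continuous_map (gtop (Fn \<Gamma> gs n)) (gtop (square B)) (\<lambda>x b. if b then \<phi> x else \<psi> x)"
    using hom by (simp add: square_def continuous_map_componentwise_UNIV if_distrib)
  then show "continuous_map (gtop (Fn \<Gamma> gs n)) (gtop (square B)) (pairing (\<phi>, \<psi>))"
    by (rule continuous_map_eq) (simp add: pairing_def Fn.topspace_gtop)
  show "gequivariant \<Gamma> (Fn \<Gamma> gs n) (square B) (pairing (\<phi>, \<psi>))"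
    using hom by (auto simp: gequivariant_def pairing_def square_def)
qed

text \<open>Invariance in a product is tested in each coordinate. A joint event for two
  homomorphisms thus becomes a single event for one homomorphism to B \<times> B.\<close>

lemma stab_pairing: "stab (square B) (pairing (\<phi>, \<psi>)) = stab B \<phi> \<inter> stab B \<psi>"
  by (auto simp: stab_def square_def ginvariants_gprod pairing_def PiE_iff split: if_splits)

lemma inj_on_pairing:
  "inj_on pairing (gHom \<Gamma> (Fn \<Gamma> gs n) B \<times> gHom \<Gamma> (Fn \<Gamma> gs n) B)"
proof (rule inj_onI)
  fix p q :: "('g free_elem \<Rightarrow> 'b) \<times> ('g free_elem \<Rightarrow> 'b)"
  assume p: "p \<in> gHom \<Gamma> (Fn \<Gamma> gs n) B \<times> gHom \<Gamma> (Fn \<Gamma> gs n) B"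
    and q: "q \<in> gHom \<Gamma> (Fn \<Gamma> gs n) B \<times> gHom \<Gamma> (Fn \<Gamma> gs n) B" and eq: "pairing p = pairing q"
  have *: "fst p x = fst q x \<and> snd p x = snd q x" if "x \<in> Fn_carrier n" for x
    using fun_cong[OF fun_cong[OF eq], of x True] fun_cong[OF fun_cong[OF eq], of x False] that
    by (simp add: pairing_def case_prod_unfold)
  have "fst p = fst q"
    by (rule extensionalityI[of _ "Fn_carrier n"]) (use p q * in \<open>auto simp: gHom_def\<close>)
  moreover have "snd p = snd q"
    by (rule extensionalityI[of _ "Fn_carrier n"]) (use p q * in \<open>auto simp: gHom_def\<close>)
  ultimately show "p = q" by (rule prod_eqI)
qed

text \<open>Pairs of surjections are particular homomorphisms to B \<times> B; the sum over all of
  them, grouped by image D, has terms |Z^1(\<Gamma>, D)|^n / [D : D^\<Gamma>]^k. When H^1 vanishes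
  the base of the power n cancels, and the bound does not involve n.\<close>

lemma survivors_second_moment_le:
  assumes "coprime (order B) (order \<Gamma>)" and nk: "int k = int n + u"
    and H1: "\<And>D. D \<in> gsubs \<Gamma> (square B) \<Longrightarrow> H1_trivial \<Gamma> (gsub (square B) D)"
  shows "(\<integral>r. (real (survivors B k r))\<^sup>2 \<partial>PiM {..<k} (\<lambda>_. \<nu>)) \<le>
     (\<Sum>D\<in>gsubs \<Gamma> (square B). 1 / real (gindex \<Gamma> (gsub (square B) D)) powi u)"
proof -
  interpret S: finite_ggroup \<Gamma> "square B" by (rule finite_ggroup_square)
  let ?T = "surjections B \<times> surjections B"
  have inj: "inj_on pairing ?T"
    by (rule inj_on_subset[OF inj_on_pairing]) (use surjections_subset in blast)
  have "(\<Sum>(\<phi>, \<psi>)\<in>?T. prob (stab B \<phi> \<inter> stab B \<psi>) ^ k) = (\<Sum>p\<in>?T. prob (stab (square B) (pairing p)) ^ k)"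
    by (intro sum.cong) (auto simp: stab_pairing)
  also have "\<dots> = (\<Sum>\<Phi>\<in>pairing ` ?T. prob (stab (square B) \<Phi>) ^ k)"
    by (simp add: sum.reindex[OF inj])
  also have "\<dots> \<le> (\<Sum>\<Phi>\<in>gHom \<Gamma> (Fn \<Gamma> gs n) (square B). prob (stab (square B) \<Phi>) ^ k)"
    by (rule sum_mono2[OF finite_gHom_Fn[OF finite_ggroup_square]])
       (use surjections_subset pairing_gHom in \<open>auto simp: subset_iff\<close>)
  also have "\<dots> \<le> (\<Sum>D\<in>gsubs \<Gamma> (square B). real (card (cocycles \<Gamma> (gsub (square B) D))) ^ n / real (gindex \<Gamma> (gsub (square B) D)) ^ k)"
    by (rule sum_prob_stab_le[OF finite_ggroup_square])
  also have "\<dots> = (\<Sum>D\<in>gsubs \<Gamma> (square B). 1 / real (gindex \<Gamma> (gsub (square B) D)) powi u)"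
  proof (rule sum.cong[OF refl])
    fix D assume D: "D \<in> gsubs \<Gamma> (square B)"
    interpret D: finite_ggroup \<Gamma> "gsub (square B) D" using S.finite_ggroup_gsub D by (simp add: gsubs_def)
    let ?g = "real (gindex \<Gamma> (gsub (square B) D))"
    have "card (cocycles \<Gamma> (gsub (square B) D)) = gindex \<Gamma> (gsub (square B) D)"
      using D.card_cocycles_eq_gindex_iff[OF group_\<Gamma> finite_\<Gamma>] H1[OF D] by simp
    moreover have "?g ^ k = ?g ^ n * ?g powi u"
      using D.gindex_pos power_int_add[of ?g "int n" u] nk[symmetric] by (simp flip: power_int_of_nat)
    ultimately show "real (card (cocycles \<Gamma> (gsub (square B) D))) ^ n / ?g ^ k = 1 / ?g powi u"
      using D.gindex_pos by simp
  qed
  finally show ?thesis by (simp add: survivors_second_moment)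
qed

text \<open>The image under \<phi> of the kernel of \<psi> is a \<Gamma>-stable normal subgroup of
  B. If it is trivial, \<phi> factors through \<psi>; if it is B, the pair is onto. The factor
  \<open>\<alpha>\<close> is recorded only as a function, which is enough to bound the number of
  such pairs.\<close>

lemma goursat:
  assumes simple: "\<And>N. \<lbrakk>N \<lhd> B; gstable \<Gamma> B N\<rbrakk> \<Longrightarrow> N = {\<one>\<^bsub>B\<^esub>} \<or> N = carrier B"
    and \<phi>: "\<phi> \<in> surjections B" and \<psi>: "\<psi> \<in> surjections B"
  shows "pairing (\<phi>, \<psi>) \<in> surjections (square B) \<or>
    (\<exists>\<alpha>\<in>carrier B \<rightarrow>\<^sub>E carrier B. \<phi> = restrict (\<alpha> \<circ> \<psi>) (Fn_carrier n))"
proof -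
  have hom: "\<phi> \<in> hom (Fn \<Gamma> gs n) B" "\<psi> \<in> hom (Fn \<Gamma> gs n) B"
    and im: "\<phi> ` Fn_carrier n = carrier B" "\<psi> ` Fn_carrier n = carrier B"
    and eq: "gequivariant \<Gamma> (Fn \<Gamma> gs n) B \<phi>" "gequivariant \<Gamma> (Fn \<Gamma> gs n) B \<psi>"
    using \<phi> \<psi> by (auto simp: gSur_eq gHom_def)
  interpret \<phi>: group_hom "Fn \<Gamma> gs n" B \<phi> by (simp add: group_hom.intro group_hom_axioms.intro hom)
  interpret \<psi>: group_hom "Fn \<Gamma> gs n" B \<psi> by (simp add: group_hom.intro group_hom_axioms.intro hom)
  let ?K = "kernel (Fn \<Gamma> gs n) B \<psi>"
  have "\<phi> ` ?K \<lhd> B"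
  proof (rule B.normal_invI)
    show "subgroup (\<phi> ` ?K) B" by (rule \<phi>.subgroup_img_is_subgroup[OF \<psi>.subgroup_kernel])
    fix b h assume "b \<in> carrier B" "h \<in> \<phi> ` ?K"
    then obtain x y where xy: "x \<in> Fn_carrier n" "b = \<phi> x" "y \<in> ?K" "h = \<phi> y" using im by blast
    then have "y \<in> Fn_carrier n" by (simp add: kernel_def)
    moreover have "x \<otimes>\<^bsub>Fn \<Gamma> gs n\<^esub> y \<otimes>\<^bsub>Fn \<Gamma> gs n\<^esub> inv\<^bsub>Fn \<Gamma> gs n\<^esub> x \<in> ?K"
      using xy Fn.normal_inv_iff \<psi>.normal_kernel by blast
    ultimately show "b \<otimes>\<^bsub>B\<^esub> h \<otimes>\<^bsub>B\<^esub> inv\<^bsub>B\<^esub> b \<in> \<phi> ` ?K"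
      using xy by (intro image_eqI[of _ _ "x \<otimes>\<^bsub>Fn \<Gamma> gs n\<^esub> y \<otimes>\<^bsub>Fn \<Gamma> gs n\<^esub> inv\<^bsub>Fn \<Gamma> gs n\<^esub> x"]) simp_all
  qed
  moreover have "gstable \<Gamma> B (\<phi> ` ?K)"
    unfolding gstable_def
  proof (intro ballI image_subsetI)
    fix \<sigma> h assume s: "\<sigma> \<in> carrier \<Gamma>" "h \<in> \<phi> ` ?K"
    then obtain y where y: "y \<in> Fn_carrier n" "\<psi> y = \<one>\<^bsub>B\<^esub>" "h = \<phi> y" by (auto simp: kernel_def)
    then have "gact (Fn \<Gamma> gs n) \<sigma> y \<in> ?K" using s eq(2) by (simp add: kernel_def gequivariant_def)
    moreover have "gact B \<sigma> h = \<phi> (gact (Fn \<Gamma> gs n) \<sigma> y)" using s y eq(1) by (simp add: gequivariant_def)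
    ultimately show "gact B \<sigma> h \<in> \<phi> ` ?K" by blast
  qed
  ultimately consider "\<phi> ` ?K = {\<one>\<^bsub>B\<^esub>}" | "\<phi> ` ?K = carrier B" using simple by blast
  then show ?thesis
  proof cases
    case 1
    define \<alpha> where "\<alpha> = (\<lambda>b\<in>carrier B. \<phi> (inv_into (Fn_carrier n) \<psi> b))"
    have inv: "inv_into (Fn_carrier n) \<psi> b \<in> Fn_carrier n" "\<psi> (inv_into (Fn_carrier n) \<psi> b) = b"
      if "b \<in> carrier B" for b
      using that im(2) by (simp_all add: inv_into_into f_inv_into_f)
    have "\<phi> x = \<alpha> (\<psi> x)" if x: "x \<in> Fn_carrier n" for x
    proof -
      let ?y = "inv_into (Fn_carrier n) \<psi> (\<psi> x)"
      have y: "?y \<in> Fn_carrier n" "\<psi> ?y = \<psi> x" using inv x by auto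
      then have "x \<otimes>\<^bsub>Fn \<Gamma> gs n\<^esub> inv\<^bsub>Fn \<Gamma> gs n\<^esub> ?y \<in> ?K" using x by (simp add: kernel_def)
      then have "\<phi> (x \<otimes>\<^bsub>Fn \<Gamma> gs n\<^esub> inv\<^bsub>Fn \<Gamma> gs n\<^esub> ?y) = \<one>\<^bsub>B\<^esub>" using 1 by blast
      then have "\<phi> x \<otimes>\<^bsub>B\<^esub> inv\<^bsub>B\<^esub> \<phi> ?y = \<one>\<^bsub>B\<^esub>" using x y by simp
      then have "\<phi> x = \<phi> ?y" using x y B.inv_equality[of "\<phi> x" "inv\<^bsub>B\<^esub> \<phi> ?y"] by simp
      then show ?thesis using x by (simp add: \<alpha>_def)
    qed
    then have "\<phi> = restrict (\<alpha> \<circ> \<psi>) (Fn_carrier n)"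
      using \<phi> by (intro extensionalityI[of _ "Fn_carrier n"]) (auto simp: gSur_eq gHom_def)
    moreover have "\<alpha> \<in> carrier B \<rightarrow>\<^sub>E carrier B" using inv by (simp add: \<alpha>_def)
    ultimately show ?thesis by blast
  next
    case 2
    have "f \<in> pairing (\<phi>, \<psi>) ` Fn_carrier n" if f: "f \<in> carrier (square B)" for f
    proof -
      have fB: "f True \<in> carrier B" "f False \<in> carrier B" using f by (auto simp: square_def PiE_iff)
      obtain x where x: "x \<in> Fn_carrier n" "\<psi> x = f False" using fB im(2) by (metis imageE)
      \<comment> \<open>With the second coordinate already right at x, the first one is corrected by
        an element of the kernel of \<psi>.\<close>
      have "f True \<otimes>\<^bsub>B\<^esub> inv\<^bsub>B\<^esub> \<phi> x \<in> \<phi> ` ?K" using 2 fB x by simp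
      then obtain y where y: "y \<in> Fn_carrier n" "\<psi> y = \<one>\<^bsub>B\<^esub>" "f True \<otimes>\<^bsub>B\<^esub> inv\<^bsub>B\<^esub> \<phi> x = \<phi> y"
        by (auto simp: kernel_def)
      have "\<phi> (y \<otimes>\<^bsub>Fn \<Gamma> gs n\<^esub> x) = f True" using x y fB by (simp add: B.m_assoc flip: y(3))
      moreover have "\<psi> (y \<otimes>\<^bsub>Fn \<Gamma> gs n\<^esub> x) = f False" using x y fB by simp
      ultimately have "f = pairing (\<phi>, \<psi>) (y \<otimes>\<^bsub>Fn \<Gamma> gs n\<^esub> x)"
        using x y by (auto simp: pairing_def)
      then show ?thesis using x y by blast
    qed
    moreover have "pairing (\<phi>, \<psi>) \<in> gHom \<Gamma> (Fn \<Gamma> gs n) (square B)"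
      using pairing_gHom \<phi> \<psi> surjections_subset by blast
    ultimately show ?thesis by (auto simp: gSur_eq gHom_def hom_in_carrier)
  qed
qed

text \<open>By Goursat's lemma a pair is either onto B \<times> B, and then its two survival events
  are independent, or it is determined by \<psi> and a self-map of B. The first kind contributes at
  most the square of the mean, the second at most a constant times the mean. No knowledge of H^1
  enters, so the estimate can serve the proof that H^1 vanishes.\<close>

lemma survivors_second_moment_simple:
  assumes simple: "\<And>N. \<lbrakk>N \<lhd> B; gstable \<Gamma> B N\<rbrakk> \<Longrightarrow> N = {\<one>\<^bsub>B\<^esub>} \<or> N = carrier B"
    and m: "m = real (card (surjections B)) / real (gindex \<Gamma> B) ^ k"
  shows "(\<integral>r. (real (survivors B k r))\<^sup>2 \<partial>PiM {..<k} (\<lambda>_. \<nu>)) \<le>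
     m\<^sup>2 + real (card (carrier B \<rightarrow>\<^sub>E carrier B)) * m"
proof -
  let ?T = "surjections B \<times> surjections B" and ?g = "real (gindex \<Gamma> B)"
  \<comment> \<open>The dependent pairs, at most one for each self-map of B and each
    surjection.\<close>
  let ?E = "(\<lambda>(\<alpha>, \<psi>). (restrict (\<alpha> \<circ> \<psi>) (Fn_carrier n), \<psi>)) ` ((carrier B \<rightarrow>\<^sub>E carrier B) \<times> surjections B)"
  let ?p = "\<lambda>(\<phi>, \<psi>). prob (stab B \<phi> \<inter> stab B \<psi>) ^ k"
  have finE: "finite ?E" using finite_surjections by (intro finite_imageI finite_cartesian_product finite_PiE) auto
  have p1: "?p p \<le> (1 / ?g ^ 2) ^ k + (if p \<in> ?E then (1 / ?g) ^ k else 0)" if "p \<in> ?T" for p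
  proof -
    obtain \<phi> \<psi> where p: "p = (\<phi>, \<psi>)" by (cases p)
    have \<phi>\<psi>: "\<phi> \<in> surjections B" "\<psi> \<in> surjections B" using that p by auto
    from goursat[OF simple \<phi>\<psi>] show ?thesis
    proof
      assume s: "pairing (\<phi>, \<psi>) \<in> surjections (square B)"
      then have "pairing (\<phi>, \<psi>) \<in> gHom \<Gamma> (Fn \<Gamma> gs n) (square B)"
        and im: "pairing (\<phi>, \<psi>) ` Fn_carrier n = carrier (square B)" by (auto simp: gSur_eq)
      interpret S: finite_ggroup \<Gamma> "square B" by (rule finite_ggroup_square)
      have "prob (stab (square B) (pairing (\<phi>, \<psi>))) = 1 / real (gindex \<Gamma> (square B))"
        using stab_sets_prob(2)[OF finite_ggroup_square, of "pairing (\<phi>, \<psi>)"] \<open>_ \<in> gHom _ _ _\<close> im S.gsub_carrier by simp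
      then have "prob (stab B \<phi> \<inter> stab B \<psi>) = 1 / ?g ^ 2" by (simp add: stab_pairing gindex_square)
      then show ?thesis by (simp add: p)
    next
      assume "\<exists>\<alpha>\<in>carrier B \<rightarrow>\<^sub>E carrier B. \<phi> = restrict (\<alpha> \<circ> \<psi>) (Fn_carrier n)"
      then have "p \<in> ?E" using \<phi>\<psi> p by auto
      moreover have "prob (stab B \<phi> \<inter> stab B \<psi>) \<le> prob (stab B \<psi>)"
        using stab_sets \<phi>\<psi> by (intro finite_measure_mono) auto
      then have "prob (stab B \<phi> \<inter> stab B \<psi>) ^ k \<le> (1 / ?g) ^ k"
        using prob_stab_surjection[OF \<phi>\<psi>(2)] by (intro power_mono) auto
      ultimately show ?thesis by (simp add: p add_increasing)
    qed
  qed
  have "(\<integral>r. (real (survivors B k r))\<^sup>2 \<partial>PiM {..<k} (\<lambda>_. \<nu>)) = (\<Sum>p\<in>?T. ?p p)"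
    by (rule survivors_second_moment)
  also have "\<dots> \<le> (\<Sum>p\<in>?T. (1 / ?g ^ 2) ^ k + (if p \<in> ?E then (1 / ?g) ^ k else 0))"
    by (rule sum_mono) (rule p1)
  also have "\<dots> = (\<Sum>p\<in>?T. (1 / ?g ^ 2) ^ k) + (\<Sum>p\<in>?T. if p \<in> ?E then (1 / ?g) ^ k else 0)"
    by (rule sum.distrib)
  also have "(\<Sum>p\<in>?T. (1 / ?g ^ 2) ^ k) = m\<^sup>2"
    by (simp add: m card_cartesian_product power2_eq_square power_divide power_mult_distrib)
  also have "(\<Sum>p\<in>?T. if p \<in> ?E then (1 / ?g) ^ k else 0) = card (?T \<inter> ?E) * (1 / ?g) ^ k"
    using finite_surjections by (simp add: sum.If_cases)
  also have "\<dots> \<le> real (card (carrier B \<rightarrow>\<^sub>E carrier B) * card (surjections B)) * (1 / ?g) ^ k"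
  proof -
    have "card (?T \<inter> ?E) \<le> card ?E" by (rule card_mono[OF finE]) blast
    also have "\<dots> \<le> card ((carrier B \<rightarrow>\<^sub>E carrier B) \<times> surjections B)"
      by (rule card_image_le) (use finite_surjections in \<open>auto intro!: finite_PiE\<close>)
    finally have "card (?T \<inter> ?E) \<le> card (carrier B \<rightarrow>\<^sub>E carrier B) * card (surjections B)"
      by (simp add: card_cartesian_product)
    then show ?thesis by (intro mult_right_mono of_nat_mono) auto
  qed
  also have "\<dots> = real (card (carrier B \<rightarrow>\<^sub>E carrier B)) * m" by (simp add: m power_divide)
  finally show ?thesis by simp
qed

end

end

section \<open>Finite completions\<close>

lemma giso_finite: "giso \<Gamma> G H \<Longrightarrow> finite (carrier G) \<longleftrightarrow> finite (carrier H)"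
  by (auto simp: giso_def iso_def bij_betw_finite)

lemma (in topological_ggroup) first_isomorphism:
  assumes \<Gamma>: "group \<Gamma>" and B: "finite_ggroup \<Gamma> B" and \<rho>: "\<rho> \<in> gHom \<Gamma> G B"
  shows "closed_normal_gsubgroup \<Gamma> G (kernel G B \<rho>)"
    and "giso \<Gamma> (gquot G (kernel G B \<rho>)) (gsub B (\<rho> ` carrier G))"
proof -
  interpret B: finite_ggroup \<Gamma> B by fact
  let ?N = "kernel G B \<rho>" and ?L = "\<rho> ` carrier G"
  have hom: "\<rho> \<in> hom G B" and cont: "continuous_map (gtop G) (gtop B) \<rho>" and eq: "gequivariant \<Gamma> G B \<rho>"
    and ext: "\<rho> \<in> extensional (carrier G)"
    using \<rho> by (auto simp: gHom_def)
  interpret \<rho>: group_hom G B \<rho> by (simp add: group_hom.intro group_hom_axioms.intro hom)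
  have st: "gstable \<Gamma> G ?N" using eq by (auto simp: gstable_def kernel_def gequivariant_def)
  have "closedin (gtop G) {x \<in> topspace (gtop G). \<rho> x \<in> {\<one>\<^bsub>B\<^esub>}}"
    by (rule closedin_continuous_map_preimage[OF cont]) (simp add: B.gtop_discrete)
  then have "closedin (gtop G) ?N" by (simp add: kernel_def topspace_gtop)
  then show N: "closed_normal_gsubgroup \<Gamma> G ?N"
    by (simp add: closed_normal_gsubgroup_def \<rho>.normal_kernel st)
  have L: "subgroup ?L B" "gstable \<Gamma> B ?L"
    using gHom_image_gsubs[OF B.topological_ggroup_axioms \<rho>] by (auto simp: gsubs_def)
  interpret L: finite_ggroup \<Gamma> "gsub B ?L" by (rule B.finite_ggroup_gsub[OF L])
  note \<pi> = quotient_projection[OF \<Gamma> \<rho>.normal_kernel st]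
  have \<rho>L: "\<rho> \<in> gSur \<Gamma> G (gsub B ?L)"
    using ext hom cont eq
    by (auto simp: gSur_def epi_def hom_def gequivariant_def continuous_map_in_subtopology topspace_gtop)
  have ker: "?N #> x = ?N #> y \<longleftrightarrow> \<rho> x = \<rho> y" if "x \<in> carrier G" "y \<in> carrier G" for x y
  proof
    assume "?N #> x = ?N #> y"
    then have "x \<in> ?N #> y" using rcos_self[OF that(1) \<rho>.subgroup_kernel] by simp
    then obtain h where h: "h \<in> ?N" "x = h \<otimes> y" by (auto simp: r_coset_def)
    then show "\<rho> x = \<rho> y" using that by (auto simp: kernel_def)
  next
    assume e: "\<rho> x = \<rho> y"
    have "y \<otimes> inv x \<in> ?N" using that e by (simp add: kernel_def)
    then have "y \<in> ?N #> x" using subgroup.rcos_module_rev[OF \<rho>.subgroup_kernel is_group that] by blast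
    then show "?N #> x = ?N #> y" using repr_independence[OF _ that(1) \<rho>.subgroup_kernel] by blast
  qed
  \<comment> \<open>Regarded as a surjection onto its image, \<open>\<rho>\<close> is constant on
    the cosets of its kernel and therefore descends to the quotient.\<close>
  have "\<rho> \<in> {\<phi> \<in> gSur \<Gamma> G (gsub B ?L). \<forall>x\<in>carrier G. \<forall>y\<in>carrier G. ?N #> x = ?N #> y \<longrightarrow> \<phi> x = \<phi> y}"
    using \<rho>L ker by blast
  then obtain f where f: "f \<in> gSur \<Gamma> (gquot G ?N) (gsub B ?L)"
      "\<rho> = restrict (f \<circ> (\<lambda>x. ?N #> x)) (carrier G)"
    using bij_betw_gSur_quotient[OF \<pi>, of "gsub B ?L"] unfolding bij_betw_def by blast
  have f\<rho>: "f (?N #> x) = \<rho> x" if "x \<in> carrier G" for x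
    using fun_cong[OF f(2), of x] that by simp
  have inj: "inj_on f (carrier (gquot G ?N))"
    using ker by (auto simp: inj_on_def rcosets_eq_image f\<rho>)
  have fs: "f ` carrier (gquot G ?N) = ?L" using f(1) by (simp add: gSur_def epi_def)
  have "f \<in> iso (gquot G ?N) (gsub B ?L)"
    using f(1) inj by (simp add: iso_iff gSur_def epi_def)
  moreover have "homeomorphic_map (gtop (gquot G ?N)) (gtop (gsub B ?L)) f"
  proof (rule bijective_open_imp_homeomorphic_map)
    have top: "topspace (gtop (gquot G ?N)) = carrier (gquot G ?N)"
      using quotient_imp_surjective_map[OF \<pi>(2)] by (simp add: topspace_gtop rcosets_eq_image)
    show "continuous_map (gtop (gquot G ?N)) (gtop (gsub B ?L)) f" using f(1) by (simp add: gSur_def)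
    show "open_map (gtop (gquot G ?N)) (gtop (gsub B ?L)) f"
      using openin_subset[of "gtop (gquot G ?N)"] fs unfolding top
      by (simp add: open_map_def L.gtop_discrete del: gsub_simps(4) gquot_simps) blast
    show "f ` topspace (gtop (gquot G ?N)) = topspace (gtop (gsub B ?L))"
      unfolding top L.topspace_gtop fs by simp
    show "inj_on f (topspace (gtop (gquot G ?N)))" unfolding top by (rule inj)
  qed
  ultimately show "giso \<Gamma> (gquot G ?N) (gsub B ?L)"
    using f(1) unfolding giso_def by (auto simp: gSur_def)
qed

lemma gclosure_finite_ggroup:
  assumes "H \<in> gclosure \<Gamma> C" and "\<And>K. K \<in> C \<Longrightarrow> finite (carrier K)"
  shows "finite_ggroup \<Gamma> H"
  using assms(1)
proof induction
  case (base K H)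
  then show ?case using assms(2) giso_finite finite_ggroup_iff_profinite by blast
next
  case (prod I K H)
  have "finite (carrier (gprod I K))" using prod.hyps(1) prod.IH
    by (auto intro!: finite_PiE finite_ggroup.finite_carrier)
  then show ?case using prod giso_finite finite_ggroup_iff_profinite by blast
next
  case (sub K L H)
  have "finite (carrier (gsub K L))"
    using finite_subset[OF subgroup.subset[of L K]] sub finite_ggroup.finite_carrier
    by (auto simp: closed_gsubgroup_def)
  then show ?case using sub giso_finite finite_ggroup_iff_profinite by blast
next
  case (quot K N H)
  have "finite (carrier (gquot K N))"
    using finite_ggroup.finite_carrier[OF quot.IH] by (simp add: RCOSETS_def)
  then show ?case using quot giso_finite finite_ggroup_iff_profinite by blast
qed

context topological_ggroup
begin

text \<open>Members of the index set are rewritten as kernels of maps to groups in the closure; in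
  this form they can be intersected by taking products of the targets.\<close>

lemma gcompl_index_witness:
  assumes "group \<Gamma>" "M \<in> gcompl_index \<Gamma> G C"
  obtains H \<theta> where "H \<in> gclosure \<Gamma> C" "\<theta> \<in> gHom \<Gamma> G H" "kernel G H \<theta> = M"
proof -
  obtain H where M: "closed_normal_gsubgroup \<Gamma> G M" and H: "H \<in> gclosure \<Gamma> C" "giso \<Gamma> (gquot G M) H"
    using assms(2) by (auto simp: gcompl_index_def)
  then obtain f where f: "f \<in> iso (gquot G M) H" "homeomorphic_map (gtop (gquot G M)) (gtop H) f"
      "gequivariant \<Gamma> (gquot G M) H f" by (auto simp: giso_def)
  have MN: "M \<lhd> G" "gstable \<Gamma> G M" using M by (auto simp: closed_normal_gsubgroup_def)
  note \<pi> = quotient_projection[OF assms(1) MN]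
  interpret M: normal M G by (rule MN)
  have sg: "subgroup M G" by (rule normal_imp_subgroup[OF MN(1)])
  define \<theta> where "\<theta> = restrict (f \<circ> (\<lambda>x. M #> x)) (carrier G)"
  have pr: "profinite_ggroup \<Gamma> H" using H(1) by cases
  then interpret H: topological_ggroup \<Gamma> H by (rule profinite_imp_topological_ggroup)
  have fh: "f \<in> hom (gquot G M) H" and inj: "inj_on f (rcosets M)" using f(1) by (auto simp: iso_iff)
  have mem: "M #> x \<in> rcosets M" if "x \<in> carrier G" for x using that by (simp add: rcosets_eq_image)
  have "\<theta> \<in> gHom \<Gamma> G H"
    unfolding gHom_def
  proof (intro CollectI conjI)
    have "f \<circ> (\<lambda>x. M #> x) \<in> hom G H"
      using \<pi>(1) fh by (auto simp: epi_def intro: Group.hom_compose)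
    then show hom: "\<theta> \<in> hom G H" by (simp add: \<theta>_def hom_def Pi_iff)
    have "continuous_map (gtop G) (gtop H) (f \<circ> (\<lambda>x. M #> x))"
      by (rule continuous_map_compose[OF quotient_imp_continuous_map[OF \<pi>(2)] homeomorphic_imp_continuous_map[OF f(2)]])
    then show "continuous_map (gtop G) (gtop H) \<theta>"
      by (rule continuous_map_eq) (simp add: \<theta>_def topspace_gtop)
    show "gequivariant \<Gamma> G H \<theta>"
      using \<pi>(3) f(3) mem by (simp add: gequivariant_def \<theta>_def)
  qed (simp add: \<theta>_def)
  moreover have "kernel G H \<theta> = M"
  proof -
    have fM: "f M = \<one>\<^bsub>H\<^esub>"
    proof -
      have "f (M <#> M) = f M \<otimes>\<^bsub>H\<^esub> f M" "f M \<in> carrier H"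
        using fh mem[OF one_closed] coset_mult_one[OF M.subset] by (auto simp: hom_def)
      then show ?thesis using M.subset subgroup_mult_id[OF sg] by simp
    qed
    have "f (M #> x) = \<one>\<^bsub>H\<^esub> \<longleftrightarrow> x \<in> M" if "x \<in> carrier G" for x
    proof -
      have MM: "M \<in> rcosets M" using mem[OF one_closed] coset_mult_one[OF M.subset] by simp
      have "f (M #> x) = \<one>\<^bsub>H\<^esub> \<longleftrightarrow> M #> x = M"
        using inj_on_eq_iff[OF inj mem[OF that] MM] fM by simp
      also have "\<dots> \<longleftrightarrow> x \<in> M"
        using coset_join1[OF _ that sg] coset_join2[OF that sg] by metis
      finally show ?thesis .
    qed
    then show ?thesis using M.subset by (auto simp: kernel_def \<theta>_def)
  qed
  ultimately show thesis by (rule that[OF H(1)])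
qed

text \<open>The quotient by the kernel is isomorphic to the image, and the closure is stable under
  \<Gamma>-subgroups.\<close>

lemma gcompl_index_kernel:
  assumes "group \<Gamma>" "finite_ggroup \<Gamma> H" "H \<in> gclosure \<Gamma> C" "\<theta> \<in> gHom \<Gamma> G H"
  shows "kernel G H \<theta> \<in> gcompl_index \<Gamma> G C"
proof -
  interpret H: finite_ggroup \<Gamma> H by fact
  note fi = first_isomorphism[OF assms(1,2,4)]
  have L: "subgroup (\<theta> ` carrier G) H" "gstable \<Gamma> H (\<theta> ` carrier G)"
    using gHom_image_gsubs[OF H.topological_ggroup_axioms assms(4)] by (auto simp: gsubs_def)
  have cl: "closed_gsubgroup \<Gamma> H (\<theta> ` carrier G)"
    using L subgroup.subset[OF L(1)] by (simp add: closed_gsubgroup_def H.gtop_discrete closedin_def)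
  have "profinite_ggroup \<Gamma> (gsub H (\<theta> ` carrier G))"
    using H.finite_ggroup_gsub(1)[OF L] by (rule finite_ggroup.profinite_ggroup)
  then have "gsub H (\<theta> ` carrier G) \<in> gclosure \<Gamma> C"
    by (rule gclosure.sub[OF assms(3) cl _ giso_refl])
  then show ?thesis using fi unfolding gcompl_index_def by blast
qed

text \<open>The index set is directed because the intersection of two kernels is the kernel of the
  map to the product of the targets, which belongs to the closure.\<close>

lemma gcompl_index_Int:
  assumes "group \<Gamma>" "\<And>K. K \<in> C \<Longrightarrow> finite (carrier K)"
    and M: "M \<in> gcompl_index \<Gamma> G C" "M' \<in> gcompl_index \<Gamma> G C"
  shows "M \<inter> M' \<in> gcompl_index \<Gamma> G C"
proof -
  obtain H \<theta> where H: "H \<in> gclosure \<Gamma> C" "\<theta> \<in> gHom \<Gamma> G H" "kernel G H \<theta> = M"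
    using gcompl_index_witness[OF assms(1) M(1)] .
  obtain H' \<theta>' where H': "H' \<in> gclosure \<Gamma> C" "\<theta>' \<in> gHom \<Gamma> G H'" "kernel G H' \<theta>' = M'"
    using gcompl_index_witness[OF assms(1) M(2)] .
  define K where "K = (\<lambda>i::nat. if i = 0 then H else H')"
  have KC: "\<forall>i\<in>{0, 1}. K i \<in> gclosure \<Gamma> C" using H H' by (simp add: K_def)
  have fK: "finite_ggroup \<Gamma> (K i)" if "i \<in> {0, 1}" for i
    using gclosure_finite_ggroup[OF _ assms(2)] KC that by blast
  define P where "P = gprod {0, 1::nat} K"
  interpret P: finite_ggroup \<Gamma> P
    unfolding P_def by (rule finite_ggroup_gprod[OF _ fK assms(1)]) simp_all
  \<comment> \<open>The product consists of functions, while members of the closure live on natural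
    numbers.\<close>
  obtain P' :: "('g, nat) ggroup" where P': "finite_ggroup \<Gamma> P'" "giso \<Gamma> P P'"
    using P.ex_nat_copy[OF assms(1)] by blast
  interpret P': finite_ggroup \<Gamma> P' by (rule P')
  have PC: "P' \<in> gclosure \<Gamma> C"
    by (rule gclosure.prod[OF _ KC P'.profinite_ggroup]) (use P'(2) in \<open>simp_all add: P_def\<close>)
  obtain \<eta> where \<eta>: "\<eta> \<in> iso P P'" "gequivariant \<Gamma> P P' \<eta>" using P'(2) by (auto simp: giso_def)
  define \<rho>0 where "\<rho>0 = (\<lambda>x. \<lambda>i\<in>{0, 1::nat}. if i = 0 then \<theta> x else \<theta>' x)"
  have h: "\<theta> \<in> hom G H" "continuous_map (gtop G) (gtop H) \<theta>" "gequivariant \<Gamma> G H \<theta>"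
    and h': "\<theta>' \<in> hom G H'" "continuous_map (gtop G) (gtop H') \<theta>'" "gequivariant \<Gamma> G H' \<theta>'"
    using H(2) H'(2) by (auto simp: gHom_def)
  have \<rho>0h: "\<rho>0 \<in> hom G P"
  proof (rule homI)
    fix x assume "x \<in> carrier G"
    then show "\<rho>0 x \<in> carrier P"
      using hom_in_carrier[OF h(1)] hom_in_carrier[OF h'(1)] by (auto simp: \<rho>0_def P_def K_def)
  next
    fix x y assume "x \<in> carrier G" "y \<in> carrier G"
    then show "\<rho>0 (x \<otimes> y) = \<rho>0 x \<otimes>\<^bsub>P\<^esub> \<rho>0 y"
      using h(1) h'(1) by (auto simp: \<rho>0_def P_def K_def hom_def fun_eq_iff)
  qed
  have "continuous_map (gtop G) (gtop (K i)) (\<lambda>x. \<rho>0 x i)" if "i \<in> {0, 1}" for i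
    using that h(2) h'(2) by (auto simp: \<rho>0_def K_def)
  then have \<rho>0c: "continuous_map (gtop G) (gtop P) \<rho>0"
    unfolding P_def gprod_simps continuous_map_componentwise by (auto simp: \<rho>0_def)
  define \<rho> where "\<rho> = restrict (\<eta> \<circ> \<rho>0) (carrier G)"
  have \<eta>h: "\<eta> \<in> hom P P'" and inj: "inj_on \<eta> (carrier P)" using \<eta>(1) by (auto simp: iso_iff)
  interpret \<eta>: group_hom P P' \<eta> by (simp add: group_hom.intro group_hom_axioms.intro \<eta>h)
  have "\<rho> \<in> gHom \<Gamma> G P'"
    unfolding gHom_def
  proof (intro CollectI conjI)
    show "\<rho> \<in> hom G P'" using Group.hom_compose[OF \<rho>0h \<eta>h] by (simp add: \<rho>_def hom_def Pi_iff)
    have "continuous_map (gtop P) (gtop P') \<eta>"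
      using hom_in_carrier[OF \<eta>h] by (auto simp: P.gtop_discrete P'.gtop_discrete)
    from continuous_map_compose[OF \<rho>0c this]
    show "continuous_map (gtop G) (gtop P') \<rho>"
      by (rule continuous_map_eq) (simp add: \<rho>_def topspace_gtop)
    have "\<rho>0 (gact G \<sigma> x) = gact P \<sigma> (\<rho>0 x)" if "\<sigma> \<in> carrier \<Gamma>" "x \<in> carrier G" for \<sigma> x
      using h(3) h'(3) that by (auto simp: \<rho>0_def P_def K_def gequivariant_def fun_eq_iff)
    then show "gequivariant \<Gamma> G P' \<rho>"
      using \<eta>(2) hom_in_carrier[OF \<rho>0h] by (simp add: gequivariant_def \<rho>_def)
  qed (simp add: \<rho>_def)
  then have "kernel G P' \<rho> \<in> gcompl_index \<Gamma> G C"
    by (rule gcompl_index_kernel[OF assms(1) P'(1) PC])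
  moreover have "kernel G P' \<rho> = M \<inter> M'"
  proof -
    have "\<eta> (\<rho>0 x) = \<one>\<^bsub>P'\<^esub> \<longleftrightarrow> \<rho>0 x = \<one>\<^bsub>P\<^esub>" if "x \<in> carrier G" for x
      using inj_on_eq_iff[OF inj hom_in_carrier[OF \<rho>0h that] P.one_closed] \<eta>.hom_one by simp
    moreover have "\<rho>0 x = \<one>\<^bsub>P\<^esub> \<longleftrightarrow> \<theta> x = \<one>\<^bsub>H\<^esub> \<and> \<theta>' x = \<one>\<^bsub>H'\<^esub>" for x
    proof -
      have "\<rho>0 x = \<one>\<^bsub>P\<^esub> \<longleftrightarrow> (\<forall>i\<in>{0, 1}. \<rho>0 x i = \<one>\<^bsub>P\<^esub> i)"
        by (auto simp: \<rho>0_def P_def fun_eq_iff)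
      then show ?thesis by (simp add: \<rho>0_def P_def K_def)
    qed
    ultimately show ?thesis using H(3) H'(3) by (auto simp: kernel_def \<rho>_def)
  qed
  ultimately show ?thesis by simp
qed

definition to_gcompl :: "('g, nat) ggroup set \<Rightarrow> 'a \<Rightarrow> 'a set \<Rightarrow> 'a set" where
  "to_gcompl C x = (\<lambda>M\<in>gcompl_index \<Gamma> G C. M #> x)"

lemma gcompl_simps:
  "carrier (gcompl \<Gamma> G C) = {f \<in> (\<Pi>\<^sub>E M\<in>gcompl_index \<Gamma> G C. rcosets M).
     \<forall>M\<in>gcompl_index \<Gamma> G C. \<forall>M'\<in>gcompl_index \<Gamma> G C. M \<subseteq> M' \<longrightarrow> f M \<subseteq> f M'}"
  "mult (gcompl \<Gamma> G C) = (\<lambda>f f'. \<lambda>M\<in>gcompl_index \<Gamma> G C. f M <#> f' M)"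
  "one (gcompl \<Gamma> G C) = (\<lambda>M\<in>gcompl_index \<Gamma> G C. M)"
  "gtop (gcompl \<Gamma> G C) =
     subtopology (product_topology (gquot_top G) (gcompl_index \<Gamma> G C)) (carrier (gcompl \<Gamma> G C))"
  "gact (gcompl \<Gamma> G C) = (\<lambda>\<sigma> f. \<lambda>M\<in>gcompl_index \<Gamma> G C. gact G \<sigma> ` f M)"
  by (simp_all add: gcompl_def Let_def)

lemma gcompl_indexD:
  assumes "M \<in> gcompl_index \<Gamma> G C"
  shows "M \<lhd> G" "gstable \<Gamma> G M" "subgroup M G" "M \<subseteq> carrier G"
proof -
  show N: "M \<lhd> G" "gstable \<Gamma> G M"
    using assms by (auto simp: gcompl_index_def closed_normal_gsubgroup_def)
  show sg: "subgroup M G" by (rule normal_imp_subgroup[OF N(1)])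
  show "M \<subseteq> carrier G" by (rule subgroup.subset[OF sg])
qed

lemma to_gcompl_hom:
  assumes "group \<Gamma>"
  shows "to_gcompl C \<in> hom G (gcompl \<Gamma> G C)"
    and "continuous_map (gtop G) (gtop (gcompl \<Gamma> G C)) (to_gcompl C)"
    and "gequivariant \<Gamma> G (gcompl \<Gamma> G C) (to_gcompl C)"
    and "\<one>\<^bsub>gcompl \<Gamma> G C\<^esub> = to_gcompl C \<one>"
proof -
  let ?I = "gcompl_index \<Gamma> G C"
  note I = gcompl_indexD[where C = C]
  have mem: "to_gcompl C x \<in> carrier (gcompl \<Gamma> G C)" if "x \<in> carrier G" for x
    using that by (auto simp: gcompl_simps(1) to_gcompl_def rcosets_eq_image r_coset_def)
  show "to_gcompl C \<in> hom G (gcompl \<Gamma> G C)"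
  proof (rule homI[OF mem])
    fix x y assume "x \<in> carrier G" "y \<in> carrier G"
    then show "to_gcompl C (x \<otimes> y) = to_gcompl C x \<otimes>\<^bsub>gcompl \<Gamma> G C\<^esub> to_gcompl C y"
      using normal.rcos_sum[OF I(1)] by (auto simp: gcompl_simps to_gcompl_def fun_eq_iff)
  qed
  have "continuous_map (gtop G) (gquot_top G M) (\<lambda>x. to_gcompl C x M)" if "M \<in> ?I" for M
    using quotient_imp_continuous_map[OF quotient_projection(2)[OF assms I(1,2)[OF that]]] that
    by (simp add: to_gcompl_def)
  then have "continuous_map (gtop G) (product_topology (gquot_top G) ?I) (to_gcompl C)"
    by (auto simp: continuous_map_componentwise to_gcompl_def)
  then show "continuous_map (gtop G) (gtop (gcompl \<Gamma> G C)) (to_gcompl C)"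
    using mem by (auto simp: gcompl_simps(4) continuous_map_in_subtopology topspace_gtop)
  show "gequivariant \<Gamma> G (gcompl \<Gamma> G C) (to_gcompl C)"
    using gact_image_rcoset[OF assms I(2,4)]
    by (auto simp: gequivariant_def gcompl_simps(5) to_gcompl_def fun_eq_iff)
  show "\<one>\<^bsub>gcompl \<Gamma> G C\<^esub> = to_gcompl C \<one>"
    using coset_mult_one[OF I(4)] by (auto simp: gcompl_simps(3) to_gcompl_def fun_eq_iff)
qed

text \<open>A finite inverse limit is already attained at a single member of the directed index set.\<close>

lemma to_gcompl_surj:
  assumes "group \<Gamma>" "\<And>K. K \<in> C \<Longrightarrow> finite (carrier K)" and fin: "finite (carrier (gcompl \<Gamma> G C))"
  shows "to_gcompl C ` carrier G = carrier (gcompl \<Gamma> G C)"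
proof
  let ?I = "gcompl_index \<Gamma> G C" and ?\<kappa> = "to_gcompl C"
  note I = gcompl_indexD[where C = C]
  show sub: "?\<kappa> ` carrier G \<subseteq> carrier (gcompl \<Gamma> G C)"
    by (rule hom_carrier[OF to_gcompl_hom(1)[OF assms(1)]])
  show "carrier (gcompl \<Gamma> G C) \<subseteq> ?\<kappa> ` carrier G"
  proof (rule ccontr)
    assume "\<not> ?thesis"
    then obtain w where w: "w \<in> carrier (gcompl \<Gamma> G C)" "w \<notin> ?\<kappa> ` carrier G" by blast
    have wI: "w M \<in> rcosets M" if "M \<in> ?I" for M using w(1) that by (auto simp: gcompl_simps(1))
    have wmono: "w M \<subseteq> w M'" if "M \<in> ?I" "M' \<in> ?I" "M \<subseteq> M'" for M M'
      using w(1) that by (auto simp: gcompl_simps(1))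
    have wext: "w \<in> extensional ?I" using w(1) by (auto simp: gcompl_simps(1) PiE_def)
    have "\<exists>M\<in>?I. f M \<noteq> w M" if "f \<in> ?\<kappa> ` carrier G" for f
    proof (rule ccontr)
      assume "\<not> (\<exists>M\<in>?I. f M \<noteq> w M)"
      moreover have "f \<in> extensional ?I" using that by (auto simp: to_gcompl_def)
      ultimately have "f = w" using wext by (intro extensionalityI) auto
      then show False using that w(2) by simp
    qed
    \<comment> \<open>Each of the finitely many points f of the image differs from w at an index
      \<open>m f\<close>. At the intersection of these indices w is the coset of some g, so the
      image of g agrees with w at all of them, in particular at the index chosen to separate it from
      w.\<close>
    then obtain m where m: "\<And>f. f \<in> ?\<kappa> ` carrier G \<Longrightarrow> m f \<in> ?I \<and> f (m f) \<noteq> w (m f)" by metis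
    let ?S = "m ` ?\<kappa> ` carrier G"
    have S: "finite ?S" "?S \<noteq> {}" "?S \<subseteq> ?I" using finite_subset[OF sub fin] m by auto
    have "\<Inter>?S \<in> ?I" using S
    proof (induction rule: finite_ne_induct)
      case (insert M F)
      then show ?case using gcompl_index_Int[OF assms(1,2), where M = M and M' = "\<Inter>F"] by auto
    qed simp
    then obtain g where g: "g \<in> carrier G" "w (\<Inter>?S) = \<Inter>?S #> g" using wI by (force simp: rcosets_eq_image)
    have gin: "g \<in> w (\<Inter>?S)" using g rcos_self[OF g(1) I(3)[OF \<open>\<Inter>?S \<in> ?I\<close>]] by simp
    define M where "M = m (?\<kappa> g)"
    have M: "M \<in> ?I" "?\<kappa> g M \<noteq> w M" "M \<in> ?S" using m[of "?\<kappa> g"] g by (auto simp: M_def)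
    have "g \<in> w M" using wmono[OF \<open>\<Inter>?S \<in> ?I\<close> M(1)] M(3) gin by blast
    moreover obtain x where x: "x \<in> carrier G" "w M = M #> x" using wI[OF M(1)] by (auto simp: rcosets_eq_image)
    ultimately have "w M = M #> g" using repr_independence[OF _ x(1) I(3)[OF M(1)]] by simp
    then show False using M by (simp add: to_gcompl_def)
  qed
qed

text \<open>A finite Hausdorff space is discrete. The completion is Hausdorff as a subspace of a
  product of quotients, each of which is homeomorphic to a discrete group in the closure.\<close>

lemma finite_ggroup_gcompl:
  assumes "group \<Gamma>" "\<And>K. K \<in> C \<Longrightarrow> finite (carrier K)" and fin: "finite (carrier (gcompl \<Gamma> G C))"
  shows "finite_ggroup \<Gamma> (gcompl \<Gamma> G C)"
proof (rule finite_ggroup_epi_image[OF assms(1) _ to_gcompl_hom(3,4)[OF assms(1)] fin])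
  let ?I = "gcompl_index \<Gamma> G C"
  show "to_gcompl C \<in> epi G (gcompl \<Gamma> G C)"
    using to_gcompl_hom(1)[OF assms(1)] to_gcompl_surj[OF assms] by (simp add: epi_def)
  have "Hausdorff_space (gquot_top G M)" if M: "M \<in> ?I" for M
  proof -
    obtain H f where H: "H \<in> gclosure \<Gamma> C" "homeomorphic_map (gtop (gquot G M)) (gtop H) f"
      using M by (auto simp: gcompl_index_def giso_def)
    have "Hausdorff_space (gtop H)"
      using finite_ggroup.gtop_discrete[OF gclosure_finite_ggroup[OF H(1) assms(2)]] by simp
    then show ?thesis using H(2) homeomorphic_Hausdorff_space homeomorphic_map_imp_homeomorphic_space
      by (metis gquot_simps(4))
  qed
  then have "Hausdorff_space (gtop (gcompl \<Gamma> G C))"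
    unfolding gcompl_simps(4) by (intro Hausdorff_space_subtopology) (simp add: Hausdorff_space_product_topology)
  moreover have "topspace (gtop (gcompl \<Gamma> G C)) = carrier (gcompl \<Gamma> G C)"
    using continuous_map_image_subset_topspace[OF to_gcompl_hom(2)[OF assms(1), of C]]
      to_gcompl_surj[OF assms] by (auto simp: topspace_gtop gcompl_simps(4))
  ultimately show "gtop (gcompl \<Gamma> G C) = discrete_topology (carrier (gcompl \<Gamma> G C))"
    using fin by (intro finite_topspace_imp_discrete_topology) auto
qed

text \<open>The kernel of the map from G to its finite completion is an open normal subgroup whose
  index is the order of the completion.\<close>

lemma coprime_order_gcompl:
  assumes "group \<Gamma>" "\<And>K. K \<in> C \<Longrightarrow> finite (carrier K)" and fin: "finite (carrier (gcompl \<Gamma> G C))"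
    and pp: "pro_prime_ggroup \<Gamma> G"
  shows "coprime (order (gcompl \<Gamma> G C)) (order \<Gamma>)"
proof -
  interpret Q: finite_ggroup \<Gamma> "gcompl \<Gamma> G C" by (rule finite_ggroup_gcompl[OF assms(1-3)])
  let ?\<kappa> = "to_gcompl C" and ?N = "kernel G (gcompl \<Gamma> G C) (to_gcompl C)"
  interpret \<kappa>: group_hom G "gcompl \<Gamma> G C" ?\<kappa>
    by (simp add: group_hom.intro group_hom_axioms.intro to_gcompl_hom(1)[OF assms(1)])
  have "openin (gtop G) {x \<in> topspace (gtop G). ?\<kappa> x = \<one>\<^bsub>gcompl \<Gamma> G C\<^esub>}"
    using to_gcompl_hom(2)[OF assms(1), of C] unfolding Q.continuous_map_into_iff by simp
  then have "openin (gtop G) ?N" by (simp add: kernel_def topspace_gtop)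
  then have "coprime (card (rcosets ?N)) (order \<Gamma>)"
    using pp \<kappa>.normal_kernel by (simp add: pro_prime_ggroup_def)
  moreover have "card (rcosets ?N) = order (gcompl \<Gamma> G C)"
    using \<kappa>.FactGroup_iso_set[OF to_gcompl_surj[OF assms(1-3)]]
    by (auto simp: order_def FactGroup_def dest!: is_isoI iso_same_card)
  ultimately show ?thesis by simp
qed

text \<open>The kernel of a surjection to A has quotient A, which is isomorphic to
  \<open>A'\<close>, so it belongs to the index set and contains the kernel of the completion map.
  Every surjection to A therefore factors through the completion at \<open>A'\<close>.\<close>

lemma bij_betw_gSur_gcompl:
  assumes "group \<Gamma>" "finite_ggroup \<Gamma> A" "giso \<Gamma> A A'" "profinite_ggroup \<Gamma> A'"
    and fin: "finite (carrier (gcompl \<Gamma> G {A'}))"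
  shows "\<exists>F. bij_betw F (gSur \<Gamma> (gcompl \<Gamma> G {A'}) A) (gSur \<Gamma> G A)"
proof -
  interpret A: finite_ggroup \<Gamma> A by fact
  have A': "finite (carrier A')" using giso_finite[OF assms(3)] by simp
  have fA': "\<And>K. K \<in> {A'} \<Longrightarrow> finite (carrier K)" using A' by simp
  interpret Q: finite_ggroup \<Gamma> "gcompl \<Gamma> G {A'}" by (rule finite_ggroup_gcompl[OF assms(1) fA' fin])
  let ?\<kappa> = "to_gcompl {A'}"
  have surj: "?\<kappa> ` carrier G = carrier (gcompl \<Gamma> G {A'})" by (rule to_gcompl_surj[OF assms(1) fA' fin])
  have epi: "?\<kappa> \<in> epi G (gcompl \<Gamma> G {A'})" using to_gcompl_hom(1)[OF assms(1)] surj by (simp add: epi_def)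
  have cont: "continuous_map (gtop G) (gtop (gcompl \<Gamma> G {A'})) ?\<kappa>" by (rule to_gcompl_hom(2)[OF assms(1)])
  have quo: "quotient_map (gtop G) (gtop (gcompl \<Gamma> G {A'})) ?\<kappa>"
    using surj openin_continuous_map_preimage[OF cont]
    by (auto simp: quotient_map_def topspace_gtop Q.gtop_discrete)
  have "\<phi> x = \<phi> y" if \<phi>: "\<phi> \<in> gSur \<Gamma> G A" and xy: "x \<in> carrier G" "y \<in> carrier G" "?\<kappa> x = ?\<kappa> y" for \<phi> x y
  proof -
    have hom: "\<phi> \<in> hom G A" and im: "\<phi> ` carrier G = carrier A" and gh: "\<phi> \<in> gHom \<Gamma> G A"
      using \<phi> by (auto simp: gSur_eq gHom_def)
    interpret \<phi>: group_hom G A \<phi> by (simp add: group_hom.intro group_hom_axioms.intro hom)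
    let ?N = "kernel G A \<phi>"
    note fi = first_isomorphism[OF assms(1,2) gh, unfolded im A.gsub_carrier]
    have "A' \<in> gclosure \<Gamma> {A'}" by (rule gclosure.base[OF _ assms(4) giso_refl]) simp
    then have N: "?N \<in> gcompl_index \<Gamma> G {A'}"
      using fi giso_trans[OF fi(2) assms(3)] by (auto simp: gcompl_index_def)
    have "?N #> x = ?N #> y" using fun_cong[OF xy(3), of ?N] N by (simp add: to_gcompl_def)
    then have "x \<in> ?N #> y" using rcos_self[OF xy(1) \<phi>.subgroup_kernel] by simp
    then obtain h where "h \<in> ?N" "x = h \<otimes> y" by (auto simp: r_coset_def)
    then show "\<phi> x = \<phi> y" using xy by (auto simp: kernel_def)
  qed
  then have "{\<phi> \<in> gSur \<Gamma> G A. \<forall>x\<in>carrier G. \<forall>y\<in>carrier G. ?\<kappa> x = ?\<kappa> y \<longrightarrow> \<phi> x = \<phi> y} = gSur \<Gamma> G A"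
    by blast
  then show ?thesis using bij_betw_gSur_quotient[OF epi quo to_gcompl_hom(3)[OF assms(1)], of A] by auto
qed

end

section \<open>A countable partition of \<open>\<P>\<close>\<close>

lemma giso_order: "giso \<Gamma> G H \<Longrightarrow> order G = order H"
  by (auto simp: giso_def iso_def order_def dest: bij_betw_same_card)

lemma finite_gSur:
  assumes "finite (carrier H)" "finite (carrier A)"
  shows "finite (gSur \<Gamma> H A)"
  by (rule finite_subset[OF _ finite_PiE[of "carrier H" "\<lambda>_. carrier A"]])
     (use assms in \<open>auto simp: gSur_def epi_def PiE_def\<close>)

text \<open>On a basic open set for the level \<open>{A'}\<close> the completion is H up to
  isomorphism, and surjections to A factor through it, so their number is constant there. The last
  claim compares a group over another type, such as X_{u,n}, with a representative of its class; it
  needs only the isomorphism between them.\<close>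

lemma card_gSur_P_basic:
  assumes "group \<Gamma>" "finite_ggroup \<Gamma> A" "giso \<Gamma> A A'" "finite_ggroup \<Gamma> A'" "level_set \<Gamma> {A'}"
    and H: "finite (carrier H)" and X: "X \<in> P_basic \<Gamma> {A'} H"
  shows "finite (gSur_class \<Gamma> X A)" and "card (gSur_class \<Gamma> X A) = card (gSur \<Gamma> H A)"
    and "\<And>Y :: ('g, 'b) ggroup. \<lbrakk>pre_ggroup \<Gamma> Y; gclass \<Gamma> Y = X\<rbrakk> \<Longrightarrow> card (gSur \<Gamma> Y A) = card (gSur \<Gamma> H A)"
proof -
  obtain G where G: "G \<in> P_groups \<Gamma>" "giso \<Gamma> (gcompl \<Gamma> G {A'}) H" "X = gclass \<Gamma> G"
    using X by (auto simp: P_basic_def)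
  have pG: "profinite_ggroup \<Gamma> G" and fin: "finite (carrier (gcompl \<Gamma> G {A'}))"
    using G(1) assms(5) by (auto simp: P_groups_def admissible_def pro_prime_ggroup_def)
  interpret G: topological_ggroup \<Gamma> G by (rule profinite_imp_topological_ggroup[OF pG])
  have fA': "\<And>K. K \<in> {A'} \<Longrightarrow> finite (carrier K)"
    using finite_ggroup.finite_carrier[OF assms(4)] by simp
  interpret Q: finite_ggroup \<Gamma> "gcompl \<Gamma> G {A'}" by (rule G.finite_ggroup_gcompl[OF assms(1) fA' fin])
  have pA': "profinite_ggroup \<Gamma> A'" by (rule finite_ggroup.profinite_ggroup[OF assms(4)])
  obtain F where "bij_betw F (gSur \<Gamma> (gcompl \<Gamma> G {A'}) A) (gSur \<Gamma> G A)"
    using G.bij_betw_gSur_gcompl[OF assms(1-3) pA' fin] by blast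
  then have 1: "card (gSur \<Gamma> G A) = card (gSur \<Gamma> H A)" "finite (gSur \<Gamma> G A) \<longleftrightarrow> finite (gSur \<Gamma> H A)"
    using Q.card_gSur_giso[OF G(2), of A] bij_betw_same_card bij_betw_finite by metis+
  have fH: "finite (gSur \<Gamma> H A)" by (rule finite_gSur[OF H finite_ggroup.finite_carrier[OF assms(2)]])
  have "G \<in> X" using pG giso_refl by (simp add: G(3) gclass_def)
  \<comment> \<open>The representative picked by \<open>gSur_class\<close> need not be G, but it is
    isomorphic to G.\<close>
  then have "(SOME G. G \<in> X) \<in> X" by (rule someI)
  then have "giso \<Gamma> G (SOME G. G \<in> X)" by (simp add: G(3) gclass_def)
  from G.card_gSur_giso[OF this, of A] 1 fH
  show "finite (gSur_class \<Gamma> X A)" "card (gSur_class \<Gamma> X A) = card (gSur \<Gamma> H A)"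
    by (simp_all add: gSur_class_def)
  fix Y :: "('g, 'b) ggroup" assume Y: "pre_ggroup \<Gamma> Y" "gclass \<Gamma> Y = X"
  have "giso \<Gamma> Y G" using \<open>G \<in> X\<close> by (simp add: gclass_def flip: Y(2))
  from pre_ggroup.card_gSur_giso(1)[OF Y(1) this, of A] 1(1)
  show "card (gSur \<Gamma> Y A) = card (gSur \<Gamma> H A)" by simp
qed

text \<open>The completion at a copy of A has countably many possible isomorphism types, whose basic
  open sets cover the space. Made disjoint, they stay in the algebra, where convergence to the limit
  law is available, and the number of surjections to A is constant on each of them.\<close>

lemma P_space_partition:
  fixes A :: "('g, 'a) ggroup"
  assumes \<Gamma>: "group \<Gamma>" "finite (carrier \<Gamma>)" and A: "finite_ggroup \<Gamma> A" "coprime (order A) (order \<Gamma>)"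
  obtains V :: "nat \<Rightarrow> 'g gclass set" and s :: "nat \<Rightarrow> nat"
  where "disjoint_family V" "\<Union>(range V) = topspace (P_top \<Gamma>)"
    "\<And>i. V i \<in> P_algebra \<Gamma>" "\<And>i. V i \<in> sets (borel_of (P_top \<Gamma>))"
    "\<And>i X. X \<in> V i \<Longrightarrow> finite (gSur_class \<Gamma> X A) \<and> card (gSur_class \<Gamma> X A) = s i"
    "\<And>i (Y :: ('g, 'b) ggroup). \<lbrakk>pre_ggroup \<Gamma> Y; gclass \<Gamma> Y \<in> V i\<rbrakk> \<Longrightarrow> card (gSur \<Gamma> Y A) = s i"
proof -
  interpret A: finite_ggroup \<Gamma> A by fact
  obtain A' where A': "A' \<in> nat_ggroups \<Gamma>" "finite_ggroup \<Gamma> A'" "giso \<Gamma> A A'"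
    using A.ex_nat_copy[OF \<Gamma>(1)] by blast
  have fA': "finite (carrier A')" by (rule finite_ggroup.finite_carrier[OF A'(2)])
  have ppA': "pro_prime_ggroup \<Gamma> A'"
    using A' A(2) giso_order[OF A'(3)] by (simp add: pro_prime_finite_iff[OF fA'])
  have lev: "level_set \<Gamma> {A'}" using ppA' fA' by (simp add: level_set_def)
  define R where "R = {H \<in> nat_ggroups \<Gamma>. pro_prime_ggroup \<Gamma> H \<and> finite (carrier H)}"
  have R: "countable R" "R \<noteq> {}"
    using countable_nat_ggroups[OF \<Gamma>(2)] A'(1) ppA' fA' by (auto simp: R_def)
  define H where "H = from_nat_into R"
  have HR: "H i \<in> R" for i unfolding H_def by (rule from_nat_into[OF R(2)])
  define U where "U = (\<lambda>i. P_basic \<Gamma> {A'} (H i))"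
  \<comment> \<open>The enumeration \<open>H\<close> may list isomorphic groups more than once;
    disjointing removes the repetitions, and each piece involves only finitely many of the sets
    \<open>U\<close>.\<close>
  define V where "V = disjointed U"
  define s where "s = (\<lambda>i. card (gSur \<Gamma> (H i) A))"
  have VU: "V i \<subseteq> U i" for i unfolding V_def by (rule disjointed_subset)
  have basic: "U i \<in> P_basics \<Gamma>" for i
    unfolding U_def P_basics_def using HR[of i] lev by (auto simp: R_def)
  have opn: "openin (P_top \<Gamma>) (U i)" for i
    unfolding P_top_def by (rule topology_generated_by_Basis[OF basic])
  have fH: "finite (carrier (H i))" for i using HR[of i] by (simp add: R_def)
  show thesis
  proof (rule that[of V s])
    show "disjoint_family V" unfolding V_def by (rule disjoint_family_disjointed)
    have "X \<in> (\<Union>i. U i)" if "X \<in> topspace (P_top \<Gamma>)" for X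
    proof -
      have "X \<in> \<Union>(P_basics \<Gamma>)" using that by (simp add: P_top_def topology_generated_by_topspace)
      then obtain G where G: "G \<in> P_groups \<Gamma>" "X = gclass \<Gamma> G" by (auto simp: P_basics_def P_basic_def)
      then have pp: "pro_prime_ggroup \<Gamma> G" and fin: "finite (carrier (gcompl \<Gamma> G {A'}))"
        using lev by (auto simp: P_groups_def admissible_def)
      interpret G: topological_ggroup \<Gamma> G
        using pp by (simp add: profinite_imp_topological_ggroup pro_prime_ggroup_def)
      have fA'': "\<And>K. K \<in> {A'} \<Longrightarrow> finite (carrier K)" using fA' by simp
      interpret Q: finite_ggroup \<Gamma> "gcompl \<Gamma> G {A'}" by (rule G.finite_ggroup_gcompl[OF \<Gamma>(1) fA'' fin])
      obtain K where K: "K \<in> nat_ggroups \<Gamma>" "finite_ggroup \<Gamma> K" "giso \<Gamma> (gcompl \<Gamma> G {A'}) K"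
        using Q.ex_nat_copy[OF \<Gamma>(1)] by blast
      have fK: "finite (carrier K)" by (rule finite_ggroup.finite_carrier[OF K(2)])
      have "coprime (order K) (order \<Gamma>)"
        using G.coprime_order_gcompl[OF \<Gamma>(1) fA'' fin pp] giso_order[OF K(3)] by simp
      then have "K \<in> R" using K fK by (simp add: R_def pro_prime_finite_iff[OF fK])
      then obtain i where "H i = K" using from_nat_into_surj[OF R(1)] unfolding H_def by blast
      then have "X \<in> U i" using G K(3) by (auto simp: U_def P_basic_def)
      then show ?thesis by blast
    qed
    moreover have "U i \<subseteq> topspace (P_top \<Gamma>)" for i by (rule openin_subset[OF opn])
    ultimately have "(\<Union>i. U i) = topspace (P_top \<Gamma>)" by blast
    then show "\<Union>(range V) = topspace (P_top \<Gamma>)" by (simp add: V_def UN_disjointed_eq)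
    show "V i \<in> P_algebra \<Gamma>" for i
      unfolding P_algebra_def
    proof (rule InterI, clarify)
      fix \<A> assume alg: "Sigma_Algebra.algebra (P_space \<Gamma>) \<A>" and sub: "P_basics \<Gamma> \<subseteq> \<A>"
      interpret alg: Sigma_Algebra.algebra "P_space \<Gamma>" \<A> by (rule alg)
      have "range U \<subseteq> \<A>" using basic sub by blast
      from alg.range_disjointed_sets[OF this] show "V i \<in> \<A>" by (auto simp: V_def)
    qed
    have "range U \<subseteq> sets (borel_of (P_top \<Gamma>))"
      using opn openin_subset[of "P_top \<Gamma>"] by (auto simp: borel_of_def sets_measure_of Pow_def)
    from sets.range_disjointed_sets[OF this] show "V i \<in> sets (borel_of (P_top \<Gamma>))" for i
      by (auto simp: V_def)
    note card = card_gSur_P_basic[OF \<Gamma>(1) A(1) A'(3,2) lev fH]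
    show "finite (gSur_class \<Gamma> X A) \<and> card (gSur_class \<Gamma> X A) = s i" if "X \<in> V i" for i X
      using card(1,2)[of X i] VU[of i] that by (auto simp: U_def s_def)
    show "card (gSur \<Gamma> Y A) = s i" if "pre_ggroup \<Gamma> Y" "gclass \<Gamma> Y \<in> V i"
      for i and Y :: "('g, 'b) ggroup"
      using card(3)[of "gclass \<Gamma> Y" i Y] VU[of i] that by (auto simp: U_def s_def)
  qed
qed

section \<open>Passing to the limit\<close>

text \<open>The events \<open>E i\<close> are not assumed to be measurable; \<^const>\<open>measure\<close> vanishes on those that are not.\<close>

lemma (in prob_space) sum_measure_disjoint:
  assumes F: "finite F" and E: "disjoint_family E"
  defines "D \<equiv> \<Union>i\<in>{i \<in> F. E i \<in> sets M}. E i"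
  shows "D \<in> sets M" and "prob D = (\<Sum>i\<in>F. prob (E i))"
proof -
  let ?F = "{i \<in> F. E i \<in> sets M}"
  show "D \<in> sets M" unfolding D_def using F by (intro sets.finite_UN) auto
  have "prob D = (\<Sum>i\<in>?F. prob (E i))"
    unfolding D_def using F E
    by (intro finite_measure_finite_Union) (auto simp: disjoint_family_on_def)
  also have "\<dots> = (\<Sum>i\<in>F. prob (E i))"
    using F by (intro sum.mono_neutral_left) (auto simp: measure_notin_sets)
  finally show "prob D = (\<Sum>i\<in>F. prob (E i))" .
qed

lemma (in prob_space) sum_measure_disjoint_value:
  fixes S :: "'a \<Rightarrow> nat"
  assumes F: "finite F" and E: "disjoint_family E" and S: "\<And>i r. r \<in> E i \<Longrightarrow> S r = s i"
  defines "D \<equiv> \<Union>i\<in>{i \<in> F. E i \<in> sets M}. E i"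
  shows "integrable M (\<lambda>r. real (S r) * indicator D r)"
    and "(\<integral>r. real (S r) * indicator D r \<partial>M) = (\<Sum>i\<in>F. real (s i) * prob (E i))"
proof -
  let ?F = "{i \<in> F. E i \<in> sets M}"
  have ind: "indicator D r = (\<Sum>i\<in>?F. indicator (E i) r :: real)" for r
    unfolding D_def using F E by (intro indicator_UN_disjoint) (auto simp: disjoint_family_on_def)
  have eq: "real (S r) * indicator D r = (\<Sum>i\<in>?F. real (s i) * indicator (E i) r)" for r
    unfolding ind sum_distrib_left using S by (intro sum.cong) (auto simp: indicator_def)
  have int: "integrable M (\<lambda>r. real (s i) * indicator (E i) r)" if "i \<in> ?F" for i
    using that by (intro integrable_mult_right integrable_real_indicator) (auto simp: less_top[symmetric])
  show "integrable M (\<lambda>r. real (S r) * indicator D r)"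
    unfolding eq by (intro Bochner_Integration.integrable_sum int)
  have "(\<integral>r. real (S r) * indicator D r \<partial>M) = (\<Sum>i\<in>?F. \<integral>r. real (s i) * indicator (E i) r \<partial>M)"
    unfolding eq by (rule Bochner_Integration.integral_sum[OF int])
  also have "\<dots> = (\<Sum>i\<in>?F. real (s i) * prob (E i))"
    using sets.sets_into_space by (intro sum.cong) (auto simp: Int_absorb2)
  also have "\<dots> = (\<Sum>i\<in>F. real (s i) * prob (E i))"
    using F by (intro sum.mono_neutral_left) (auto simp: measure_notin_sets)
  finally show "(\<integral>r. real (S r) * indicator D r \<partial>M) = (\<Sum>i\<in>F. real (s i) * prob (E i))" .
qed

text \<open>Abstracts from the groups: \<open>S n\<close> is the number of survivors and
  \<open>E n i\<close> the event that the class of X_{u,n} lies in the i-th piece. For a given n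
  these events need not exhaust the space; that no mass is lost in the limit is expressed by
  \<open>p sums 1\<close>.\<close>

locale tight_limit =
  fixes M :: "nat \<Rightarrow> 'b measure" and S :: "nat \<Rightarrow> 'b \<Rightarrow> nat" and E :: "nat \<Rightarrow> nat \<Rightarrow> 'b set"
    and p :: "nat \<Rightarrow> real" and s :: "nat \<Rightarrow> nat"
  assumes prob: "\<And>n. prob_space (M n)"
    and E: "\<And>n. disjoint_family (E n)"
    and lim: "\<And>i. (\<lambda>n. measure (M n) (E n i)) \<longlonglongrightarrow> p i"
    and p: "p sums 1"
    and S: "\<And>n i r. r \<in> E n i \<Longrightarrow> S n r = s i"
    and int1: "\<And>n. integrable (M n) (\<lambda>r. real (S n r))"
    and int2: "\<And>n. integrable (M n) (\<lambda>r. (real (S n r))\<^sup>2)"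
begin

lemma p_nonneg: "p i \<ge> 0"
  by (rule LIMSEQ_le_const[OF lim]) auto

definition D :: "nat \<Rightarrow> nat \<Rightarrow> 'b set" where
  "D N n = (\<Union>i\<in>{i \<in> {..<N}. E n i \<in> sets (M n)}. E n i)"

lemma D: "D N n \<in> sets (M n)" "measure (M n) (D N n) = (\<Sum>i<N. measure (M n) (E n i))"
  using prob_space.sum_measure_disjoint[of "M n" "{..<N}" "E n", OF prob finite_lessThan E] by (simp_all add: D_def)

lemma integral_D:
  "integrable (M n) (\<lambda>r. real (S n r) * indicator (D N n) r)"
  "(\<integral>r. real (S n r) * indicator (D N n) r \<partial>M n) = (\<Sum>i<N. real (s i) * measure (M n) (E n i))"
  using prob_space.sum_measure_disjoint_value[of "M n" "{..<N}" "E n" "S n" s, OF prob finite_lessThan E S] by (simp_all add: D_def)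

text \<open>Finite partial sums pass to the limit and are at most e, as in Fatou's lemma. The
  reverse inequality is uniform integrability: the second-moment bound controls the part of the mean
  that comes from large values.\<close>

lemma expectation_sums:
  assumes second: "eventually (\<lambda>n. (\<integral>r. (real (S n r))\<^sup>2 \<partial>M n) \<le> K) sequentially"
    and first: "(\<lambda>n. \<integral>r. real (S n r) \<partial>M n) \<longlonglongrightarrow> e"
  shows "(\<lambda>i. real (s i) * p i) sums e"
proof -
  have "(\<Sum>i<N. real (s i) * p i) \<le> e" for N
  proof (rule LIMSEQ_le[OF _ first])
    show "(\<lambda>n. \<Sum>i<N. real (s i) * measure (M n) (E n i)) \<longlonglongrightarrow> (\<Sum>i<N. real (s i) * p i)"
      by (intro tendsto_intros lim)
    have "(\<Sum>i<N. real (s i) * measure (M n) (E n i)) \<le> (\<integral>r. real (S n r) \<partial>M n)" for n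
      unfolding integral_D(2)[symmetric]
      by (rule integral_mono[OF integral_D(1) int1]) (simp add: indicator_def)
    then show "\<exists>N0. \<forall>n\<ge>N0. (\<Sum>i<N. real (s i) * measure (M n) (E n i)) \<le> (\<integral>r. real (S n r) \<partial>M n)" by blast
  qed
  moreover have nn: "real (s i) * p i \<ge> 0" for i using p_nonneg by simp
  ultimately have summ: "summable (\<lambda>i. real (s i) * p i)" by (intro summableI_nonneg_bounded[where x = e]) auto
  let ?T = "\<Sum>i. real (s i) * p i"
  have "?T \<le> e" using \<open>\<And>N. (\<Sum>i<N. real (s i) * p i) \<le> e\<close> by (intro suminf_le_const[OF summ])
  \<comment> \<open>Splits the mean at the level L. Outside \<open>D N n\<close> a value is at most
    L plus S^2/L; then n, N and L tend to infinity in this order.\<close>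
  have trunc: "e \<le> (\<Sum>i<N. real (s i) * p i) + L * (1 - (\<Sum>i<N. p i)) + K / L" if L: "L > 0" for N L
  proof (rule tendsto_le[OF sequentially_bot _ first])
    show "(\<lambda>n. (\<Sum>i<N. real (s i) * measure (M n) (E n i)) + L * (1 - (\<Sum>i<N. measure (M n) (E n i))) + K / L)
        \<longlonglongrightarrow> (\<Sum>i<N. real (s i) * p i) + L * (1 - (\<Sum>i<N. p i)) + K / L"
      by (intro tendsto_intros lim)
    show "eventually (\<lambda>n. (\<integral>r. real (S n r) \<partial>M n) \<le>
        (\<Sum>i<N. real (s i) * measure (M n) (E n i)) + L * (1 - (\<Sum>i<N. measure (M n) (E n i))) + K / L) sequentially"
      using second
    proof eventually_elim
      case (elim n)
      interpret prob_space "M n" by (rule prob)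
      let ?D = "D N n"
      have int: "integrable (M n) (\<lambda>r. L * indicator (space (M n) - ?D) r)"
        using D(1)[of N n] by (intro integrable_mult_right integrable_real_indicator) (auto simp: less_top[symmetric])
      have int': "integrable (M n) (\<lambda>r. (real (S n r))\<^sup>2 / L)" by (rule integrable_divide_zero[OF int2])
      have "(\<integral>r. real (S n r) \<partial>M n) \<le>
          (\<integral>r. real (S n r) * indicator ?D r + L * indicator (space (M n) - ?D) r + (real (S n r))\<^sup>2 / L \<partial>M n)"
      proof (rule integral_mono[OF int1])
        show "integrable (M n) (\<lambda>r. real (S n r) * indicator ?D r + L * indicator (space (M n) - ?D) r + (real (S n r))\<^sup>2 / L)"
          by (intro Bochner_Integration.integrable_add integral_D(1) int int')
        fix r assume r: "r \<in> space (M n)"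
        \<comment> \<open>Values above L are dominated by S^2/L.\<close>
        have "real (S n r) \<le> L + (real (S n r))\<^sup>2 / L"
        proof (cases "real (S n r) \<le> L")
          case True
          moreover have "0 \<le> (real (S n r))\<^sup>2 / L" using L by simp
          ultimately show ?thesis by linarith
        next
          case False
          then have "real (S n r) * L \<le> (real (S n r))\<^sup>2" by (simp add: power2_eq_square mult_left_mono)
          then have "real (S n r) \<le> (real (S n r))\<^sup>2 / L" using L by (simp add: field_simps)
          then show ?thesis using L by linarith
        qed
        moreover have "0 \<le> (real (S n r))\<^sup>2 / L" using L by simp
        ultimately show "real (S n r) \<le> real (S n r) * indicator ?D r + L * indicator (space (M n) - ?D) r + (real (S n r))\<^sup>2 / L"
          using r by (auto simp: indicator_def)
      qed
      also have "\<dots> = (\<integral>r. real (S n r) * indicator ?D r \<partial>M n) + (\<integral>r. L * indicator (space (M n) - ?D) r \<partial>M n)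
          + (\<integral>r. (real (S n r))\<^sup>2 / L \<partial>M n)"
        by (simp only: Bochner_Integration.integral_add[OF Bochner_Integration.integrable_add[OF integral_D(1) int] int']
            Bochner_Integration.integral_add[OF integral_D(1) int])
      also have "(\<integral>r. L * indicator (space (M n) - ?D) r \<partial>M n) = L * (1 - measure (M n) ?D)"
        using D(1)[of N n] prob_compl[of ?D] by (simp add: Int_absorb2 Diff_subset)
      also have "(\<integral>r. (real (S n r))\<^sup>2 / L \<partial>M n) \<le> K / L"
        using elim L by (simp add: divide_right_mono)
      finally show ?case by (simp add: integral_D(2) D(2))
    qed
  qed
  have "e \<le> ?T + K / L" if L: "L > 0" for L
  proof (rule LIMSEQ_le_const)
    have "(\<lambda>N. ?T + L * (1 - (\<Sum>i<N. p i)) + K / L) \<longlonglongrightarrow> ?T + L * (1 - 1) + K / L"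
      using p unfolding sums_def by (intro tendsto_intros)
    then show "(\<lambda>N. ?T + L * (1 - (\<Sum>i<N. p i)) + K / L) \<longlonglongrightarrow> ?T + K / L" by simp
    have "e \<le> ?T + L * (1 - (\<Sum>i<N. p i)) + K / L" for N
      using trunc[OF L, of N] sum_le_suminf[OF summ finite_lessThan[of N]] nn by (auto intro: order_trans)
    then show "\<exists>N0. \<forall>N\<ge>N0. e \<le> ?T + L * (1 - (\<Sum>i<N. p i)) + K / L" by blast
  qed
  then have ev: "eventually (\<lambda>L. e \<le> ?T + K / L) at_top"
    by (rule eventually_mono[OF eventually_gt_at_top[of "0::real"]])
  have "((\<lambda>L. ?T + K / L) \<longlongrightarrow> ?T + 0) at_top"
    by (intro tendsto_intros tendsto_divide_0[OF tendsto_const] filterlim_at_top_imp_at_infinity filterlim_ident)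
  then have "e \<le> ?T" using tendsto_lowerbound[OF _ ev] by simp
  with \<open>?T \<le> e\<close> have "?T = e" by simp
  then show ?thesis using summ by (simp add: sums_iff)
qed

text \<open>Chebyshev's inequality would force mass to escape to infinity.\<close>

lemma no_concentration_at_infinity:
  assumes m: "filterlim m at_top sequentially"
    and first: "\<And>n. (\<integral>r. real (S n r) \<partial>M n) = m n"
    and second: "\<And>n. (\<integral>r. (real (S n r))\<^sup>2 \<partial>M n) \<le> (m n)\<^sup>2 + K * m n"
  shows False
proof -
  have "(\<lambda>N. \<Sum>i<N. p i) \<longlonglongrightarrow> 1" using p by (simp add: sums_def)
  then have "eventually (\<lambda>N. (\<Sum>i<N. p i) > 1 / 2) sequentially" by (rule order_tendstoD) simp
  then obtain N where N: "(\<Sum>i<N. p i) > 1 / 2" by (auto simp: eventually_sequentially)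
  \<comment> \<open>A bound for the number of survivors on the first N pieces, which capture more
    than half of the limiting mass.\<close>
  define L where "L = (\<Sum>i<N. real (s i))"
  have "(\<lambda>n. measure (M n) (D N n)) \<longlonglongrightarrow> (\<Sum>i<N. p i)" unfolding D(2) by (intro tendsto_intros lim)
  then have "eventually (\<lambda>n. measure (M n) (D N n) > 1 / 2) sequentially" using N by (rule order_tendstoD)
  \<comment> \<open>The first condition gives m - L \<ge> m/2. On an event of probability above 1/2
    the deviation from the mean is then at least m/2, so m^2/8 \<le> K m, which the second condition
    excludes.\<close>
  moreover have "eventually (\<lambda>n. m n > 2 * L + 1 \<and> m n > 8 * K) sequentially"
    using m by (simp add: filterlim_at_top_dense eventually_conj_iff)
  ultimately have "eventually (\<lambda>n. False) sequentially"
  proof eventually_elim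
    case (elim n)
    interpret prob_space "M n" by (rule prob)
    have L0: "L \<ge> 0" unfolding L_def by (intro sum_nonneg) simp
    have SL: "real (S n r) \<le> L" if r: "r \<in> D N n" for r
    proof -
      obtain i where "i < N" "r \<in> E n i" using r by (auto simp: D_def)
      then show ?thesis using member_le_sum[of i "{..<N}" "\<lambda>i. real (s i)"] S by (simp add: L_def)
    qed
    have intD: "integrable (M n) (\<lambda>r. (m n - L)\<^sup>2 * indicator (D N n) r)"
      using D(1)[of N n] by (intro integrable_mult_right integrable_real_indicator) (auto simp: less_top[symmetric])
    have eq: "(real (S n r) - m n)\<^sup>2 = (real (S n r))\<^sup>2 - 2 * m n * real (S n r) + (m n)\<^sup>2" for r
      by (simp add: power2_eq_square algebra_simps)
    have int: "integrable (M n) (\<lambda>r. (real (S n r) - m n)\<^sup>2)"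
      unfolding eq by (intro Bochner_Integration.integrable_add Bochner_Integration.integrable_diff int1 int2 integrable_mult_right) simp
    have "(m n - L)\<^sup>2 * measure (M n) (D N n) = (\<integral>r. (m n - L)\<^sup>2 * indicator (D N n) r \<partial>M n)"
      using sets.sets_into_space[OF D(1)] by (simp add: Int_absorb2)
    also have "\<dots> \<le> (\<integral>r. (real (S n r) - m n)\<^sup>2 \<partial>M n)"
    proof (rule integral_mono[OF intD int])
      fix r
      show "(m n - L)\<^sup>2 * indicator (D N n) r \<le> (real (S n r) - m n)\<^sup>2"
      proof (cases "r \<in> D N n")
        case True
        then have "(m n - L)\<^sup>2 \<le> (m n - real (S n r))\<^sup>2"
          using SL elim L0 by (intro power_mono) auto
        then show ?thesis using True by (simp add: power2_commute)
      qed simp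
    qed
    also have "\<dots> = (\<integral>r. (real (S n r))\<^sup>2 \<partial>M n) - 2 * m n * (\<integral>r. real (S n r) \<partial>M n) + (m n)\<^sup>2"
      unfolding eq using int1 int2 by (simp add: prob_space)
    also have "\<dots> \<le> K * m n" using first second[of n] by (simp add: power2_eq_square)
    finally have 1: "(m n - L)\<^sup>2 * measure (M n) (D N n) \<le> K * m n" .
    have "(m n - L)\<^sup>2 * (1 / 2) \<le> (m n - L)\<^sup>2 * measure (M n) (D N n)"
      using elim by (intro mult_left_mono) auto
    moreover have "(m n / 2)\<^sup>2 \<le> (m n - L)\<^sup>2" using elim L0 by (intro power_mono) auto
    ultimately have "(m n / 2)\<^sup>2 * (1 / 2) \<le> K * m n" using 1 by linarith
    then have "m n * m n \<le> 8 * K * m n" by (simp add: power2_eq_square)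
    then have "m n \<le> 8 * K" using elim L0 by (simp add: mult_le_cancel_right)
    then show ?case using elim by simp
  qed
  then show False by simp
qed

end

section \<open>The moments of \<open>\<mu>\<^sub>u\<close>\<close>

text \<open>A surjection descends to the quotient exactly when its kernel, a closed normal
  \<Gamma>-subgroup, contains the coordinates of Y at all relators, that is, when every relator has
  invariant image.\<close>

lemma (in haar_Fn) card_gSur_Xun:
  assumes A: "finite_ggroup \<Gamma> A" and r: "\<And>j. j < k \<Longrightarrow> r j \<in> Fn_carrier n"
  shows "pre_ggroup \<Gamma> (Xun \<Gamma> gs n (r ` {..<k}))"
    and "card (gSur \<Gamma> (Xun \<Gamma> gs n (r ` {..<k})) A) = survivors A k r"
proof -
  interpret A: finite_ggroup \<Gamma> A by fact
  let ?F = "Fn \<Gamma> gs n" and ?Y = "\<Union>x\<in>r ` {..<k}. set (Ymap gs (Fn \<Gamma> gs n) x)"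
  define N where "N = closed_normal_gsubgroup_gen \<Gamma> ?F ?Y"
  have X: "Xun \<Gamma> gs n (r ` {..<k}) = gquot ?F N" by (simp add: Xun_def N_def)
  have Y: "?Y \<subseteq> Fn_carrier n" using r gs by (auto simp: Ymap_def)
  have N: "N \<lhd> ?F" "gstable \<Gamma> ?F N" and YN: "?Y \<subseteq> N"
    using Fn.closed_normal_gsubgroup_gen[OF Y] by (auto simp: N_def closed_normal_gsubgroup_def)
  have sg: "subgroup N ?F" by (rule normal_imp_subgroup[OF N(1)])
  note \<pi> = Fn.quotient_projection[OF group_\<Gamma> N]
  show "pre_ggroup \<Gamma> (Xun \<Gamma> gs n (r ` {..<k}))" unfolding X by (rule Fn.pre_ggroup_gquot[OF group_\<Gamma> N])
  have "{\<phi> \<in> surjections A. \<forall>x\<in>Fn_carrier n. \<forall>y\<in>Fn_carrier n. N #>\<^bsub>?F\<^esub> x = N #>\<^bsub>?F\<^esub> y \<longrightarrow> \<phi> x = \<phi> y}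
      = {\<phi> \<in> surjections A. \<forall>j<k. r j \<in> stab A \<phi>}" (is "?L = ?R")
  proof (rule Collect_cong, rule conj_cong[OF refl])
    fix \<phi> assume \<phi>: "\<phi> \<in> surjections A"
    then have gh: "\<phi> \<in> gHom \<Gamma> ?F A" and hom: "\<phi> \<in> hom ?F A" and eq: "gequivariant \<Gamma> ?F A \<phi>"
      by (auto simp: gSur_eq gHom_def)
    interpret \<phi>: group_hom ?F A \<phi> by (simp add: group_hom.intro group_hom_axioms.intro hom)
    have Ymem: "inv\<^bsub>?F\<^esub> (r j) \<otimes>\<^bsub>?F\<^esub> gact ?F \<gamma> (r j) \<in> kernel ?F A \<phi> \<longleftrightarrow> gact A \<gamma> (\<phi> (r j)) = \<phi> (r j)"
      if "j < k" "\<gamma> \<in> carrier \<Gamma>" for j \<gamma>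
    proof -
      have c: "\<phi> (r j) \<in> carrier A" "gact A \<gamma> (\<phi> (r j)) \<in> carrier A" using r[OF that(1)] that(2) by auto
      have "\<phi> (inv\<^bsub>?F\<^esub> (r j) \<otimes>\<^bsub>?F\<^esub> gact ?F \<gamma> (r j)) = inv\<^bsub>A\<^esub> \<phi> (r j) \<otimes>\<^bsub>A\<^esub> gact A \<gamma> (\<phi> (r j))"
        using r[OF that(1)] that(2) eq by (simp add: gequivariant_def)
      moreover have "\<one>\<^bsub>A\<^esub> = inv\<^bsub>A\<^esub> \<phi> (r j) \<otimes>\<^bsub>A\<^esub> gact A \<gamma> (\<phi> (r j)) \<longleftrightarrow> gact A \<gamma> (\<phi> (r j)) = \<phi> (r j) \<otimes>\<^bsub>A\<^esub> \<one>\<^bsub>A\<^esub>"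
        by (rule A.inv_solve_left) (use c in simp_all)
      ultimately show ?thesis using r[OF that(1)] that(2) c by (auto simp: kernel_def)
    qed
    show "(\<forall>x\<in>Fn_carrier n. \<forall>y\<in>Fn_carrier n. N #>\<^bsub>?F\<^esub> x = N #>\<^bsub>?F\<^esub> y \<longrightarrow> \<phi> x = \<phi> y) \<longleftrightarrow>
        (\<forall>j<k. r j \<in> stab A \<phi>)"
    proof
      assume const: "\<forall>x\<in>Fn_carrier n. \<forall>y\<in>Fn_carrier n. N #>\<^bsub>?F\<^esub> x = N #>\<^bsub>?F\<^esub> y \<longrightarrow> \<phi> x = \<phi> y"
      have Nker: "\<phi> x = \<one>\<^bsub>A\<^esub>" if "x \<in> N" for x
      proof -
        have x: "x \<in> Fn_carrier n" using subgroup.mem_carrier[OF sg that] .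
        have "N #>\<^bsub>?F\<^esub> x = N #>\<^bsub>?F\<^esub> \<one>\<^bsub>?F\<^esub>"
          using Fn.coset_join2[OF x sg that] Fn.coset_mult_one[OF subgroup.subset[OF sg]] by simp
        then have "\<phi> x = \<phi> \<one>\<^bsub>?F\<^esub>" using const x by blast
        then show ?thesis by simp
      qed
      show "\<forall>j<k. r j \<in> stab A \<phi>"
      proof (intro allI impI)
        fix j assume j: "j < k"
        let ?a = "\<phi> (r j)"
        have a: "?a \<in> carrier A" using r[OF j] by simp
        have gsfix: "gact A \<gamma> ?a = ?a" if \<gamma>: "\<gamma> \<in> set gs" for \<gamma>
        proof -
          have "inv\<^bsub>?F\<^esub> (r j) \<otimes>\<^bsub>?F\<^esub> gact ?F \<gamma> (r j) \<in> ?Y" using j \<gamma> by (auto simp: Ymap_def)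
          then have y: "inv\<^bsub>?F\<^esub> (r j) \<otimes>\<^bsub>?F\<^esub> gact ?F \<gamma> (r j) \<in> N" using YN by blast
          then have "inv\<^bsub>?F\<^esub> (r j) \<otimes>\<^bsub>?F\<^esub> gact ?F \<gamma> (r j) \<in> kernel ?F A \<phi>"
            using Nker subgroup.mem_carrier[OF sg y] by (simp add: kernel_def)
          then show ?thesis using Ymem[OF j] \<gamma> gs by blast
        qed
        \<comment> \<open>Only the members of \<open>gs\<close> are known to fix the image of the
          relator. Its coboundary is a cocycle that is trivial on \<open>gs\<close>, hence on all of
          \<Gamma>.\<close>
        have cob: "coboundary \<Gamma> A ?a \<in> cocycles \<Gamma> A" by (rule A.coboundary_mem_cocycles[OF group_\<Gamma> a])
        have "coboundary \<Gamma> A ?a \<gamma> \<in> {\<one>\<^bsub>A\<^esub>}" if "\<gamma> \<in> carrier \<Gamma>" for \<gamma>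
        proof (rule A.cocycle_mem_of_generators[OF group_\<Gamma> cob A.triv_subgroup _ gs generate_gs _ that])
          show "gstable \<Gamma> A {\<one>\<^bsub>A\<^esub>}" by (simp add: gstable_def)
          show "coboundary \<Gamma> A ?a \<sigma> \<in> {\<one>\<^bsub>A\<^esub>}" if "\<sigma> \<in> set gs" for \<sigma>
            using that gs a gsfix by (auto simp: coboundary_def)
        qed
        then have *: "inv\<^bsub>A\<^esub> ?a \<otimes>\<^bsub>A\<^esub> gact A \<gamma> ?a = \<one>\<^bsub>A\<^esub>" if "\<gamma> \<in> carrier \<Gamma>" for \<gamma>
          using that by (auto simp: coboundary_def)
        have "gact A \<gamma> ?a = ?a" if \<gamma>: "\<gamma> \<in> carrier \<Gamma>" for \<gamma>
          using A.inv_mult_cancel_left(1)[OF a A.gact_closed[OF \<gamma> a]] *[OF \<gamma>] a by simp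
        then show "r j \<in> stab A \<phi>" using r[OF j] a by (simp add: stab_def ginvariants_def)
      qed
    next
      assume inv: "\<forall>j<k. r j \<in> stab A \<phi>"
      have "?Y \<subseteq> kernel ?F A \<phi>"
      proof
        fix y assume "y \<in> ?Y"
        then obtain j \<gamma> where j: "j < k" "\<gamma> \<in> set gs" "y = inv\<^bsub>?F\<^esub> (r j) \<otimes>\<^bsub>?F\<^esub> gact ?F \<gamma> (r j)"
          by (auto simp: Ymap_def)
        then have \<gamma>: "\<gamma> \<in> carrier \<Gamma>" using gs by blast
        have "gact A \<gamma> (\<phi> (r j)) = \<phi> (r j)" using inv j(1) \<gamma> by (simp add: stab_def ginvariants_def)
        then show "y \<in> kernel ?F A \<phi>" using Ymem[OF j(1) \<gamma>] j(3) by simp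
      qed
      from closed_normal_gsubgroup_gen_least[OF Fn.first_isomorphism(1)[OF group_\<Gamma> A gh] this]
      have Nk: "N \<subseteq> kernel ?F A \<phi>" by (simp add: N_def)
      show "\<forall>x\<in>Fn_carrier n. \<forall>y\<in>Fn_carrier n. N #>\<^bsub>?F\<^esub> x = N #>\<^bsub>?F\<^esub> y \<longrightarrow> \<phi> x = \<phi> y"
      proof (intro ballI impI)
        fix x y assume xy: "x \<in> Fn_carrier n" "y \<in> Fn_carrier n" "N #>\<^bsub>?F\<^esub> x = N #>\<^bsub>?F\<^esub> y"
        then have "x \<in> N #>\<^bsub>?F\<^esub> y" using Fn.rcos_self[OF xy(1) sg] by simp
        then obtain h where "h \<in> N" "x = h \<otimes>\<^bsub>?F\<^esub> y" by (auto simp: r_coset_def)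
        moreover then have "h \<in> Fn_carrier n" "\<phi> h = \<one>\<^bsub>A\<^esub>" using Nk by (auto simp: kernel_def)
        ultimately show "\<phi> x = \<phi> y" using xy by simp
      qed
    qed
  qed
  then have "bij_betw (\<lambda>f. restrict (f \<circ> (\<lambda>x. N #>\<^bsub>?F\<^esub> x)) (Fn_carrier n)) (gSur \<Gamma> (gquot ?F N) A) ?R"
    using Fn.bij_betw_gSur_quotient[OF \<pi>, of A] by simp
  then show "card (gSur \<Gamma> (Xun \<Gamma> gs n (r ` {..<k})) A) = survivors A k r"
    unfolding X survivors_def by (rule bij_betw_same_card)
qed

locale mu_moments = generated_finite_group \<Gamma> gs for \<Gamma> :: "'g monoid" and gs :: "'g list" +
  fixes \<nu> :: "nat \<Rightarrow> 'g free_elem measure" and u :: int and \<mu> :: "'g gclass measure"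
  assumes haar: "\<And>n. haar_prob (Fn \<Gamma> gs n) (\<nu> n)" and mu: "is_mu \<Gamma> gs \<nu> u \<mu>"
begin

lemma haar_Fn: "haar_Fn \<Gamma> gs n (\<nu> n)"
  by unfold_locales (rule haar)

text \<open>The truncation is harmless: \<open>eventually_relators\<close> shows that the value is n
  + u as soon as n \<ge> -u.\<close>

definition relators :: "nat \<Rightarrow> nat" where
  "relators n = nat (int n + u)"

definition relator_space :: "nat \<Rightarrow> (nat \<Rightarrow> 'g free_elem) measure" where
  "relator_space n = PiM {..<relators n} (\<lambda>_. \<nu> n)"

definition relator_survivors :: "('g, 'a) ggroup \<Rightarrow> nat \<Rightarrow> (nat \<Rightarrow> 'g free_elem) \<Rightarrow> nat" where
  "relator_survivors A n = haar_Fn.survivors \<Gamma> gs n A (relators n)"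

lemma eventually_relators: "eventually (\<lambda>n. int (relators n) = int n + u) sequentially"
  by (rule eventually_mono[OF eventually_ge_at_top[of "nat (- u)"]]) (simp add: relators_def)

lemma prob_space_relators: "prob_space (relator_space n)"
proof -
  interpret haar_Fn \<Gamma> gs n "\<nu> n" by (rule haar_Fn)
  show ?thesis unfolding relator_space_def by (rule prob_space_PiM) (rule prob_space_axioms)
qed

lemma prob_space_mu: "prob_space \<mu>" and sets_mu: "sets \<mu> = sets (borel_of (P_top \<Gamma>))"
  using mu by (simp_all add: is_mu_def)

lemma space_mu: "space \<mu> = topspace (P_top \<Gamma>)"
  using sets_eq_imp_space_eq[OF sets_mu] openin_subset[of "P_top \<Gamma>"]
  by (simp add: borel_of_def space_measure_of_conv)

text \<open>The only place where the hypothesis on \<mu> is turned into analysis: convergence on the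
  pieces of the partition together with total mass one.\<close>

lemma tight_limit:
  fixes A :: "('g, 'a) ggroup"
  assumes A: "finite_ggroup \<Gamma> A" "coprime (order A) (order \<Gamma>)"
  obtains V s E where "disjoint_family V" "\<Union>(range V) = space \<mu>" "\<And>i. V i \<in> sets \<mu>"
    "\<And>i X. X \<in> V i \<Longrightarrow> finite (gSur_class \<Gamma> X A) \<and> card (gSur_class \<Gamma> X A) = s i"
    "tight_limit relator_space (relator_survivors A) E (\<lambda>i. measure \<mu> (V i)) s"
proof -
  obtain V :: "nat \<Rightarrow> 'g gclass set" and s :: "nat \<Rightarrow> nat"
  where V: "disjoint_family V" "\<Union>(range V) = topspace (P_top \<Gamma>)"
    "\<And>i. V i \<in> P_algebra \<Gamma>" "\<And>i. V i \<in> sets (borel_of (P_top \<Gamma>))"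
    "\<And>i X. X \<in> V i \<Longrightarrow> finite (gSur_class \<Gamma> X A) \<and> card (gSur_class \<Gamma> X A) = s i"
    "\<And>i (Y :: ('g, 'g free_elem set) ggroup). \<lbrakk>pre_ggroup \<Gamma> Y; gclass \<Gamma> Y \<in> V i\<rbrakk> \<Longrightarrow> card (gSur \<Gamma> Y A) = s i"
    using P_space_partition[OF group_\<Gamma> finite_\<Gamma> A] by blast
  define E where "E = (\<lambda>n i. {r \<in> space (relator_space n). gclass \<Gamma> (Xun \<Gamma> gs n (r ` {..<relators n})) \<in> V i})"
  interpret \<mu>: prob_space \<mu> by (rule prob_space_mu)
  have Vs: "V i \<in> sets \<mu>" for i using V(4) sets_mu by simp
  have "tight_limit relator_space (relator_survivors A) E (\<lambda>i. measure \<mu> (V i)) s"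
  proof (rule tight_limit.intro)
    show "prob_space (relator_space n)" for n by (rule prob_space_relators)
    show "disjoint_family (E n)" for n using V(1) by (auto simp: E_def disjoint_family_on_def)
    \<comment> \<open>The piece \<open>V i\<close> belongs to the generated algebra, where the
      convergence is part of \<open>is_mu\<close>.\<close>
    show "(\<lambda>n. measure (relator_space n) (E n i)) \<longlonglongrightarrow> measure \<mu> (V i)" for i
      using mu V(3)[of i] by (simp add: is_mu_def Xun_prob_def Let_def relator_space_def relators_def E_def)
    have "(\<lambda>i. measure \<mu> (V i)) sums measure \<mu> (\<Union>i. V i)"
      by (rule \<mu>.finite_measure_UNION[OF _ V(1)]) (use Vs in blast)
    \<comment> \<open>The pieces exhaust the space of \<mu>; this is the tightness on which both
      limit arguments rest.\<close>
    then show "(\<lambda>i. measure \<mu> (V i)) sums 1" using V(2) \<mu>.prob_space by (simp add: space_mu)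
    fix n
    interpret F: haar_Fn \<Gamma> gs n "\<nu> n" by (rule haar_Fn)
    show "relator_survivors A n r = s i" if "r \<in> E n i" for i r
    proof -
      have "r \<in> space (relator_space n)" and X: "gclass \<Gamma> (Xun \<Gamma> gs n (r ` {..<relators n})) \<in> V i"
        using that by (auto simp: E_def)
      then have "r j \<in> Fn_carrier n" if "j < relators n" for j
        using that by (auto simp: relator_space_def space_PiM F.space_\<nu> PiE_iff)
      from F.card_gSur_Xun[OF A(1) this] V(6)[OF _ X] show ?thesis by (simp add: relator_survivors_def)
    qed
    show "integrable (relator_space n) (\<lambda>r. real (relator_survivors A n r))"
      using F.survivors_moment(1)[OF A(1)] by (simp add: relator_space_def relator_survivors_def)
    show "integrable (relator_space n) (\<lambda>r. (real (relator_survivors A n r))\<^sup>2)"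
      using F.survivors_second_moment(1)[OF A(1)] by (simp add: relator_space_def relator_survivors_def)
  qed
  then show thesis using that[of V s E] V Vs by (simp add: space_mu)
qed

lemma survivors_mean:
  assumes "finite_ggroup \<Gamma> A"
  shows "(\<integral>r. real (relator_survivors A n r) \<partial>relator_space n) =
    card (gSur \<Gamma> (Fn \<Gamma> gs n) A) / real (gindex \<Gamma> A) ^ relators n"
proof -
  interpret F: haar_Fn \<Gamma> gs n "\<nu> n" by (rule haar_Fn)
  show ?thesis using F.survivors_moment(2)[OF assms] by (simp add: relator_space_def relator_survivors_def)
qed

text \<open>Homomorphisms with a proper image D number at most |Z^1(\<Gamma>, D)|^n. Admissibility
  makes the base smaller than |Z^1(\<Gamma>, A)|, so the finitely many D together contribute an
  exponentially small proportion.\<close>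

lemma card_gSur_asymptotics:
  assumes A: "finite_ggroup \<Gamma> A" "coprime (order A) (order \<Gamma>)" "admissible \<Gamma> A"
  shows "(\<lambda>n. card (gSur \<Gamma> (Fn \<Gamma> gs n) A) / real (card (cocycles \<Gamma> A)) ^ n) \<longlonglongrightarrow> 1"
proof -
  interpret A: finite_ggroup \<Gamma> A by fact
  let ?z = "\<lambda>D. card (cocycles \<Gamma> (gsub A D))" and ?Z = "card (cocycles \<Gamma> A)" and ?G = "gsubs \<Gamma> A - {carrier A}"
  have Z: "?Z > 0" using A.gindex_le_card_cocycles[OF group_\<Gamma> finite_\<Gamma>] A.gindex_pos by simp
  show ?thesis
  proof (rule tendsto_sandwich)
    show "eventually (\<lambda>n. 1 - (\<Sum>D\<in>?G. (real (?z D) / ?Z) ^ n) \<le> card (gSur \<Gamma> (Fn \<Gamma> gs n) A) / real ?Z ^ n) sequentially"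
    proof (rule always_eventually, rule allI)
      fix n
      interpret F: haar_Fn \<Gamma> gs n "\<nu> n" by (rule haar_Fn)
      have "?Z ^ n \<le> card (gSur \<Gamma> (Fn \<Gamma> gs n) A) + (\<Sum>D\<in>?G. ?z D ^ n)"
        using F.card_gHom_le[OF A(1)] card_gHom_Fn[OF A(1,2), of n] by simp
      then have "real (?Z ^ n) \<le> real (card (gSur \<Gamma> (Fn \<Gamma> gs n) A) + (\<Sum>D\<in>?G. ?z D ^ n))" by (rule of_nat_mono)
      then have "1 \<le> (card (gSur \<Gamma> (Fn \<Gamma> gs n) A) + (\<Sum>D\<in>?G. real (?z D) ^ n)) / real ?Z ^ n"
        using Z by (simp add: field_simps)
      then show "1 - (\<Sum>D\<in>?G. (real (?z D) / ?Z) ^ n) \<le> card (gSur \<Gamma> (Fn \<Gamma> gs n) A) / real ?Z ^ n"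
        by (simp add: add_divide_distrib sum_divide_distrib power_divide)
    qed
    show "eventually (\<lambda>n. card (gSur \<Gamma> (Fn \<Gamma> gs n) A) / real ?Z ^ n \<le> 1) sequentially"
    proof (rule always_eventually, rule allI)
      fix n
      have "card (gSur \<Gamma> (Fn \<Gamma> gs n) A) \<le> card (gHom \<Gamma> (Fn \<Gamma> gs n) A)"
        by (rule card_mono[OF finite_gHom_Fn[OF A(1)]]) (auto simp: gSur_eq)
      also have "\<dots> = ?Z ^ n" by (rule card_gHom_Fn[OF A(1,2)])
      finally have "real (card (gSur \<Gamma> (Fn \<Gamma> gs n) A)) \<le> real (?Z ^ n)" by (rule of_nat_mono)
      then show "card (gSur \<Gamma> (Fn \<Gamma> gs n) A) / real ?Z ^ n \<le> 1" using Z by simp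
    qed
    have "(\<lambda>n. 1 - (\<Sum>D\<in>?G. (real (?z D) / ?Z) ^ n)) \<longlonglongrightarrow> 1 - (\<Sum>D\<in>?G. 0)"
    proof (intro tendsto_intros LIMSEQ_power_zero)
      fix D assume "D \<in> ?G"
      then have "?z D < ?Z" using A.card_cocycles_gsub_less[OF group_\<Gamma> finite_\<Gamma> A(3)] by (auto simp: gsubs_def)
      then show "norm (real (?z D) / ?Z) < 1" using Z by simp
    qed
    then show "(\<lambda>n. 1 - (\<Sum>D\<in>?G. (real (?z D) / ?Z) ^ n)) \<longlonglongrightarrow> 1" by simp
  qed simp
qed

end

section \<open>Vanishing of \<open>H\<^sup>1\<close>\<close>

context finite_ggroup
begin

text \<open>Conjugates of the generators are products of generators and inverses of generators. For
  a \<Gamma>-simple group this leaves two cases: K is trivial and so is the action, or K is the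
  whole group, which is then generated as admissibility demands.\<close>

lemma commutator_normal:
  assumes \<Gamma>: "group \<Gamma>"
  defines "K \<equiv> closed_gsubgroup_gen \<Gamma> B {inv g \<otimes> gact B \<sigma> g | g \<sigma>. g \<in> carrier B \<and> \<sigma> \<in> carrier \<Gamma>}"
  shows "K \<lhd> B" "gstable \<Gamma> B K"
    and "\<And>g \<sigma>. \<lbrakk>g \<in> carrier B; \<sigma> \<in> carrier \<Gamma>\<rbrakk> \<Longrightarrow> inv g \<otimes> gact B \<sigma> g \<in> K"
proof -
  interpret \<Gamma>: group \<Gamma> by fact
  let ?S = "{inv g \<otimes> gact B \<sigma> g | g \<sigma>. g \<in> carrier B \<and> \<sigma> \<in> carrier \<Gamma>}"
  have S: "?S \<subseteq> carrier B" by auto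
  have K: "subgroup K B" "gstable \<Gamma> B K" and SK: "?S \<subseteq> K"
    using closed_gsubgroup_gen[OF S] by (auto simp: K_def closed_gsubgroup_def)
  show "gstable \<Gamma> B K" by (rule K(2))
  have KB: "K \<subseteq> carrier B" by (rule subgroup.subset[OF K(1)])
  show comm: "inv g \<otimes> gact B \<sigma> g \<in> K" if "g \<in> carrier B" "\<sigma> \<in> carrier \<Gamma>" for g \<sigma>
    using that SK by blast
  \<comment> \<open>The elements all of whose conjugates lie in K. They form a closed
    \<Gamma>-subgroup, so it suffices to find the generators among them.\<close>
  let ?T = "{x \<in> carrier B. \<forall>h\<in>carrier B. h \<otimes> x \<otimes> inv h \<in> K}"
  have "closed_gsubgroup \<Gamma> B ?T"
    unfolding closed_gsubgroup_def
  proof (intro conjI)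
    show "subgroup ?T B"
    proof (rule subgroupI)
      show "?T \<noteq> {}" using subgroup.one_closed[OF K(1)] by (auto intro!: exI[of _ \<one>])
      show "inv a \<in> ?T" if a: "a \<in> ?T" for a
      proof -
        have "h \<otimes> inv a \<otimes> inv h = inv (h \<otimes> a \<otimes> inv h)" if "h \<in> carrier B" for h
          using a that by (simp add: inv_mult_group m_assoc)
        then show ?thesis using a subgroup.m_inv_closed[OF K(1)] by simp
      qed
      show "a \<otimes> b \<in> ?T" if a: "a \<in> ?T" and b: "b \<in> ?T" for a b
      proof -
        have "h \<otimes> (a \<otimes> b) \<otimes> inv h = (h \<otimes> a \<otimes> inv h) \<otimes> (h \<otimes> b \<otimes> inv h)" if "h \<in> carrier B" for h
          using a b that by (simp add: m_assoc inv_mult_cancel_left)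
        then show ?thesis using a b subgroup.m_closed[OF K(1)] by simp
      qed
    qed auto
    show "closedin (gtop B) ?T" by (auto simp: gtop_discrete closedin_def)
    show "gstable \<Gamma> B ?T"
      unfolding gstable_def
    proof (intro ballI image_subsetI)
      fix \<sigma> x assume \<sigma>: "\<sigma> \<in> carrier \<Gamma>" and x: "x \<in> ?T"
      have "h \<otimes> gact B \<sigma> x \<otimes> inv h \<in> K" if h: "h \<in> carrier B" for h
      proof -
        let ?h = "gact B (inv\<^bsub>\<Gamma>\<^esub> \<sigma>) h"
        have hh: "?h \<in> carrier B" "gact B \<sigma> ?h = h"
          using h \<sigma> gact_one by (simp_all flip: gact_comp)
        have "gact B \<sigma> (?h \<otimes> x \<otimes> inv ?h) = h \<otimes> gact B \<sigma> x \<otimes> inv h"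
          using x hh \<sigma> by (simp add: gact_mult gact_inv)
        moreover have "?h \<otimes> x \<otimes> inv ?h \<in> K" using x hh by blast
        then have "gact B \<sigma> (?h \<otimes> x \<otimes> inv ?h) \<in> K"
          using K(2) \<sigma> unfolding gstable_def by blast
        ultimately show ?thesis by simp
      qed
      then show "gact B \<sigma> x \<in> ?T" using x \<sigma> by simp
    qed
  qed
  moreover have "?S \<subseteq> ?T"
  proof (intro subsetI CollectI conjI ballI)
    fix x assume "x \<in> ?S"
    then obtain g \<sigma> where g: "g \<in> carrier B" "\<sigma> \<in> carrier \<Gamma>" "x = inv g \<otimes> gact B \<sigma> g" by blast
    then show "x \<in> carrier B" by simp
    fix h assume h: "h \<in> carrier B"
    \<comment> \<open>With k = g h^(-1), the factor k^(-1) \<sigma>(k) is the desired conjugate up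
      to a discrepancy \<sigma>(h)^(-1) in place of h^(-1), which the generator attached to h^(-1)
      repairs.\<close>
    have "h \<otimes> x \<otimes> inv h =
        (inv (g \<otimes> inv h) \<otimes> gact B \<sigma> (g \<otimes> inv h)) \<otimes> inv (inv (inv h) \<otimes> gact B \<sigma> (inv h))"
      using g h by (simp add: gact_mult gact_inv inv_mult_group m_assoc inv_mult_cancel_left)
    also have "\<dots> \<in> K"
      by (rule subgroup.m_closed[OF K(1) comm subgroup.m_inv_closed[OF K(1) comm]]) (use g h in auto)
    finally show "h \<otimes> x \<otimes> inv h \<in> K" .
  qed
  ultimately have "K \<subseteq> ?T" unfolding K_def by (rule closed_gsubgroup_gen_least)
  then show "K \<lhd> B" using K(1) by (intro normal_invI) blast+
qed

text \<open>For the trivial action a cocycle is a homomorphism from \<Gamma> to B, and coprime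
  orders force it to be trivial.\<close>

lemma H1_trivial_of_trivial_action:
  assumes \<Gamma>: "group \<Gamma>" "finite (carrier \<Gamma>)" "coprime (order B) (order \<Gamma>)"
    and triv: "\<And>g \<sigma>. \<lbrakk>g \<in> carrier B; \<sigma> \<in> carrier \<Gamma>\<rbrakk> \<Longrightarrow> gact B \<sigma> g = g"
  shows "H1_trivial \<Gamma> B"
  unfolding H1_trivial_def
proof
  interpret \<Gamma>: group \<Gamma> by fact
  fix c assume c: "c \<in> cocycles \<Gamma> B"
  have cB: "c \<sigma> \<in> carrier B" if "\<sigma> \<in> carrier \<Gamma>" for \<sigma> using c that by (auto simp: cocycles_def)
  have "c \<in> hom \<Gamma> B"
    using c cB triv by (intro homI) (auto simp: cocycles_def)
  then interpret c: group_hom \<Gamma> B c by (simp add: group_hom.intro group_hom_axioms.intro is_group \<Gamma>.is_group)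
  have "c \<sigma> = \<one>" if \<sigma>: "\<sigma> \<in> carrier \<Gamma>" for \<sigma>
  proof -
    have "c \<sigma> [^] order \<Gamma> = c (\<sigma> [^]\<^bsub>\<Gamma>\<^esub> order \<Gamma>)" using \<sigma> by (simp add: c.hom_nat_pow)
    also have "\<dots> = \<one>" using \<sigma> by (simp add: \<Gamma>.pow_order_eq_1)
    finally have "ord (c \<sigma>) dvd order \<Gamma>" using pow_eq_id[OF cB[OF \<sigma>]] by simp
    moreover have "ord (c \<sigma>) dvd order B" by (rule ord_dvd_group_order[OF cB[OF \<sigma>]])
    ultimately have "ord (c \<sigma>) = 1" using \<Gamma>(3) by (metis coprime_common_divisor nat_dvd_1_iff_1)
    then show ?thesis using cB[OF \<sigma>] ord_eq_1 by simp
  qed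
  then have "c = coboundary \<Gamma> B \<one>"
    using c by (intro extensionalityI[of _ "carrier \<Gamma>"]) (auto simp: coboundary_def cocycles_def PiE_def)
  then show "c \<in> coboundary \<Gamma> B ` carrier B" by simp
qed

end

section \<open>H^1 for \<Gamma>-simple groups, the general case, and the final integral\<close>

context mu_moments
begin

lemma gindex_power_relators:
  assumes "finite_ggroup \<Gamma> A"
  shows "eventually (\<lambda>n. real (gindex \<Gamma> A) ^ relators n = real (gindex \<Gamma> A) ^ n * real (gindex \<Gamma> A) powi u) sequentially"
  using eventually_relators
proof (rule eventually_mono)
  fix n assume "int (relators n) = int n + u"
  then show "real (gindex \<Gamma> A) ^ relators n = real (gindex \<Gamma> A) ^ n * real (gindex \<Gamma> A) powi u"
    using power_int_add[of "real (gindex \<Gamma> A)" "int n" u] finite_ggroup.gindex_pos[OF assms]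
    by (simp flip: power_int_of_nat)
qed

text \<open>Otherwise |Z^1(\<Gamma>, B)| exceeds [B : B^\<Gamma>], so the means tend to infinity
  while the variances are at most a constant times the means. This contradicts the total mass of the
  limit law.\<close>

lemma H1_trivial_simple:
  assumes B: "finite_ggroup \<Gamma> B" "coprime (order B) (order \<Gamma>)" "admissible \<Gamma> B"
    and simple: "\<And>N. \<lbrakk>N \<lhd> B; gstable \<Gamma> B N\<rbrakk> \<Longrightarrow> N = {\<one>\<^bsub>B\<^esub>} \<or> N = carrier B"
  shows "H1_trivial \<Gamma> B"
proof (rule ccontr)
  assume nH1: "\<not> H1_trivial \<Gamma> B"
  interpret B: finite_ggroup \<Gamma> B by fact
  let ?z = "real (card (cocycles \<Gamma> B))" and ?b = "real (gindex \<Gamma> B)"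
  have "card (cocycles \<Gamma> B) > gindex \<Gamma> B"
    using B.card_cocycles_eq_gindex_iff[OF group_\<Gamma> finite_\<Gamma>] B.gindex_le_card_cocycles[OF group_\<Gamma> finite_\<Gamma>] nH1
    by linarith
  then have zb: "?z / ?b > 1" and b0: "?b > 0" and z0: "?z > 0" using B.gindex_pos by (simp_all add: field_simps)
  define m where "m = (\<lambda>n. card (gSur \<Gamma> (Fn \<Gamma> gs n) B) / ?b ^ relators n)"
  \<comment> \<open>The mean is split into a factor with positive limit, by
    \<open>card_gSur_asymptotics\<close>, and the power of |Z^1| / [B : B^\<Gamma>], which exceeds
    one.\<close>
  have "filterlim (\<lambda>n. (card (gSur \<Gamma> (Fn \<Gamma> gs n) B) / ?z ^ n * (1 / ?b powi u)) * (?z / ?b) ^ n) at_top sequentially"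
  proof (rule filterlim_tendsto_pos_mult_at_top)
    show "(\<lambda>n. card (gSur \<Gamma> (Fn \<Gamma> gs n) B) / ?z ^ n * (1 / ?b powi u)) \<longlonglongrightarrow> 1 * (1 / ?b powi u)"
      by (intro tendsto_intros card_gSur_asymptotics[OF B])
    show "0 < 1 * (1 / ?b powi u)" using b0 by simp
    show "filterlim (\<lambda>n. (?z / ?b) ^ n) at_top sequentially" using zb b0 z0
      by (intro filterlim_at_infinity_imp_filterlim_at_top filterlim_realpow_sequentially_gt1) simp_all
  qed
  moreover have "eventually (\<lambda>n. (card (gSur \<Gamma> (Fn \<Gamma> gs n) B) / ?z ^ n * (1 / ?b powi u)) * (?z / ?b) ^ n = m n) sequentially"
    using gindex_power_relators[OF B(1)]
    by (rule eventually_mono) (use z0 in \<open>simp add: m_def power_divide\<close>)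
  ultimately have m: "filterlim m at_top sequentially" by (rule filterlim_cong[OF refl refl, THEN iffD1, rotated])
  obtain V s E where "tight_limit relator_space (relator_survivors B) E (\<lambda>i. measure \<mu> (V i)) s"
    using tight_limit[OF B(1,2)] by metis
  then interpret T: tight_limit relator_space "relator_survivors B" E "\<lambda>i. measure \<mu> (V i)" s .
  show False
  proof (rule T.no_concentration_at_infinity[OF m])
    fix n
    interpret F: haar_Fn \<Gamma> gs n "\<nu> n" by (rule haar_Fn)
    show "(\<integral>r. real (relator_survivors B n r) \<partial>relator_space n) = m n"
      using survivors_mean[OF B(1)] by (simp add: m_def)
    show "(\<integral>r. (real (relator_survivors B n r))\<^sup>2 \<partial>relator_space n) \<le>
        (m n)\<^sup>2 + real (card (carrier B \<rightarrow>\<^sub>E carrier B)) * m n"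
      using F.survivors_second_moment_simple[OF B(1) simple, of "m n" "relators n"]
      by (simp add: m_def relator_space_def relator_survivors_def)
  qed
qed

text \<open>In general the vanishing of \<open>H\<^sup>1\<close> for coprime orders rests on the Feit-Thompson theorem.
  Here it is a consequence of the existence of \<open>\<mu>\<^sub>u\<close>: for a \<open>\<Gamma>\<close>-simple counterexample the number of
  surjections from \<open>X\<^sub>u\<^sub>,\<^sub>n\<close> would tend to infinity in probability.\<close>

lemma H1_trivial_nat:
  fixes B :: "('g, nat) ggroup"
  assumes "finite_ggroup \<Gamma> B" "coprime (order B) (order \<Gamma>)"
  shows "H1_trivial \<Gamma> B"
  using assms
proof (induction "order B" arbitrary: B rule: less_induct)
  case less
  interpret B: finite_ggroup \<Gamma> B by fact
  show ?case
  proof (cases "\<exists>N. N \<lhd> B \<and> gstable \<Gamma> B N \<and> N \<noteq> {\<one>\<^bsub>B\<^esub>} \<and> N \<noteq> carrier B")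
    case True
    then obtain N where N: "N \<lhd> B" "gstable \<Gamma> B N" "N \<noteq> {\<one>\<^bsub>B\<^esub>}" "N \<noteq> carrier B" by blast
    have sg: "subgroup N B" by (rule normal_imp_subgroup[OF N(1)])
    have NB: "N \<subset> carrier B" using subgroup.subset[OF sg] N(4) by blast
    have finN: "finite N" using NB finite_subset[OF _ B.finite_carrier] by blast
    have "{\<one>\<^bsub>B\<^esub>} \<subset> N" using subgroup.one_closed[OF sg] N(3) by blast
    then have N1: "card N > 1" using psubset_card_mono[OF finN, of "{\<one>\<^bsub>B\<^esub>}"] by simp
    have "order (gsub B N) < order B" using psubset_card_mono[OF B.finite_carrier NB] by (simp add: order_def)
    moreover have "coprime (order (gsub B N)) (order \<Gamma>)"
      by (rule coprime_divisors[OF B.finite_ggroup_gsub(2)[OF sg N(2)] dvd_refl less.prems(2)])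
    ultimately have HN: "H1_trivial \<Gamma> (gsub B N)"
      using less.hyps B.finite_ggroup_gsub(1)[OF sg N(2)] by blast
    note Q = B.finite_ggroup_gquot[OF group_\<Gamma> N(1,2)]
    interpret Q: finite_ggroup \<Gamma> "gquot B N" by (rule Q(1))
    \<comment> \<open>The induction runs over groups on natural numbers, while the quotient consists
      of cosets; the hypothesis is applied to a copy and carried back.\<close>
    obtain Q' :: "('g, nat) ggroup" where Q': "finite_ggroup \<Gamma> Q'" "giso \<Gamma> (gquot B N) Q'"
      using Q.ex_nat_copy[OF group_\<Gamma>] by blast
    have ord: "order Q' = order (gquot B N)" using giso_order[OF Q'(2)] by simp
    have "order (gquot B N) * 1 < order (gquot B N) * card N" using N1 Q.order_pos by (intro mult_strict_left_mono)
    then have "order Q' < order B" using Q(2) ord by simp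
    moreover have "coprime (order Q') (order \<Gamma>)"
      by (rule coprime_divisors[OF _ dvd_refl less.prems(2)]) (metis Q(2) ord dvd_triv_left)
    ultimately have HQ': "H1_trivial \<Gamma> Q'" using less.hyps Q'(1) by blast
    interpret Q': finite_ggroup \<Gamma> Q' by (rule Q'(1))
    have HQ: "H1_trivial \<Gamma> (gquot B N)"
      by (rule Q.H1_trivial_giso[OF group_\<Gamma> Q'.topological_ggroup_axioms Q'(2) HQ'])
    note \<pi> = B.quotient_projection[OF group_\<Gamma> N(1,2)]
    show ?thesis
    proof (rule B.H1_trivial_extension[OF group_\<Gamma> N(1,2) HN Q.topological_ggroup_axioms HQ \<pi>(1,3)])
      show "x \<in> N" if "x \<in> carrier B" "N #>\<^bsub>B\<^esub> x = \<one>\<^bsub>gquot B N\<^esub>" for x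
        using B.coset_join1[OF _ that(1) sg] that(2) by simp
    qed
  next
    case False
    then have simple: "N = {\<one>\<^bsub>B\<^esub>} \<or> N = carrier B" if "N \<lhd> B" "gstable \<Gamma> B N" for N using that by blast
    note K = B.commutator_normal[OF group_\<Gamma>]
    from simple[OF K(1,2)] show ?thesis
    proof
      assume 1: "closed_gsubgroup_gen \<Gamma> B {inv\<^bsub>B\<^esub> g \<otimes>\<^bsub>B\<^esub> gact B \<sigma> g | g \<sigma>. g \<in> carrier B \<and> \<sigma> \<in> carrier \<Gamma>} = {\<one>\<^bsub>B\<^esub>}"
      show ?thesis
      proof (rule B.H1_trivial_of_trivial_action[OF group_\<Gamma> finite_\<Gamma> less.prems(2)])
        fix g \<sigma> assume g: "g \<in> carrier B" "\<sigma> \<in> carrier \<Gamma>"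
        then have "inv\<^bsub>B\<^esub> g \<otimes>\<^bsub>B\<^esub> gact B \<sigma> g = \<one>\<^bsub>B\<^esub>" using K(3)[OF g] unfolding 1 by simp
        then show "gact B \<sigma> g = g" using g B.inv_mult_cancel_left(1)[of g "gact B \<sigma> g"] by simp
      qed
    next
      assume "closed_gsubgroup_gen \<Gamma> B {inv\<^bsub>B\<^esub> g \<otimes>\<^bsub>B\<^esub> gact B \<sigma> g | g \<sigma>. g \<in> carrier B \<and> \<sigma> \<in> carrier \<Gamma>} = carrier B"
      then have "admissible \<Gamma> B"
        using less.prems by (simp add: admissible_def pro_prime_finite_iff)
      then show ?thesis using H1_trivial_simple less.prems simple by blast
    qed
  qed
qed

lemma H1_trivial:
  assumes "finite_ggroup \<Gamma> B" "coprime (order B) (order \<Gamma>)"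
  shows "H1_trivial \<Gamma> B"
proof -
  interpret B: finite_ggroup \<Gamma> B by fact
  obtain B' :: "('g, nat) ggroup" where B': "finite_ggroup \<Gamma> B'" "giso \<Gamma> B B'"
    using B.ex_nat_copy[OF group_\<Gamma>] by blast
  interpret B': finite_ggroup \<Gamma> B' by (rule B')
  have "H1_trivial \<Gamma> B'" using H1_trivial_nat[OF B'(1)] giso_order[OF B'(2)] assms(2) by simp
  then show ?thesis by (rule B.H1_trivial_giso[OF group_\<Gamma> B'.topological_ggroup_axioms B'(2)])
qed

text \<open>The number of surjections is constant on each of countably many measurable pieces, so
  the integral is the series evaluated by \<open>expectation_sums\<close>. The non-negative integral
  yields integrability and value at once.\<close>

lemma nn_integral_card_gSur:
  assumes A: "finite_ggroup \<Gamma> A" "coprime (order A) (order \<Gamma>)" "admissible \<Gamma> A"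
  shows "(\<lambda>X. real (card (gSur_class \<Gamma> X A))) \<in> borel_measurable \<mu>"
    and "(\<integral>\<^sup>+X. ennreal (real (card (gSur_class \<Gamma> X A))) \<partial>\<mu>) = ennreal (1 / real (gindex \<Gamma> A) powi u)"
    and "\<And>X. X \<in> space \<mu> \<Longrightarrow> finite (gSur_class \<Gamma> X A)"
proof -
  interpret A: finite_ggroup \<Gamma> A by fact
  let ?b = "real (gindex \<Gamma> A)" and ?f = "\<lambda>X. real (card (gSur_class \<Gamma> X A))"
  have b0: "?b > 0" using A.gindex_pos by simp
  have z: "card (cocycles \<Gamma> A) = gindex \<Gamma> A"
    using A.card_cocycles_eq_gindex_iff[OF group_\<Gamma> finite_\<Gamma>] H1_trivial[OF A(1,2)] by simp
  obtain V s E where V: "disjoint_family V" "\<Union>(range V) = space \<mu>" "\<And>i. V i \<in> sets \<mu>"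
    "\<And>i X. X \<in> V i \<Longrightarrow> finite (gSur_class \<Gamma> X A) \<and> card (gSur_class \<Gamma> X A) = s i"
    and T: "tight_limit relator_space (relator_survivors A) E (\<lambda>i. measure \<mu> (V i)) s"
    using tight_limit[OF A(1,2)] by metis
  interpret T: tight_limit relator_space "relator_survivors A" E "\<lambda>i. measure \<mu> (V i)" s by (rule T)
  interpret \<mu>: prob_space \<mu> by (rule prob_space_mu)
  have sums: "(\<lambda>i. real (s i) * measure \<mu> (V i)) sums (1 / ?b powi u)"
  proof (rule T.expectation_sums)
    have "(\<lambda>n. card (gSur \<Gamma> (Fn \<Gamma> gs n) A) / ?b ^ n * (1 / ?b powi u)) \<longlonglongrightarrow> 1 * (1 / ?b powi u)"
      using card_gSur_asymptotics[OF A] unfolding z by (intro tendsto_intros)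
    moreover have "eventually (\<lambda>n. card (gSur \<Gamma> (Fn \<Gamma> gs n) A) / ?b ^ n * (1 / ?b powi u) =
        (\<integral>r. real (relator_survivors A n r) \<partial>relator_space n)) sequentially"
      using gindex_power_relators[OF A(1)] by (rule eventually_mono) (simp add: survivors_mean[OF A(1)])
    ultimately show "(\<lambda>n. \<integral>r. real (relator_survivors A n r) \<partial>relator_space n) \<longlonglongrightarrow> 1 / ?b powi u"
      by (simp add: tendsto_cong)
    \<comment> \<open>The bound is the same for all n, since \<open>square\<close> depends on A
      alone. It uses H^1 for every \<Gamma>-subgroup of A \<times> A, each of order prime to that of
      \<Gamma>.\<close>
    show "eventually (\<lambda>n. (\<integral>r. (real (relator_survivors A n r))\<^sup>2 \<partial>relator_space n) \<le>
        (\<Sum>D\<in>gsubs \<Gamma> (haar_Fn.square A). 1 / real (gindex \<Gamma> (gsub (haar_Fn.square A) D)) powi u)) sequentially"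
      using eventually_relators
    proof (rule eventually_mono)
      fix n assume k: "int (relators n) = int n + u"
      interpret F: haar_Fn \<Gamma> gs n "\<nu> n" by (rule haar_Fn)
      interpret S: finite_ggroup \<Gamma> "F.square A" by (rule F.finite_ggroup_square[OF A(1)])
      have "coprime (order (F.square A)) (order \<Gamma>)" using A(2) by (simp add: F.order_square[OF A(1)])
      then have "H1_trivial \<Gamma> (gsub (F.square A) D)" if "D \<in> gsubs \<Gamma> (F.square A)" for D
        using S.finite_ggroup_gsub[of D] that coprime_divisors[OF _ dvd_refl] by (intro H1_trivial) (auto simp: gsubs_def)
      from F.survivors_second_moment_le[OF A(1,2) k this]
      show "(\<integral>r. (real (relator_survivors A n r))\<^sup>2 \<partial>relator_space n) \<le>
        (\<Sum>D\<in>gsubs \<Gamma> (F.square A). 1 / real (gindex \<Gamma> (gsub (F.square A) D)) powi u)"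
        by (simp add: relator_space_def relator_survivors_def)
    qed
  qed
  have f: "?f X = real (s i)" if "X \<in> V i" for X i using V(4)[OF that] by simp
  have fX: "ennreal (?f X) = (\<Sum>i. ennreal (real (s i)) * indicator (V i) X)" if "X \<in> space \<mu>" for X
  proof -
    obtain i where i: "X \<in> V i" using \<open>X \<in> space \<mu>\<close> unfolding V(2)[symmetric] by blast
    show ?thesis using suminf_cmult_indicator[OF V(1) i, of "\<lambda>i. ennreal (real (s i))"] f[OF i] by simp
  qed
  have "(\<lambda>X. \<Sum>i. ennreal (real (s i)) * indicator (V i) X) \<in> borel_measurable \<mu>"
    using V(3) by (intro borel_measurable_suminf_order borel_measurable_times borel_measurable_indicator) auto
  then have "(\<lambda>X. ennreal (?f X)) \<in> borel_measurable \<mu>" using fX by (simp cong: measurable_cong)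
  then have "(\<lambda>X. enn2real (ennreal (?f X))) \<in> borel_measurable \<mu>" by measurable
  then show "?f \<in> borel_measurable \<mu>" by simp
  have "(\<integral>\<^sup>+X. ennreal (?f X) \<partial>\<mu>) = (\<integral>\<^sup>+X. (\<Sum>i. ennreal (real (s i)) * indicator (V i) X) \<partial>\<mu>)"
    by (rule nn_integral_cong) (rule fX)
  also have "\<dots> = (\<Sum>i. \<integral>\<^sup>+X. ennreal (real (s i)) * indicator (V i) X \<partial>\<mu>)"
    using V(3) by (intro nn_integral_suminf borel_measurable_times borel_measurable_indicator) auto
  also have "\<dots> = (\<Sum>i. ennreal (real (s i) * measure \<mu> (V i)))"
    using V(3) by (simp add: nn_integral_cmult_indicator \<mu>.emeasure_eq_measure ennreal_mult')
  also have "\<dots> = ennreal (1 / ?b powi u)"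
    using sums by (intro suminf_ennreal_eq) auto
  finally show "(\<integral>\<^sup>+X. ennreal (?f X) \<partial>\<mu>) = ennreal (1 / ?b powi u)" .
  show "finite (gSur_class \<Gamma> X A)" if "X \<in> space \<mu>" for X
  proof -
    obtain i where "X \<in> V i" using \<open>X \<in> space \<mu>\<close> unfolding V(2)[symmetric] by blast
    then show ?thesis using V(4) by blast
  qed
qed

end

theorem theorem6p2:
  fixes \<Gamma> :: "'g monoid" and gs :: "'g list"
    and \<nu> :: "nat \<Rightarrow> 'g free_elem measure"
    and u :: int and \<mu> :: "'g gclass measure"
    and \<Omega> :: "'w measure" and X :: "'w \<Rightarrow> 'g gclass"
    and A :: "('g, 'a) ggroup"
  assumes "group \<Gamma>" and "finite (carrier \<Gamma>)"
    and "set gs \<subseteq> carrier \<Gamma>" and "generate \<Gamma> (set gs) = carrier \<Gamma>"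
    and "\<And>n. haar_prob (Fn \<Gamma> gs n) (\<nu> n)"
    and "is_mu \<Gamma> gs \<nu> u \<mu>"
    and "prob_space \<Omega>" and "X \<in> \<Omega> \<rightarrow>\<^sub>M borel_of (P_top \<Gamma>)"
    and "distr \<Omega> (borel_of (P_top \<Gamma>)) X = \<mu>"
    and "admissible \<Gamma> A" and "finite (carrier A)"
  shows "(AE \<omega> in \<Omega>. finite (gSur_class \<Gamma> (X \<omega>) A)) \<and>
         has_bochner_integral \<Omega> (\<lambda>\<omega>. real (card (gSur_class \<Gamma> (X \<omega>) A)))
           (1 / real (card (rcosets\<^bsub>A\<^esub> (ginvariants \<Gamma> A))) powi u)"
proof -
  interpret mu_moments \<Gamma> gs \<nu> u \<mu>
    by (intro mu_moments.intro generated_finite_group.intro generated_finite_group_axioms.intro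
        mu_moments_axioms.intro assms)
  have A: "finite_ggroup \<Gamma> A" "coprime (order A) (order \<Gamma>)"
    using assms(10) pro_prime_finite_iff[OF assms(11), of \<Gamma>] by (simp_all add: admissible_def)
  note f = nn_integral_card_gSur[OF A assms(10)]
  have X: "X \<in> \<Omega> \<rightarrow>\<^sub>M \<mu>" using assms(8) measurable_cong_sets[OF refl sets_mu] by blast
  have \<mu>: "\<mu> = distr \<Omega> \<mu> X" using assms(9) by (metis distr_cong sets_mu)
  have "has_bochner_integral \<Omega> (\<lambda>\<omega>. real (card (gSur_class \<Gamma> (X \<omega>) A))) (1 / real (gindex \<Gamma> A) powi u)"
  proof (rule has_bochner_integral_nn_integral)
    show "(\<lambda>\<omega>. real (card (gSur_class \<Gamma> (X \<omega>) A))) \<in> borel_measurable \<Omega>"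
      using measurable_compose[OF X f(1)] .
    have "(\<integral>\<^sup>+\<omega>. ennreal (real (card (gSur_class \<Gamma> (X \<omega>) A))) \<partial>\<Omega>) =
        (\<integral>\<^sup>+x. ennreal (real (card (gSur_class \<Gamma> x A))) \<partial>distr \<Omega> \<mu> X)"
      using f(1) by (subst nn_integral_distr[OF X]) auto
    also have "\<dots> = ennreal (1 / real (gindex \<Gamma> A) powi u)" using f(2) \<mu> by simp
    finally show "(\<integral>\<^sup>+\<omega>. ennreal (real (card (gSur_class \<Gamma> (X \<omega>) A))) \<partial>\<Omega>) =
        ennreal (1 / real (gindex \<Gamma> A) powi u)" .
  qed auto
  moreover have "AE \<omega> in \<Omega>. finite (gSur_class \<Gamma> (X \<omega>) A)"
    using measurable_space[OF X] f(3) by (intro AE_I2) blast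
  ultimately show ?thesis by (simp add: gindex_def)
qed

end
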